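(* There exist universal (absolute) constants $C_3,C_4,C_5>0$ such that the following holds. Let $q\in(1,2]$, $\epsilon\in(0,1]$ and $\beta\in(0,1)$. Let $\widehat{\mathbf x}$ be a $(\delta,q)$-approximate solution to the regularized SAA problem $\min_{\mathbf x\in\mathcal X}F_{\lambda_0,N}(\mathbf x)$ with parameters $q'\in(1,2]$ with $q'\le q$, $R^*\ge\max\{1,\mathcal D_{q'}^2\}$, $\lambda_0=\frac{\epsilon}{2R^*}$ and $\delta\le\frac1N$. Suppose that $N\ge3$, that $f(\cdot,\xi)$ is convex on $B$ for every $\xi\in\Xi$, and that $\mathcal X$ is bounded with $q'$-norm diameter $\mathcal D_{q'}$, i.e. $\sup_{\mathbf x_1,\mathbf x_2\in\mathcal X}\|\mathbf x_1-\mathbf x_2\|_{q'}\le\mathcal D_{q'}$. Suppose also that there is a deterministic $\mathcal B(\Xi)$-measurable function $M:\Xi\to\mathbb R_+$ such that $$|f(\mathbf x,\xi)-f(\mathbf y,\xi)|\le M(\xi)\,\|\mathbf x-\mathbf y\|_q\qquad\text{for all }\mathbf x,\mathbf y\in\mathcal X\text{ and every }\xi\in\Xi .$$ (a) If, for some $p>2$ and $\psi_M\ge1$, $\|M(\xi)\|_{L^p}\le\psi_M$, then $\Pr[F(\widehat{\mathbf x})-F(\mathbf x^* )\le\epsilon]\ge1-\beta$ whenever $$N\ge\left(C_3\cdot\frac{\psi_M^2}{\epsilon^2}\cdot B_{N,\beta,q'}\cdot R^*\right)^{\frac{p}{p-2}}\beta^{-\frac{2}{p-2}}+\left(C_3\cdot\frac{p\,\mathcal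 D_{q'}}{p-1}\cdot\frac{\psi_M}{\epsilon}\right)^{\frac{p}{p-1}}\beta,\qquad B_{N,\beta,q'}:=\frac{1}{q'-1}\ln N\cdot\ln\frac N\beta .$$ (b) If, for some $\varphi\ge1$, $\Pr[M(\xi)\ge t]\le2\exp(-t/\varphi)$ for all $t\ge0$, then $\Pr[F(\widehat{\mathbf x})-F(\mathbf x^* )\le\epsilon]\ge1-\beta$ whenever $$N\ge C_4\cdot R^*\cdot\frac{\varphi^2}{\epsilon^2}\cdot\frac{\ln N\cdot\ln^3(N/\beta)}{q'-1}.$$ (c) If, for some $\varphi\ge1$, $\Pr[M(\xi)\ge t]\le2\exp(-t^2/\varphi^2)$ for all $t\ge0$, then $\Pr[F(\widehat{\mathbf x})-F(\mathbf x^* )\le\epsilon]\ge1-\beta$ whenever $$N\ge C_5\cdot R^*\cdot\frac{\varphi^2}{\epsilon^2}\cdot\frac{\ln N\cdot\ln^2(N/\beta)}{q'-1}.$$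
   Context: Setting. $(\Omega,\mathcal F,\Pr)$ is a complete probability space, $\Xi$ is a Borel subset of $\mathbb R^m$, and $\xi$ is a $\Xi$-valued random vector with distribution $P$. $B\subseteq\mathbb R^d$ is open and convex, $\mathcal X\subseteq B$ is non-empty, closed and convex, and $f:B\times\Xi\to\mathbb R$ is $\mathcal B(B)\otimes\mathcal B(\Xi)$-measurable. $F(\mathbf x):=\mathbb E[f(\mathbf x,\xi)]$ is well-defined and finite for all $\mathbf x\in\mathcal X$ and admits a minimizer $\mathbf x^*$ on $\mathcal X$. $\partial$ denotes the subdifferential of convex analysis, $\|\cdot\|_p$ the usual $p$-norm on $\mathbb R^d$, and $\|M(\xi)\|_{L^p}=(\mathbb E[|M(\xi)|^p])^{1/p}$. Regularized SAA. For a positive integer $N$, $\boldsymbol\xi_{1,N}=(\xi_1,\dots,\xi_N)$ is an i.i.d. sample of $\xi$ and $F_N(\mathbf x):=N^{-1}\sum_{j=1}^Nf(\mathbf x,\xi_j)$. For $q'\in(1,2]$ and a fixed initial guess $\mathbf x^0\in\mathcal X$, $V_{q'}(\mathbf x):=\frac12\|\mathbf x-\mathbf x^0\|_{q'}^2$, and $F_{\lambda_0,N}(\mathbf x):=F_N(\mathbf x)+\lambda_0V_{q'}(\mathbf x)$. Approximate solution. For $q\ge1$ and $\delta\ge0$, a random vector $\widehat{\mathbf x}=\widetilde{\mathbf x}(\boldsymbol\xi_{1,N})\in\mathcal X$ is a $(\delta,q)$-approximate solution to $\min_{\mathbf x\in\mathcal X}F_{\lambda_0,N}(\mathbf x)$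 if $\widetilde{\mathbf x}:\Xi^N\to\mathcal X$ is a deterministic $\mathcal B(\Xi^N)$-measurable function such that, for every value of the sample $\boldsymbol\xi_{1,N}\in\Xi^N$ and some $\mathbf g\in\partial F_{\lambda_0,N}(\widetilde{\mathbf x}(\boldsymbol\xi_{1,N}))$, $\langle\mathbf g,\mathbf x-\widetilde{\mathbf x}(\boldsymbol\xi_{1,N})\rangle\ge-\delta\|\mathbf x-\widetilde{\mathbf x}(\boldsymbol\xi_{1,N})\|_q$ for all $\mathbf x\in\mathcal X$. *)

theory Defs
  imports "HOL-Probability.Probability"
begin

text \<open>
  The constants of the theorem must not depend on the dimensions, so the dimension of
  Euclidean space has to be a term that can be quantified over, not a type. The space
  \<open>\<real>\<^sup>n\<close> is therefore the set of real functions on the index set \<open>{0, \<dots>, n - 1}\<close>, taking the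
  value \<^const>\<open>undefined\<close> outside it (as the library's product spaces do). Its topology is the
  product topology, and its Borel sets are given by the product sigma-algebra, which agrees
  with the sigma-algebra generated by the open sets because there are finitely many factors.
\<close>

type_synonym rvec = "nat \<Rightarrow> real"

definition Rn :: "nat \<Rightarrow> rvec set" where
  "Rn n = (\<Pi>\<^sub>E i\<in>{..<n}. UNIV)"

definition Rn_top :: "nat \<Rightarrow> rvec topology" where
  "Rn_top n = product_topology (\<lambda>_. euclideanreal) {..<n}"

definition Rn_borel :: "nat \<Rightarrow> rvec measure" where
  "Rn_borel n = (\<Pi>\<^sub>M i\<in>{..<n}. borel)"

definition Borel_on :: "nat \<Rightarrow> rvec set \<Rightarrow> rvec measure" where
  "Borel_on n S = restrict_space (Rn_borel n) S"

definition lincomb :: "nat \<Rightarrow> real \<Rightarrow> rvec \<Rightarrow> real \<Rightarrow> rvec \<Rightarrow> rvec" where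
  "lincomb n a x b y = (\<lambda>i\<in>{..<n}. a * x i + b * y i)"

definition vdiff :: "nat \<Rightarrow> rvec \<Rightarrow> rvec \<Rightarrow> rvec" where
  "vdiff n x y = (\<lambda>i\<in>{..<n}. x i - y i)"

definition dot :: "nat \<Rightarrow> rvec \<Rightarrow> rvec \<Rightarrow> real" where
  "dot n x y = (\<Sum>i<n. x i * y i)"

definition pnorm :: "nat \<Rightarrow> real \<Rightarrow> rvec \<Rightarrow> real" where
  "pnorm n p x = (\<Sum>i<n. \<bar>x i\<bar> powr p) powr (1 / p)"

definition convex_Rn :: "nat \<Rightarrow> rvec set \<Rightarrow> bool" where
  "convex_Rn n S \<longleftrightarrow>
    S \<subseteq> Rn n \<and> (\<forall>x\<in>S. \<forall>y\<in>S. \<forall>u\<ge>0. \<forall>v\<ge>0. u + v = 1 \<longrightarrow> lincomb n u x v y \<in> S)"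

definition convex_on_Rn :: "nat \<Rightarrow> rvec set \<Rightarrow> (rvec \<Rightarrow> real) \<Rightarrow> bool" where
  "convex_on_Rn n S h \<longleftrightarrow> convex_Rn n S \<and>
    (\<forall>x\<in>S. \<forall>y\<in>S. \<forall>u\<ge>0. \<forall>v\<ge>0. u + v = 1 \<longrightarrow> h (lincomb n u x v y) \<le> u * h x + v * h y)"

definition subdifferential :: "nat \<Rightarrow> rvec set \<Rightarrow> (rvec \<Rightarrow> real) \<Rightarrow> rvec \<Rightarrow> rvec set" where
  "subdifferential n S h x = {g \<in> Rn n. \<forall>y\<in>S. h y \<ge> h x + dot n g (vdiff n y x)}"

definition expected_value ::
    "'w measure \<Rightarrow> ('w \<Rightarrow> rvec) \<Rightarrow> (rvec \<Rightarrow> rvec \<Rightarrow> real) \<Rightarrow> rvec \<Rightarrow> real" where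
  "expected_value \<Omega> \<xi> f x = (\<integral>\<omega>. f x (\<xi> \<omega>) \<partial>\<Omega>)"

locale stochastic_program =
  prob_space \<Omega> + complete_measure \<Omega> for \<Omega> :: "'w measure" +
  fixes m d :: nat
    and \<Xi> :: "rvec set"
    and \<xi> :: "'w \<Rightarrow> rvec"
    and B X :: "rvec set"
    and f :: "rvec \<Rightarrow> rvec \<Rightarrow> real"
    and xstar :: rvec
  assumes Xi_borel: "\<Xi> \<in> sets (Rn_borel m)"
    and xi_measurable: "\<xi> \<in> measurable \<Omega> (Borel_on m \<Xi>)"
    and B_open: "openin (Rn_top d) B"
    and B_convex: "convex_Rn d B"
    and X_subset: "X \<subseteq> B"
    and X_nonempty: "X \<noteq> {}"
    and X_closed: "closedin (Rn_top d) X"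
    and X_convex: "convex_Rn d X"
    and f_measurable:
      "(\<lambda>(x, z). f x z) \<in> borel_measurable (Borel_on d B \<Otimes>\<^sub>M Borel_on m \<Xi>)"
    and F_finite: "\<And>x. x \<in> X \<Longrightarrow> integrable \<Omega> (\<lambda>\<omega>. f x (\<xi> \<omega>))"
    and xstar_in_X: "xstar \<in> X"
    and xstar_minimizer:
      "\<And>x. x \<in> X \<Longrightarrow> expected_value \<Omega> \<xi> f xstar \<le> expected_value \<Omega> \<xi> f x"

definition iid_sample ::
    "'w measure \<Rightarrow> rvec measure \<Rightarrow> ('w \<Rightarrow> rvec) \<Rightarrow> nat \<Rightarrow> (nat \<Rightarrow> 'w \<Rightarrow> rvec) \<Rightarrow> bool" where
  "iid_sample \<Omega> S \<xi> N \<xi>s \<longleftrightarrow>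
    prob_space.indep_vars \<Omega> (\<lambda>_. S) \<xi>s {1..N} \<and>
    (\<forall>j\<in>{1..N}. distr \<Omega> S (\<xi>s j) = distr \<Omega> S \<xi>)"

definition sample :: "nat \<Rightarrow> (nat \<Rightarrow> 'w \<Rightarrow> rvec) \<Rightarrow> 'w \<Rightarrow> nat \<Rightarrow> rvec" where
  "sample N \<xi>s \<omega> = (\<lambda>j\<in>{1..N}. \<xi>s j \<omega>)"

definition SAA :: "(rvec \<Rightarrow> rvec \<Rightarrow> real) \<Rightarrow> nat \<Rightarrow> (nat \<Rightarrow> rvec) \<Rightarrow> rvec \<Rightarrow> real" where
  "SAA f N s x = (1 / real N) * (\<Sum>j=1..N. f x (s j))"

definition regularizer :: "nat \<Rightarrow> real \<Rightarrow> rvec \<Rightarrow> rvec \<Rightarrow> real" where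
  "regularizer d q' x0 x = (1 / 2) * (pnorm d q' (vdiff d x x0))\<^sup>2"

definition regularized_SAA ::
    "nat \<Rightarrow> (rvec \<Rightarrow> rvec \<Rightarrow> real) \<Rightarrow> real \<Rightarrow> rvec \<Rightarrow> real \<Rightarrow> nat \<Rightarrow> (nat \<Rightarrow> rvec) \<Rightarrow> rvec \<Rightarrow> real" where
  "regularized_SAA d f q' x0 lam0 N s x = SAA f N s x + lam0 * regularizer d q' x0 x"

text \<open>
  The subdifferential is that of the regularized objective as a function on \<open>B\<close>, which is where
  \<open>f\<close> is defined; the variational inequality ranges over \<open>X\<close> only.
\<close>

definition approximate_solution ::
    "nat \<Rightarrow> nat \<Rightarrow> rvec set \<Rightarrow> rvec set \<Rightarrow> rvec set \<Rightarrow> (rvec \<Rightarrow> rvec \<Rightarrow> real) \<Rightarrow> real \<Rightarrow> rvec \<Rightarrow> real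
      \<Rightarrow> nat \<Rightarrow> real \<Rightarrow> real \<Rightarrow> ((nat \<Rightarrow> rvec) \<Rightarrow> rvec) \<Rightarrow> bool" where
  "approximate_solution m d \<Xi> B X f q' x0 lam0 N \<delta> q xt \<longleftrightarrow>
    xt \<in> measurable (\<Pi>\<^sub>M j\<in>{1..N}. Borel_on m \<Xi>) (Borel_on d X) \<and>
    (\<forall>s \<in> (\<Pi>\<^sub>E j\<in>{1..N}. \<Xi>). xt s \<in> X \<and>
      (\<exists>g \<in> subdifferential d B (regularized_SAA d f q' x0 lam0 N s) (xt s).
        \<forall>x\<in>X. dot d g (vdiff d x (xt s)) \<ge> - \<delta> * pnorm d q (vdiff d x (xt s))))"

text \<open>
  A Bochner integral of a non-integrable function is \<open>0\<close>, so integrability of the \<open>p\<close>-th power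
  is part of the bound on the \<open>L\<^sup>p\<close> norm.
\<close>

definition Lp_norm_le :: "'w measure \<Rightarrow> real \<Rightarrow> ('w \<Rightarrow> real) \<Rightarrow> real \<Rightarrow> bool" where
  "Lp_norm_le \<Omega> p Y c \<longleftrightarrow>
    integrable \<Omega> (\<lambda>\<omega>. \<bar>Y \<omega>\<bar> powr p) \<and> (\<integral>\<omega>. \<bar>Y \<omega>\<bar> powr p \<partial>\<Omega>) powr (1 / p) \<le> c"

text \<open>
  The first argument only fixes the type of the points of the probability space; the real
  arguments are candidates for the three constants. Since \<open>\<exists>C3 C4 C5\<close> in front of a formula with a
  free type \<open>'w\<close> would let the constants vary with \<open>'w\<close>, their existence is to be asserted at the
  closed type \<open>nat \<Rightarrow> nat \<Rightarrow> real\<close>, which can carry any joint law of \<open>\<xi>, \<xi>\<^sub>1, \<dots>, \<xi>\<^sub>N\<close>, together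
  with the claim that constants valid there are valid at every other type. The number \<open>D\<close> is an upper bound for the
  \<open>q'\<close>-norm diameter of \<open>X\<close>.
\<close>

definition sample_complexity_constants :: "'w itself \<Rightarrow> real \<Rightarrow> real \<Rightarrow> real \<Rightarrow> bool" where
  "sample_complexity_constants T C3 C4 C5 \<longleftrightarrow>
    (\<forall>(\<Omega> :: 'w measure) m d \<Xi> \<xi> B X f xstar x0 N \<xi>s q \<epsilon> \<beta> q' D R lam0 \<delta> xt M.
      stochastic_program \<Omega> m d \<Xi> \<xi> B X f xstar \<longrightarrow>
      x0 \<in> X \<longrightarrow>
      iid_sample \<Omega> (Borel_on m \<Xi>) \<xi> N \<xi>s \<longrightarrow>
      1 < q \<longrightarrow> q \<le> 2 \<longrightarrow> 0 < \<epsilon> \<longrightarrow> \<epsilon> \<le> 1 \<longrightarrow> 0 < \<beta> \<longrightarrow> \<beta> < 1 \<longrightarrow>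
      1 < q' \<longrightarrow> q' \<le> 2 \<longrightarrow> q' \<le> q \<longrightarrow>
      R \<ge> max 1 (D\<^sup>2) \<longrightarrow> lam0 = \<epsilon> / (2 * R) \<longrightarrow> 0 \<le> \<delta> \<longrightarrow> \<delta> \<le> 1 / real N \<longrightarrow>
      approximate_solution m d \<Xi> B X f q' x0 lam0 N \<delta> q xt \<longrightarrow>
      3 \<le> N \<longrightarrow>
      (\<forall>z\<in>\<Xi>. convex_on_Rn d B (\<lambda>x. f x z)) \<longrightarrow>
      (\<forall>x1\<in>X. \<forall>x2\<in>X. pnorm d q' (vdiff d x1 x2) \<le> D) \<longrightarrow>
      M \<in> borel_measurable (Borel_on m \<Xi>) \<longrightarrow>
      (\<forall>z\<in>\<Xi>. 0 \<le> M z) \<longrightarrow>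
      (\<forall>x\<in>X. \<forall>y\<in>X. \<forall>z\<in>\<Xi>. \<bar>f x z - f y z\<bar> \<le> M z * pnorm d q (vdiff d x y)) \<longrightarrow>
      (let
         F = expected_value \<Omega> \<xi> f;
         success = measure \<Omega> {\<omega> \<in> space \<Omega>. F (xt (sample N \<xi>s \<omega>)) - F xstar \<le> \<epsilon>} \<ge> 1 - \<beta>
       in
         (\<forall>p \<psi>. 2 < p \<longrightarrow> 1 \<le> \<psi> \<longrightarrow> Lp_norm_le \<Omega> p (\<lambda>\<omega>. M (\<xi> \<omega>)) \<psi> \<longrightarrow>
           (let BN = 1 / (q' - 1) * ln (real N) * ln (real N / \<beta>) in
             real N \<ge> (C3 * (\<psi>\<^sup>2 / \<epsilon>\<^sup>2) * BN * R) powr (p / (p - 2)) * \<beta> powr (- 2 / (p - 2))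
                      + (C3 * (p * D / (p - 1)) * (\<psi> / \<epsilon>)) powr (p / (p - 1)) * \<beta>) \<longrightarrow>
           success) \<and>
         (\<forall>\<phi>. 1 \<le> \<phi> \<longrightarrow>
           (\<forall>t\<ge>0. measure \<Omega> {\<omega> \<in> space \<Omega>. M (\<xi> \<omega>) \<ge> t} \<le> 2 * exp (- t / \<phi>)) \<longrightarrow>
           real N \<ge> C4 * R * (\<phi>\<^sup>2 / \<epsilon>\<^sup>2) * (ln (real N) * (ln (real N / \<beta>)) ^ 3 / (q' - 1)) \<longrightarrow>
           success) \<and>
         (\<forall>\<phi>. 1 \<le> \<phi> \<longrightarrow>
           (\<forall>t\<ge>0. measure \<Omega> {\<omega> \<in> space \<Omega>. M (\<xi> \<omega>) \<ge> t} \<le> 2 * exp (- t\<^sup>2 / \<phi>\<^sup>2)) \<longrightarrow>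
           real N \<ge> C5 * R * (\<phi>\<^sup>2 / \<epsilon>\<^sup>2) * (ln (real N) * (ln (real N / \<beta>))\<^sup>2 / (q' - 1)) \<longrightarrow>
           success)))"

end

theory Submission
  imports Defs
begin

text \<open>
  Truncating \<open>M(\<xi>)\<close> at a level \<open>L\<close> that all of \<open>M(\<xi>\<^sub>1), \<dots>, M(\<xi>\<^sub>N)\<close> stay below with probability
  at least \<open>1 - \<beta>/2\<close> reduces the claim to an \<open>L\<close>-Lipschitz integrand, at the price of an error of
  order \<open>D E[M(\<xi>); M(\<xi>) > L]\<close>. Since \<open>V\<close> is \<open>(q' - 1)\<close>-strongly convex for the \<open>q'\<close>-norm (Ball, Carlen
  and Lieb), an approximate solution moves by at most \<open>O(R L / (\<epsilon> (q' - 1) N))\<close> when one sample point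
  is replaced. It is thus a uniformly stable algorithm with stability constant
  \<open>\<gamma> = O(R L\<^sup>2 / (\<epsilon> (q' - 1) N))\<close>, and its generalization gap is at most
  \<open>O(\<gamma> ln N ln (1/\<beta>) + L \<surd>R \<surd>(ln (1/\<beta>) / N))\<close> by the theorem of Bousquet, Klochkov and
  Zhivotovskiy. Conditional expectations on the product space are expressed by averaging over sets of
  coordinates, and moment bounds by bounds on the mean of \<open>exp (f / K)\<close>.
\<close>

text \<open>Stability has to hold for every pair of samples, while \<open>M\<close> is unbounded,
  and cutting off the values of \<open>f\<close> would destroy convexity. So truncation acts on the
  sample points: a point with \<open>M z > L\<close> is sent to a fixed \<open>z0\<close> with
  \<open>M z0 \<le> L\<close>. Composing \<open>f\<close> and the solution map with this map keeps
  convexity and measurability and, since approximate optimality is demanded at every sample value,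
  yields an approximate solution again. A bound uniform over \<open>X\<close> would in general bring
  in the dimension; hence the gap is bounded only for the output of the stable map.

  The error \<epsilon> is spent in quarters: truncation, regularization (\<open>lam0\<close> times
  at most \<open>R / 2\<close>), the inexactness \<delta> times \<open>D\<close>, and the
  generalization gap. The probability \<beta> is shared equally by the events that some sample point
  exceeds \<open>L\<close> and that the gap bound fails. The basic constant is 25000 for an
  \<open>L\<close>-Lipschitz problem; the three final ones are 2, 9 and 3 times it, the factors in
  the bounds of \<open>L^2\<close> by \<psi>^2 (N/\<beta>)^(2/p), (\<phi> b)^2 and \<phi>^2 b, where
  b = ln (N/\<beta>).\<close>

section \<open>Elementary inequalities for the exponential function\<close>

text \<open>On [-1, 1] the bound 1 + x + x^2 lies in between; outside, x + x^2 \<ge> 0 or x \<le>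
  x^2 suffices. When \<open>x\<close> is centred, the linear term disappears under averaging and
  only the square is left; all the exponential moment bounds below rest on this.\<close>

lemma exp_le_plus_exp_square: "exp x \<le> x + exp (x\<^sup>2)" for x :: real
proof -
  have sq: "1 + x\<^sup>2 \<le> exp (x\<^sup>2)"
    by simp
  consider "x \<ge> 1" | "0 \<le> x" "x \<le> 1" | "-1 \<le> x" "x \<le> 0" | "x \<le> -1"
    by linarith
  then show ?thesis
  proof cases
    case 1
    then have "x \<le> x\<^sup>2"
      by (simp add: power2_eq_square mult_le_cancel_left1)
    then have "exp x \<le> exp (x\<^sup>2)"
      by simp
    with 1 show ?thesis
      by linarith
  next
    case 2
    then show ?thesis
      using exp_bound[of x] sq by linarith
  next
    case 3
    \<comment> \<open>Against 1 - x \<le> exp (-x) this factorization gives exp x \<le> 1 + x + x^2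
      for negative \<open>x\<close>.\<close>
    have "(1 + x + x\<^sup>2) * (1 - x) = 1 - x ^ 3"
      by (simp add: power2_eq_square power3_eq_cube algebra_simps)
    moreover have "x ^ 3 \<le> 0"
      using 3 by (simp add: power3_eq_cube mult_nonneg_nonpos zero_le_mult_iff mult_le_0_iff)
    ultimately have *: "1 \<le> (1 + x + x\<^sup>2) * (1 - x)"
      by simp
    have "1 \<le> (1 + x + x\<^sup>2) * exp (- x)"
    proof -
      have "1 - x \<le> exp (- x)"
        using exp_ge_add_one_self[of "-x"] by simp
      moreover have "0 \<le> 1 + x + x\<^sup>2"
        using 3 by simp
      ultimately show ?thesis
        using * by (meson mult_left_mono order_trans)
    qed
    then have "exp x \<le> (1 + x + x\<^sup>2)"
      by (simp add: exp_minus field_simps)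
    with sq show ?thesis by linarith
  next
    case 4
    then have "x * (x + 1) \<ge> 0"
      by (simp add: mult_nonpos_nonpos)
    then have "x + x\<^sup>2 \<ge> 0"
      by (simp add: power2_eq_square algebra_simps)
    moreover have "exp x \<le> 1"
      using 4 by simp
    ultimately show ?thesis
      using sq by linarith
  qed
qed

text \<open>Completing the square, the summand for the integer nearest to \<open>\<bar>x\<bar>\<close> is large enough.\<close>

lemma exp_half_square_le_sum:
  fixes x :: real
  assumes "\<bar>x\<bar> \<le> real m"
  shows "exp (x\<^sup>2 / 2) \<le> exp (1 / 8) * (\<Sum>k\<le>m. exp (- (real k)\<^sup>2 / 2) * (exp (real k * x) + exp (- (real k * x))))"
proof -
  define k where "k = nat (round \<bar>x\<bar>)"
  have r0: "round \<bar>x\<bar> \<ge> 0"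
    by (metis abs_ge_zero round_0 round_mono)
  have "round \<bar>x\<bar> \<le> int m"
    by (metis assms round_mono round_of_nat)
  then have km: "k \<le> m"
    by (simp add: k_def)
  have rk: "real k = of_int (round \<bar>x\<bar>)"
    using r0 by (simp add: k_def)
  have "\<bar>real k - \<bar>x\<bar>\<bar> \<le> 1 / 2"
    unfolding rk by (rule of_int_round_abs_le)
  \<comment> \<open>The rounding error of at most 1/2 is what costs the factor exp (1/8).\<close>
  then have "(real k - \<bar>x\<bar>)\<^sup>2 \<le> (1 / 2)\<^sup>2"
    by (metis abs_ge_zero power2_abs power_mono)
  then have "x\<^sup>2 / 2 \<le> 1 / 8 + (- (real k)\<^sup>2 / 2 + real k * \<bar>x\<bar>)"
    by (simp add: power2_diff power_divide)
  then have "exp (x\<^sup>2 / 2) \<le> exp (1 / 8) * (exp (- (real k)\<^sup>2 / 2) * exp (real k * \<bar>x\<bar>))"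
    by (simp flip: exp_add)
  also have "\<dots> \<le> exp (1 / 8) * (exp (- (real k)\<^sup>2 / 2) * (exp (real k * x) + exp (- (real k * x))))"
    by (intro mult_left_mono) (auto simp: abs_if)
  also have "\<dots> \<le> exp (1 / 8) * (\<Sum>k\<le>m. exp (- (real k)\<^sup>2 / 2) * (exp (real k * x) + exp (- (real k * x))))"
    using km by (intro mult_left_mono member_le_sum) auto
  finally show ?thesis .
qed

text \<open>Jensen's inequality for the uniform average of the numbers \<open>card A * y i\<close>.
  It lets dependent summands be averaged one at a time, at the price of the factor
  \<open>card A\<close> in the exponent.\<close>

lemma exp_sum_le_average:
  fixes y :: "'i \<Rightarrow> real"
  assumes "finite A" "A \<noteq> {}"
  shows "exp (\<Sum>i\<in>A. y i) \<le> (\<Sum>i\<in>A. exp (real (card A) * y i)) / real (card A)"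
proof -
  have c: "card A > 0"
    using assms by (simp add: card_gt_0_iff)
  have "exp (\<Sum>i\<in>A. (1 / real (card A)) *\<^sub>R (real (card A) * y i))
      \<le> (\<Sum>i\<in>A. (1 / real (card A)) * exp (real (card A) * y i))"
    using assms c by (intro convex_on_sum[OF _ _ exp_convex]) auto
  then show ?thesis
    using c by (simp add: sum_divide_distrib)
qed

text \<open>Comparison with the geometric series of ratio exp (-1/4) \<le> 4/5, using k \<le> k^2.
  That the bound is the same for every \<open>m\<close> is what matters later.\<close>

lemma sum_exp_neg_square_le: "(\<Sum>k\<le>m. exp (- (real k)\<^sup>2 / 4)) \<le> 5"
proof -
  define r where "r = exp (- (1 / 4) :: real)"
  have "1 + 1 / 4 \<le> exp (1 / 4 :: real)"
    by (rule exp_ge_add_one_self)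
  then have r: "0 < r" "r \<le> 4 / 5"
    unfolding r_def exp_minus by (simp_all add: field_simps)
  have "exp (- (real k)\<^sup>2 / 4) \<le> r ^ k" for k :: nat
  proof -
    have "real k \<le> (real k)\<^sup>2"
      by (metis le_square of_nat_le_iff of_nat_power power2_eq_square)
    then have "exp (- (real k)\<^sup>2 / 4) \<le> exp (real k * (- (1 / 4)))"
      by simp
    then show ?thesis
      by (simp only: exp_of_nat_mult r_def)
  qed
  then have "(\<Sum>k\<le>m. exp (- (real k)\<^sup>2 / 4)) \<le> (\<Sum>k\<le>m. r ^ k)"
    by (rule sum_mono)
  also have "\<dots> = (1 - r ^ Suc m) / (1 - r)"
    using r by (subst sum_gp0) auto
  also have "\<dots> \<le> 1 / (1 / 5)"
    using r by (intro frac_le) auto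
  finally show ?thesis
    by simp
qed

lemma (in prob_space) integral_abs_le_const:
  fixes f :: "'a \<Rightarrow> real"
  assumes "f \<in> borel_measurable M" "\<And>x. x \<in> space M \<Longrightarrow> \<bar>f x\<bar> \<le> b"
  shows "\<bar>\<integral>x. f x \<partial>M\<bar> \<le> b"
proof -
  have "integrable M f"
    using assms by (intro integrable_const_bound[where B=b]) auto
  then have "(\<integral>x. \<bar>f x\<bar> \<partial>M) \<le> (\<integral>x. b \<partial>M)"
    using assms by (intro integral_mono) auto
  then show ?thesis
    by (simp add: prob_space order_trans[OF integral_abs_bound])
qed

section \<open>Averaging over coordinates of a product space\<close>

locale coordinate_average = prob_space P for P :: "'z measure" +
  fixes U :: "'i set"
  assumes finite_U: "finite U"
begin

abbreviation Q :: "('i \<Rightarrow> 'z) measure" where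
  "Q \<equiv> Pi\<^sub>M U (\<lambda>_. P)"

text \<open>A version, defined at every point, of the conditional expectation given the coordinates
  outside \<open>J\<close>: the draw \<open>t\<close> supplies fresh values on \<open>J\<close>.
  Integrating over all of \<open>Q\<close> keeps one space for all \<open>J\<close>, and identities
  hold pointwise instead of almost everywhere.\<close>

definition avg :: "'i set \<Rightarrow> (('i \<Rightarrow> 'z) \<Rightarrow> real) \<Rightarrow> ('i \<Rightarrow> 'z) \<Rightarrow> real" where
  "avg J g s = (\<integral>t. g (override_on s t J) \<partial>Q)"

text \<open>Boundedness makes every average exist; the class is closed under the algebraic
  operations, \<open>exp\<close> and \<open>avg\<close>, so that integrability is never a separate
  issue.\<close>

definition bmeas :: "(('i \<Rightarrow> 'z) \<Rightarrow> real) \<Rightarrow> bool" where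
  "bmeas g \<longleftrightarrow> g \<in> borel_measurable Q \<and> (\<exists>b. \<forall>s\<in>space Q. \<bar>g s\<bar> \<le> b)"

text \<open>The pointwise form of measurability with respect to the coordinates outside
  \<open>J\<close>.\<close>

definition indep_of :: "'i set \<Rightarrow> (('i \<Rightarrow> 'z) \<Rightarrow> real) \<Rightarrow> bool" where
  "indep_of J g \<longleftrightarrow> (\<forall>s\<in>space Q. \<forall>t\<in>space Q. g (override_on s t J) = g s)"

text \<open>The bounded difference condition of McDiarmid's inequality, restricted to the
  coordinates in \<open>J\<close>.\<close>

definition bdiff :: "real \<Rightarrow> 'i set \<Rightarrow> (('i \<Rightarrow> 'z) \<Rightarrow> real) \<Rightarrow> bool" where
  "bdiff c J g \<longleftrightarrow>
    (\<forall>s\<in>space Q. \<forall>t\<in>space Q. \<forall>j\<in>J. \<bar>g (override_on s t {j}) - g s\<bar> \<le> c)"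

sublocale PF: product_prob_space "\<lambda>_. P" U ..

sublocale QQ: pair_prob_space Q Q ..

lemma prob_Q: "measure Q (space Q) = 1"
proof -
  have "prob_space Q"
    by unfold_locales
  then show ?thesis
    by (rule prob_space.prob_space)
qed

lemma override_space:
  "s \<in> space Q \<Longrightarrow> t \<in> space Q \<Longrightarrow> override_on s t J \<in> space Q"
  by (auto simp: space_PiM override_on_def PiE_iff extensional_def)

lemma measurable_override:
  "(\<lambda>(s, t). override_on s t J) \<in> Q \<Otimes>\<^sub>M Q \<rightarrow>\<^sub>M Q"
proof (rule measurable_PiM_single')
  fix i assume i: "i \<in> U"
  show "(\<lambda>\<omega>. (case \<omega> of (s, t) \<Rightarrow> override_on s t J) i) \<in> Q \<Otimes>\<^sub>M Q \<rightarrow>\<^sub>M P"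
    using i by (cases "i \<in> J") (auto simp: override_on_def split_beta')
next
  show "(\<lambda>\<omega> i. (case \<omega> of (s, t) \<Rightarrow> override_on s t J) i)
      \<in> space (Q \<Otimes>\<^sub>M Q) \<rightarrow> (\<Pi>\<^sub>E i\<in>U. space P)"
  proof
    fix \<omega> assume "\<omega> \<in> space (Q \<Otimes>\<^sub>M Q)"
    then have "override_on (fst \<omega>) (snd \<omega>) J \<in> space Q"
      by (intro override_space) (auto simp: space_pair_measure)
    then show "(\<lambda>i. (case \<omega> of (s, t) \<Rightarrow> override_on s t J) i) \<in> (\<Pi>\<^sub>E i\<in>U. space P)"
      by (simp add: space_PiM split_beta')
  qed
qed

lemma measurable_override1:
  "s \<in> space Q \<Longrightarrow> (\<lambda>t. override_on s t J) \<in> Q \<rightarrow>\<^sub>M Q"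
  using measurable_Pair2[OF measurable_override] by simp

text \<open>The preimage of a box is a product of two boxes, and each coordinate is constrained in
  exactly one of them, so the measures of the two multiply to that of the original box.\<close>

lemma distr_override: "distr (Q \<Otimes>\<^sub>M Q) Q (\<lambda>(s, t). override_on s t J) = Q"
proof (rule PF.PiM_eqI)
  show "finite U"
    by (rule finite_U)
  show "sets (distr (Q \<Otimes>\<^sub>M Q) Q (\<lambda>(s, t). override_on s t J)) = sets Q"
    by simp
  fix A assume A: "\<And>i. i \<in> U \<Longrightarrow> A i \<in> sets P"
  let ?A1 = "Pi\<^sub>E U (\<lambda>i. if i \<in> J then space P else A i)"
  let ?A2 = "Pi\<^sub>E U (\<lambda>i. if i \<in> J then A i else space P)"
  have vim: "(\<lambda>(s, t). override_on s t J) -` Pi\<^sub>E U A \<inter> space (Q \<Otimes>\<^sub>M Q) = ?A1 \<times> ?A2"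
    using A[THEN sets.sets_into_space]
    by (auto simp: space_pair_measure space_PiM override_on_def PiE_iff extensional_def
          split: if_splits) blast+
  have "emeasure (distr (Q \<Otimes>\<^sub>M Q) Q (\<lambda>(s, t). override_on s t J)) (Pi\<^sub>E U A)
      = emeasure (Q \<Otimes>\<^sub>M Q) (?A1 \<times> ?A2)"
    using A finite_U
    by (subst emeasure_distr[OF measurable_override])
       (auto simp: vim intro!: sets_PiM_I_finite)
  also have "\<dots> = emeasure Q ?A1 * emeasure Q ?A2"
    using A finite_U by (intro PF.emeasure_pair_measure_Times sets_PiM_I_finite) auto
  also have "\<dots> = (\<Prod>i\<in>U. emeasure P (if i \<in> J then space P else A i))
      * (\<Prod>i\<in>U. emeasure P (if i \<in> J then A i else space P))"
    using A finite_U by (subst (1 2) PF.emeasure_PiM) auto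
  also have "\<dots> = (\<Prod>i\<in>U. emeasure P (A i))"
    unfolding prod.distrib[symmetric]
    by (intro prod.cong refl) (simp add: emeasure_space_1)
  finally show "emeasure (distr (Q \<Otimes>\<^sub>M Q) Q (\<lambda>(s, t). override_on s t J)) (Pi\<^sub>E U A)
      = (\<Prod>i\<in>U. emeasure P (A i))" .
qed

lemma override_override:
  "override_on (override_on s t J) t' K = override_on s (override_on t t' K) (J \<union> K)"
  by (auto simp: override_on_def fun_eq_iff)

lemma bmeasI: "g \<in> borel_measurable Q \<Longrightarrow> (\<And>s. s \<in> space Q \<Longrightarrow> \<bar>g s\<bar> \<le> b) \<Longrightarrow> bmeas g"
  by (auto simp: bmeas_def)

lemma bmeas_meas: "bmeas g \<Longrightarrow> g \<in> borel_measurable Q"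
  by (simp add: bmeas_def)

lemma bmeas_const [simp]: "bmeas (\<lambda>_. c)"
  by (rule bmeasI[of _ "\<bar>c\<bar>"]) auto

lemma bmeas_add [simp]: "bmeas f \<Longrightarrow> bmeas g \<Longrightarrow> bmeas (\<lambda>s. f s + g s)"
  unfolding bmeas_def
  by (auto intro!: exI[of _ "_ + _"] order_trans[OF abs_triangle_ineq] add_mono)

lemma bmeas_mult [simp]: "bmeas f \<Longrightarrow> bmeas g \<Longrightarrow> bmeas (\<lambda>s. f s * g s)"
  unfolding bmeas_def
  by (auto simp: abs_mult intro!: exI[of _ "_ * _"] mult_mono' )

lemma bmeas_uminus [simp]: "bmeas f \<Longrightarrow> bmeas (\<lambda>s. - f s)"
  using bmeas_mult[of "\<lambda>_. -1" f] by simp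

lemma bmeas_diff [simp]: "bmeas f \<Longrightarrow> bmeas g \<Longrightarrow> bmeas (\<lambda>s. f s - g s)"
  using bmeas_add[of f "\<lambda>s. - g s"] by simp

lemma bmeas_divide [simp]: "bmeas f \<Longrightarrow> bmeas (\<lambda>s. f s / c)"
  using bmeas_mult[of f "\<lambda>_. 1 / c"] by simp

lemma bmeas_power [simp]: "bmeas f \<Longrightarrow> bmeas (\<lambda>s. f s ^ n)"
  by (induction n) auto

lemma bmeas_sum [simp]: "(\<And>i. i \<in> A \<Longrightarrow> bmeas (f i)) \<Longrightarrow> bmeas (\<lambda>s. \<Sum>i\<in>A. f i s)"
  by (induction A rule: infinite_finite_induct) auto

lemma bmeas_exp [simp]: "bmeas f \<Longrightarrow> bmeas (\<lambda>s. exp (f s))"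
  unfolding bmeas_def by (auto intro!: exI[of _ "exp _"] simp: abs_le_iff)

lemma bmeas_integrable:
  assumes "bmeas g"
  shows "integrable Q g"
proof -
  obtain b where "\<And>s. s \<in> space Q \<Longrightarrow> \<bar>g s\<bar> \<le> b" and "g \<in> borel_measurable Q"
    using assms by (auto simp: bmeas_def)
  then show ?thesis
    by (intro PF.integrable_const_bound[where B=b]) auto
qed

lemma bmeas_override:
  assumes "bmeas g" "s \<in> space Q"
  shows "bmeas (\<lambda>t. g (override_on s t J))"
proof -
  obtain b where b: "\<And>s. s \<in> space Q \<Longrightarrow> \<bar>g s\<bar> \<le> b" and g: "g \<in> borel_measurable Q"
    using assms by (auto simp: bmeas_def)
  show ?thesis
    by (rule bmeasI[OF measurable_compose[OF measurable_override1[OF assms(2)] g]])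
       (rule b[OF override_space[OF assms(2)]])
qed

lemma integrable_override: "bmeas g \<Longrightarrow> s \<in> space Q \<Longrightarrow> integrable Q (\<lambda>t. g (override_on s t J))"
  by (intro bmeas_integrable bmeas_override)

lemma avg_mono:
  assumes "bmeas f" "bmeas g" "\<And>s. s \<in> space Q \<Longrightarrow> f s \<le> g s" "s \<in> space Q"
  shows "avg J f s \<le> avg J g s"
  unfolding avg_def using assms
  by (intro integral_mono integrable_override) (auto intro: override_space)

lemma avg_cong:
  assumes "\<And>s. s \<in> space Q \<Longrightarrow> f s = g s" "s \<in> space Q"
  shows "avg J f s = avg J g s"
  unfolding avg_def using assms
  by (intro Bochner_Integration.integral_cong refl) (auto intro: override_space)

lemma avg_const [simp]: "avg J (\<lambda>_. c) s = c"
  by (simp add: avg_def prob_Q)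

lemma avg_add: "bmeas f \<Longrightarrow> bmeas g \<Longrightarrow> s \<in> space Q \<Longrightarrow> avg J (\<lambda>s. f s + g s) s = avg J f s + avg J g s"
  unfolding avg_def by (intro Bochner_Integration.integral_add integrable_override)

lemma avg_diff: "bmeas f \<Longrightarrow> bmeas g \<Longrightarrow> s \<in> space Q \<Longrightarrow> avg J (\<lambda>s. f s - g s) s = avg J f s - avg J g s"
  unfolding avg_def by (intro Bochner_Integration.integral_diff integrable_override)

lemma avg_cmult: "avg J (\<lambda>s. c * f s) s = c * avg J f s"
  unfolding avg_def by simp

lemma avg_sum:
  "(\<And>i. i \<in> A \<Longrightarrow> bmeas (f i)) \<Longrightarrow> s \<in> space Q \<Longrightarrow>
    avg J (\<lambda>s. \<Sum>i\<in>A. f i s) s = (\<Sum>i\<in>A. avg J (f i) s)"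
  by (induction A rule: infinite_finite_induct) (auto simp: avg_add)

lemma avg_mult_indep:
  assumes "indep_of J u" "s \<in> space Q"
  shows "avg J (\<lambda>s. u s * g s) s = u s * avg J g s"
proof -
  have "avg J (\<lambda>s. u s * g s) s = (\<integral>t. u s * g (override_on s t J) \<partial>Q)"
    unfolding avg_def using assms
    by (intro Bochner_Integration.integral_cong refl) (auto simp: indep_of_def)
  then show ?thesis
    by (simp add: avg_def)
qed

lemma avg_abs_le:
  assumes "bmeas g" "s \<in> space Q" "\<And>t. t \<in> space Q \<Longrightarrow> \<bar>g (override_on s t J)\<bar> \<le> b"
  shows "\<bar>avg J g s\<bar> \<le> b"
proof -
  have "\<bar>avg J g s\<bar> \<le> (\<integral>t. \<bar>g (override_on s t J)\<bar> \<partial>Q)"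
    unfolding avg_def by (rule integral_abs_bound)
  also have "\<dots> \<le> (\<integral>t. b \<partial>Q)"
    using assms by (intro integral_mono integrable_abs integrable_override) auto
  finally show ?thesis
    by (simp add: prob_Q)
qed

lemma bmeas_avg [simp]:
  assumes "bmeas g"
  shows "bmeas (avg J g)"
proof -
  obtain b where b: "\<And>s. s \<in> space Q \<Longrightarrow> \<bar>g s\<bar> \<le> b" and g: "g \<in> borel_measurable Q"
    using assms by (auto simp: bmeas_def)
  have "(\<lambda>(s, t). g (override_on s t J)) \<in> borel_measurable (Q \<Otimes>\<^sub>M Q)"
    using measurable_compose[OF measurable_override g] by (simp add: split_beta')
  then have "avg J g \<in> borel_measurable Q"
    unfolding avg_def[abs_def] by (rule PF.borel_measurable_lebesgue_integral)
  then show ?thesis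
    by (rule bmeasI[of _ b]) (auto intro!: avg_abs_le[OF assms] b override_space)
qed

text \<open>The tower property, for index sets that may overlap. Two successive resamplings amount
  to one resampling from a mixed draw; the mixed draw has law \<open>Q\<close> by
  \<open>distr_override\<close>, and Fubini's theorem does the rest.\<close>

lemma avg_avg:
  assumes g: "bmeas g" and s: "s \<in> space Q"
  shows "avg J (avg K g) s = avg (J \<union> K) g s"
proof -
  obtain b where b: "\<And>s. s \<in> space Q \<Longrightarrow> \<bar>g s\<bar> \<le> b" and gm: "g \<in> borel_measurable Q"
    using g by (auto simp: bmeas_def)
  have G: "(\<lambda>u. g (override_on s u (J \<union> K))) \<in> borel_measurable Q"
    using bmeas_meas[OF bmeas_override[OF g s]] .
  have m: "(\<lambda>p. g (override_on s (case p of (t, t') \<Rightarrow> override_on t t' K) (J \<union> K)))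
      \<in> borel_measurable (Q \<Otimes>\<^sub>M Q)"
    using measurable_compose[OF measurable_override G] by simp
  have "avg (J \<union> K) g s = (\<integral>u. g (override_on s u (J \<union> K)) \<partial>distr (Q \<Otimes>\<^sub>M Q) Q (\<lambda>(t, t'). override_on t t' K))"
    by (simp add: avg_def distr_override)
  also have "\<dots> = (\<integral>p. g (override_on s (case p of (t, t') \<Rightarrow> override_on t t' K) (J \<union> K)) \<partial>(Q \<Otimes>\<^sub>M Q))"
    by (rule integral_distr[OF measurable_override G])
  also have "\<dots> = (\<integral>t. (\<integral>t'. g (override_on s (override_on t t' K) (J \<union> K)) \<partial>Q) \<partial>Q)"
  proof -
    have "integrable (Q \<Otimes>\<^sub>M Q) (\<lambda>p. g (override_on s (case p of (t, t') \<Rightarrow> override_on t t' K) (J \<union> K)))"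
      by (rule QQ.integrable_const_bound[where B=b])
         (auto intro!: AE_I2 b override_space s m simp: space_pair_measure)
    from QQ.integral_fst'[OF this] show ?thesis
      by simp
  qed
  also have "\<dots> = avg J (avg K g) s"
    by (simp add: avg_def override_override)
  finally show ?thesis ..
qed

lemma avg_swap:
  "bmeas g \<Longrightarrow> s \<in> space Q \<Longrightarrow> avg J (avg K g) s = avg K (avg J g) s"
  by (simp add: avg_avg Un_commute)

lemma indep_of_mono:
  assumes "indep_of J g" "K \<subseteq> J"
  shows "indep_of K g"
  unfolding indep_of_def
proof (intro ballI)
  fix s t assume st: "s \<in> space Q" "t \<in> space Q"
  have "override_on s t K = override_on s (override_on s t K) J"
    using assms(2) by (auto simp: override_on_def fun_eq_iff)
  then show "g (override_on s t K) = g s"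
    using assms(1) override_space[OF st, of K] st by (metis indep_of_def)
qed

lemma indep_of_avg: "indep_of J (avg J g)"
proof -
  have "override_on (override_on s t J) u J = override_on s u J" for s t u :: "'i \<Rightarrow> 'z"
    by (auto simp: override_on_def fun_eq_iff)
  then show ?thesis
    by (simp add: indep_of_def avg_def)
qed

lemma indep_of_avg':
  assumes "indep_of J g" "bmeas g"
  shows "indep_of J (avg K g)"
  unfolding indep_of_def
proof (intro ballI)
  fix s t assume st: "s \<in> space Q" "t \<in> space Q"
  have "g (override_on (override_on s t J) u K) = g (override_on s u K)" if "u \<in> space Q" for u
  proof -
    have "override_on (override_on s t J) u K = override_on (override_on s u K) (override_on t u K) J"
      by (auto simp: override_on_def fun_eq_iff)
    then show ?thesis
      using assms(1) that st by (simp add: indep_of_def override_space)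
  qed
  then show "avg K g (override_on s t J) = avg K g s"
    unfolding avg_def by (intro Bochner_Integration.integral_cong) auto
qed

lemma bdiff_avg:
  assumes g: "bmeas g" and b: "bdiff c J g" and c: "0 \<le> c"
  shows "bdiff c J (avg K g)"
  unfolding bdiff_def
proof (intro ballI)
  fix s t j assume *: "s \<in> space Q" "t \<in> space Q" "j \<in> J"
  have "\<bar>g (override_on (override_on s t {j}) u K) - g (override_on s u K)\<bar> \<le> c" if u: "u \<in> space Q" for u
  proof (cases "j \<in> K")
    case True
    then have "override_on (override_on s t {j}) u K = override_on s u K"
      by (auto simp: override_on_def fun_eq_iff)
    then show ?thesis
      using c by simp
  next
    case False
    then have "override_on (override_on s t {j}) u K = override_on (override_on s u K) t {j}"
      by (auto simp: override_on_def fun_eq_iff)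
    then show ?thesis
      using b * u by (simp add: bdiff_def override_space)
  qed
  note diff = this
  have st: "override_on s t {j} \<in> space Q"
    using * by (simp add: override_space)
  have i: "integrable Q (\<lambda>u. g (override_on (override_on s t {j}) u K))"
      "integrable Q (\<lambda>u. g (override_on s u K))"
    by (intro integrable_override g * st)+
  have "\<bar>avg K g (override_on s t {j}) - avg K g s\<bar>
     = \<bar>\<integral>u. g (override_on (override_on s t {j}) u K) - g (override_on s u K) \<partial>Q\<bar>"
    unfolding avg_def using i by (simp add: Bochner_Integration.integral_diff)
  also have "\<dots> \<le> (\<integral>u. \<bar>g (override_on (override_on s t {j}) u K) - g (override_on s u K)\<bar> \<partial>Q)"
    by (rule integral_abs_bound)
  also have "\<dots> \<le> (\<integral>u. c \<partial>Q)"
    using i by (intro integral_mono integrable_abs Bochner_Integration.integrable_diff) (auto intro: diff)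
  finally show "\<bar>avg K g (override_on s t {j}) - avg K g s\<bar> \<le> c"
    by (simp add: prob_Q)
qed

lemma bdiff_mono: "bdiff c J g \<Longrightarrow> K \<subseteq> J \<Longrightarrow> bdiff c K g"
  by (auto simp: bdiff_def)

lemma avg_UNIV:
  assumes "s \<in> space Q" 
  shows "avg U g s = (\<integral>t. g t \<partial>Q)"
  unfolding avg_def
proof (intro Bochner_Integration.integral_cong refl)
  fix t assume "t \<in> space Q"
  then have "override_on s t U = t"
    using assms by (auto simp: override_on_def space_PiM PiE_iff extensional_def)
  then show "g (override_on s t U) = g t"
    by simp
qed

section \<open>Concentration\<close>

text \<open>Hoeffding's lemma with a weaker constant: the deviation from the average is an average
  of differences bounded by \<open>c\<close>, and \<open>exp_le_plus_exp_square\<close> applies to a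
  centred variable.\<close>

lemma avg_exp_single:
  assumes a: "bmeas a" and b: "bdiff c {k} a" and s: "s \<in> space Q"
  shows "avg {k} (\<lambda>s. exp (\<theta> * (a s - avg {k} a s))) s \<le> exp (\<theta>\<^sup>2 * c\<^sup>2)"
proof -
  define y where "y s = \<theta> * (a s - avg {k} a s)" for s
  have y: "bmeas y"
    unfolding y_def[abs_def] using a by simp
  have yb: "(y s)\<^sup>2 \<le> \<theta>\<^sup>2 * c\<^sup>2" if s: "s \<in> space Q" for s
  proof -
    have "\<bar>avg {k} (\<lambda>t. a t - a s) s\<bar> \<le> c"
      using a b s by (intro avg_abs_le) (auto simp: bdiff_def)
    then have "\<bar>a s - avg {k} a s\<bar> \<le> c"
      using a s by (simp add: avg_diff)
    then have "(a s - avg {k} a s)\<^sup>2 \<le> c\<^sup>2"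
      by (metis abs_ge_zero power2_abs power_mono)
    then show ?thesis
      unfolding y_def power_mult_distrib by (intro mult_left_mono) auto
  qed
  have "avg {k} y s = 0"
    unfolding y_def[abs_def] using a s by (simp add: avg_cmult avg_diff avg_avg)
  moreover have "avg {k} (\<lambda>s. exp (y s)) s \<le> avg {k} (\<lambda>s. y s + exp (\<theta>\<^sup>2 * c\<^sup>2)) s"
  proof (rule avg_mono)
    fix s assume "s \<in> space Q"
    then show "exp (y s) \<le> y s + exp (\<theta>\<^sup>2 * c\<^sup>2)"
      using exp_le_plus_exp_square[of "y s"] yb[of s] 
      by (meson add_left_mono exp_le_cancel_iff order_trans)
  qed (use y s in auto)
  ultimately have "avg {k} (\<lambda>s. exp (y s)) s \<le> exp (\<theta>\<^sup>2 * c\<^sup>2)"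
    using y s by (simp add: avg_add)
  then show ?thesis
    by (simp add: y_def)
qed

text \<open>McDiarmid's argument: one coordinate \<open>k\<close> is peeled off at a time. The
  factor \<open>w\<close> built from \<open>avg {k} a\<close> does not see coordinate
  \<open>k\<close>, so only \<open>a - avg {k} a\<close> is averaged over it, while
  \<open>avg {k} a\<close> inherits the bounded differences on the rest.\<close>

lemma avg_exp_bdiff:
  assumes "finite K" "bmeas a" "bdiff c K a" "0 \<le> c" "s \<in> space Q"
  shows "avg K (\<lambda>s. exp (\<theta> * (a s - avg K a s))) s \<le> exp (\<theta>\<^sup>2 * c\<^sup>2 * card K)"
  using assms(1,2,3,5)
proof (induction K arbitrary: a s)
  case empty
  then show ?case
    by (simp add: avg_def prob_Q override_on_def)
next
  case (insert k K)
  define a' where "a' = avg {k} a"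
  define w where "w s = exp (\<theta> * (a' s - avg K a' s))" for s
  have a': "bmeas a'"
    using insert by (simp add: a'_def)
  have w: "bmeas w"
    unfolding w_def[abs_def] using a' by simp
  have eq: "avg (insert k K) a s = avg K a' s" if "s \<in> space Q" for s
    using that insert.prems unfolding a'_def by (simp add: avg_avg)
  have wi: "indep_of {k} w"
  proof -
    have "indep_of {k} a'"
      unfolding a'_def by (rule indep_of_avg)
    moreover from this have "indep_of {k} (avg K a')"
      using a' by (rule indep_of_avg')
    ultimately show ?thesis
      by (simp add: indep_of_def w_def)
  qed
  have "avg (insert k K) (\<lambda>s. exp (\<theta> * (a s - avg (insert k K) a s))) s
     = avg (insert k K) (\<lambda>s. w s * exp (\<theta> * (a s - a' s))) s"
  proof (rule avg_cong)
    fix s assume "s \<in> space Q"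
    moreover have "\<theta> * (a s - avg K a' s) = \<theta> * (a' s - avg K a' s) + \<theta> * (a s - a' s)"
      by (simp add: algebra_simps)
    ultimately show "exp (\<theta> * (a s - avg (insert k K) a s)) = w s * exp (\<theta> * (a s - a' s))"
      by (simp only: eq w_def exp_add)
  qed fact
  also have "\<dots> = avg K (avg {k} (\<lambda>s. w s * exp (\<theta> * (a s - a' s)))) s"
    using insert.prems a' w by (simp add: avg_avg)
  also have "\<dots> \<le> avg K (\<lambda>s. w s * exp (\<theta>\<^sup>2 * c\<^sup>2)) s"
  proof (rule avg_mono)
    fix s assume s: "s \<in> space Q"
    have "avg {k} (\<lambda>s. w s * exp (\<theta> * (a s - a' s))) s = w s * avg {k} (\<lambda>s. exp (\<theta> * (a s - a' s))) s"
      using wi s by (rule avg_mult_indep)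
    also have "\<dots> \<le> w s * exp (\<theta>\<^sup>2 * c\<^sup>2)"
      unfolding a'_def using insert.prems s
      by (intro mult_left_mono avg_exp_single bdiff_mono[of c "insert k K" a "{k}"]) (auto simp: w_def)
    finally show "avg {k} (\<lambda>s. w s * exp (\<theta> * (a s - a' s))) s \<le> w s * exp (\<theta>\<^sup>2 * c\<^sup>2)" .
  qed (use insert.prems w a' in auto)
  also have "\<dots> = exp (\<theta>\<^sup>2 * c\<^sup>2) * avg K w s"
    by (simp only: mult.commute[of _ "exp (\<theta>\<^sup>2 * c\<^sup>2)"] avg_cmult)
  also have "\<dots> \<le> exp (\<theta>\<^sup>2 * c\<^sup>2) * exp (\<theta>\<^sup>2 * c\<^sup>2 * card K)"
  proof (rule mult_left_mono)
    have "bdiff c K a'"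
      unfolding a'_def
    proof (rule bdiff_avg)
      show "bdiff c K a"
        using insert.prems(2) by (rule bdiff_mono) auto
    qed fact+
    from insert.IH[OF a' this \<open>s \<in> space Q\<close>]
    show "avg K w s \<le> exp (\<theta>\<^sup>2 * c\<^sup>2 * card K)"
      by (simp only: w_def[abs_def])
  qed simp
  also have "\<dots> = exp (\<theta>\<^sup>2 * c\<^sup>2 * card (insert k K))"
    using insert.hyps by (simp add: algebra_simps flip: exp_add)
  finally show ?case .
qed

text \<open>A subgaussian moment generating function controls the exponential of the square. Instead
  of a Gaussian integral, a sum over integer multiples of \<open>x\<close> is used: the weight exp
  (-k^2/2) beats the moment bound exp (k^2/4).\<close>

lemma avg_exp_square_bdiff:
  assumes K: "finite K" and a: "bmeas a" and b: "bdiff c K a" and c: "0 \<le> c" and s: "s \<in> space Q"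
    and z: "\<And>s. s \<in> space Q \<Longrightarrow> avg K a s = 0"
    and \<theta>: "\<theta>\<^sup>2 * c\<^sup>2 * card K \<le> 1 / 4"
  shows "avg K (\<lambda>s. exp (\<theta>\<^sup>2 * (a s)\<^sup>2 / 8)) s \<le> 2"
proof -
  define x where "x s = \<theta> * a s" for s
  have x: "bmeas x"
    unfolding x_def[abs_def] using a by simp
  obtain b where "\<And>s. s \<in> space Q \<Longrightarrow> \<bar>x s\<bar> \<le> b"
    using x by (auto simp: bmeas_def)
  \<comment> \<open>The number of terms depends on the bound of \<open>x\<close>, but the bound on
    their sum does not; so no infinite series has to be averaged.\<close>
  then obtain m :: nat where m: "\<And>s. s \<in> space Q \<Longrightarrow> \<bar>x s\<bar> \<le> real m"
    by (meson order_trans real_arch_simple)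
  have mgf: "avg K (\<lambda>s. exp (k * x s)) s \<le> exp (k\<^sup>2 / 4)" for k :: real
  proof -
    have "avg K (\<lambda>s. exp (k * x s)) s = avg K (\<lambda>s. exp ((k * \<theta>) * (a s - avg K a s))) s"
      using s by (intro avg_cong) (auto simp: x_def z)
    also have "\<dots> \<le> exp ((k * \<theta>)\<^sup>2 * c\<^sup>2 * card K)"
      using assms by (intro avg_exp_bdiff) auto
    also have "\<dots> \<le> exp (k\<^sup>2 / 4)"
      using mult_left_mono[OF \<theta>, of "k\<^sup>2"] by (simp add: power_mult_distrib mult_ac)
    finally show ?thesis .
  qed
  have "avg K (\<lambda>s. exp ((x s)\<^sup>2 / 2)) s
      \<le> avg K (\<lambda>s. exp (1 / 8) * (\<Sum>k\<le>m. exp (- (real k)\<^sup>2 / 2) * (exp (real k * x s) + exp ((- real k) * x s)))) s"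
    using x s by (intro avg_mono) (auto intro!: order_trans[OF exp_half_square_le_sum[OF m]])
  also have "\<dots> = exp (1 / 8) * (\<Sum>k\<le>m. exp (- (real k)\<^sup>2 / 2) * (avg K (\<lambda>s. exp (real k * x s)) s + avg K (\<lambda>s. exp ((- real k) * x s)) s))"
    using x s by (simp add: avg_cmult avg_sum avg_add del: mult_minus_left)
  also have "\<dots> \<le> exp (1 / 8) * (\<Sum>k\<le>m. exp (- (real k)\<^sup>2 / 2) * (exp ((real k)\<^sup>2 / 4) + exp ((- real k)\<^sup>2 / 4)))"
    by (intro mult_left_mono sum_mono add_mono mgf) auto
  also have "\<dots> = exp (1 / 8) * (2 * (\<Sum>k\<le>m. exp (- (real k)\<^sup>2 / 4)))"
    by (auto simp: sum_distrib_left algebra_simps simp flip: exp_add intro!: sum.cong)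
  also have "\<dots> \<le> exp (1 / 8) * 10"
    using sum_exp_neg_square_le[of m] by simp
  also have "\<dots> \<le> 16"
  proof -
    have "1 - 1 / 8 \<le> exp (- (1 / 8 :: real))"
      using exp_ge_add_one_self[of "- (1 / 8) :: real"] by linarith
    then show ?thesis
      by (simp add: exp_minus field_simps)
  qed
  finally have E: "avg K (\<lambda>s. exp ((x s)\<^sup>2 / 2)) s \<le> 16" .
  \<comment> \<open>The tangent of the fourth root at 16, in terms of u: Jensen's inequality carried
    out pointwise. It turns the bound 16 into 3/2 + 16/32 = 2.\<close>
  have tangent: "u \<le> 3 / 2 + u ^ 4 / 32" if "u \<ge> 0" for u :: real
  proof -
    have "0 \<le> (u - 2)\<^sup>2 * (u\<^sup>2 + 4 * u + 12)"
      using that by (intro mult_nonneg_nonneg) auto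
    also have "\<dots> = u ^ 4 - 32 * u + 48"
      by (simp add: power2_eq_square power4_eq_xxxx algebra_simps)
    finally show ?thesis
      by simp
  qed
  have "avg K (\<lambda>s. exp ((x s)\<^sup>2 / 8)) s \<le> avg K (\<lambda>s. 3 / 2 + (1 / 32) * exp ((x s)\<^sup>2 / 2)) s"
  proof (rule avg_mono)
    fix s
    have "exp ((x s)\<^sup>2 / 8) ^ 4 = exp ((x s)\<^sup>2 / 2)"
      by (simp flip: exp_of_nat_mult)
    then show "exp ((x s)\<^sup>2 / 8) \<le> 3 / 2 + (1 / 32) * exp ((x s)\<^sup>2 / 2)"
      using tangent[of "exp ((x s)\<^sup>2 / 8)"] by simp
  qed (use x s in auto)
  also have "\<dots> = 3 / 2 + (1 / 32) * avg K (\<lambda>s. exp ((x s)\<^sup>2 / 2)) s"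
    by (subst avg_add) (simp_all only: avg_cmult avg_const x s bmeas_const bmeas_mult bmeas_exp bmeas_divide bmeas_power)
  also have "\<dots> \<le> 2"
    using E by simp
  finally show ?thesis
    by (simp add: x_def power_mult_distrib)
qed

text \<open>Given the coordinates outside \<open>A\<close>, each \<open>a i\<close> is a centred
  function of coordinate \<open>i\<close> alone, so the averages factor. The weight \<open>w\<close>
  makes the induction go through: it collects the factors of the coordinates that are already
  treated.\<close>

lemma avg_exp_sum_le_exp_square_sum:
  assumes "finite A" and "\<And>i. i \<in> A \<Longrightarrow> bmeas (a i)"
    and "\<And>i. i \<in> A \<Longrightarrow> indep_of (A - {i}) (a i)"
    and "\<And>i s. i \<in> A \<Longrightarrow> s \<in> space Q \<Longrightarrow> avg {i} (a i) s = 0"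
    and "bmeas w" "indep_of A w" "\<And>s. s \<in> space Q \<Longrightarrow> 0 \<le> w s" and "s \<in> space Q"
  shows "avg A (\<lambda>s. w s * exp (\<Sum>i\<in>A. \<theta> * a i s)) s \<le> avg A (\<lambda>s. w s * exp (\<Sum>i\<in>A. (\<theta> * a i s)\<^sup>2)) s"
  using assms
proof (induction A arbitrary: w s)
  case empty
  then show ?case by simp
next
  case (insert i A)
  have am: "bmeas (a j)" if "j = i \<or> j \<in> A" for j
    using that insert.prems(1) by auto
  \<comment> \<open>The squared factor after averaging over coordinate \<open>i\<close>; it no
    longer depends on \<open>i\<close> or on \<open>A\<close> and joins the weight for the induction
    hypothesis.\<close>
  define v where "v = avg {i} (\<lambda>s. exp ((\<theta> * a i s)\<^sup>2))"
  have vm: "bmeas v"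
    unfolding v_def using am by simp
  have ai: "indep_of {i} (a j)" if "j \<in> A" for j
    using insert.prems(2)[of j] insert.hyps that by (auto elim!: indep_of_mono)
  have wi: "indep_of {i} w" and wA: "indep_of A w"
    using insert.prems(5) by (auto elim: indep_of_mono)
  have viA: "indep_of A v"
  proof -
    have "indep_of A (a i)"
      using insert.prems(2)[of i] insert.hyps by simp
    then have "indep_of A (\<lambda>s. exp ((\<theta> * a i s)\<^sup>2))"
      by (simp add: indep_of_def)
    then show ?thesis
      unfolding v_def using am by (intro indep_of_avg') auto
  qed
  have v0: "0 \<le> v s" for s
    by (simp add: v_def avg_def)
  have step: "avg {i} (\<lambda>s. exp (\<theta> * a i s)) s \<le> v s" if s: "s \<in> space Q" for s
  proof -
    have "avg {i} (\<lambda>s. exp (\<theta> * a i s)) s \<le> avg {i} (\<lambda>s. \<theta> * a i s + exp ((\<theta> * a i s)\<^sup>2)) s"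
      using am s by (intro avg_mono exp_le_plus_exp_square) auto
    then show ?thesis
      using am s insert.prems(3)[of i s] by (simp add: avg_add avg_cmult v_def)
  qed
  have sp: "avg (insert i A) (\<lambda>s. w s * exp (\<Sum>j\<in>insert i A. y j s)) s
      = avg A (\<lambda>s. (w s * exp (\<Sum>j\<in>A. y j s)) * avg {i} (\<lambda>s. exp (y i s)) s) s"
    if y: "\<And>j. j = i \<or> j \<in> A \<Longrightarrow> bmeas (y j)" "\<And>j. j \<in> A \<Longrightarrow> indep_of {i} (y j)" for y
  proof -
    have "avg (insert i A) (\<lambda>s. w s * exp (\<Sum>j\<in>insert i A. y j s)) s
      = avg (insert i A) (\<lambda>s. (w s * exp (\<Sum>j\<in>A. y j s)) * exp (y i s)) s"
      using insert.hyps by (simp add: exp_add mult_ac)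
    also have "\<dots> = avg A (avg {i} (\<lambda>s. (w s * exp (\<Sum>j\<in>A. y j s)) * exp (y i s))) s"
      using insert.prems y(1) by (subst avg_avg) auto
    also have "\<dots> = avg A (\<lambda>s. (w s * exp (\<Sum>j\<in>A. y j s)) * avg {i} (\<lambda>s. exp (y i s)) s) s"
    proof (rule avg_cong)
      have "indep_of {i} (\<lambda>s. w s * exp (\<Sum>j\<in>A. y j s))"
        using wi y(2) by (simp add: indep_of_def)
      then show "avg {i} (\<lambda>s. w s * exp (\<Sum>j\<in>A. y j s) * exp (y i s)) s =
         w s * exp (\<Sum>j\<in>A. y j s) * avg {i} (\<lambda>s. exp (y i s)) s" if "s \<in> space Q" for s
        using that by (rule avg_mult_indep)
    qed fact
    finally show ?thesis .
  qed
  have "avg (insert i A) (\<lambda>s. w s * exp (\<Sum>j\<in>insert i A. \<theta> * a j s)) s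
      = avg A (\<lambda>s. (w s * exp (\<Sum>j\<in>A. \<theta> * a j s)) * avg {i} (\<lambda>s. exp (\<theta> * a i s)) s) s"
    using am ai by (intro sp) (auto simp: indep_of_def)
  also have "\<dots> \<le> avg A (\<lambda>s. (w s * exp (\<Sum>j\<in>A. \<theta> * a j s)) * v s) s"
    using am vm insert.prems by (intro avg_mono mult_left_mono step) auto
  also have "\<dots> = avg A (\<lambda>s. (w s * v s) * exp (\<Sum>j\<in>A. \<theta> * a j s)) s"
    by (simp add: mult_ac)
  also have "\<dots> \<le> avg A (\<lambda>s. (w s * v s) * exp (\<Sum>j\<in>A. (\<theta> * a j s)\<^sup>2)) s"
  proof (rule insert.IH)
    show "indep_of (A - {j}) (a j)" if "j \<in> A" for j
      using insert.prems(2)[of j] that by (auto elim!: indep_of_mono)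
    show "indep_of A (\<lambda>s. w s * v s)"
      using wA viA by (simp add: indep_of_def)
    show "bmeas (a j)" if "j \<in> A" for j
      using am that by blast
    show "avg {j} (a j) s = 0" if "j \<in> A" "s \<in> space Q" for j s
      using insert.prems(3) that by blast
    show "bmeas (\<lambda>s. w s * v s)"
      using insert.prems(4) vm by (rule bmeas_mult)
    show "0 \<le> w s * v s" if "s \<in> space Q" for s
      using insert.prems(6)[OF that] v0 by simp
  qed fact
  also have "\<dots> = avg A (\<lambda>s. (w s * exp (\<Sum>j\<in>A. (\<theta> * a j s)\<^sup>2)) * avg {i} (\<lambda>s. exp ((\<theta> * a i s)\<^sup>2)) s) s"
    by (simp add: mult_ac v_def)
  also have "\<dots> = avg (insert i A) (\<lambda>s. w s * exp (\<Sum>j\<in>insert i A. (\<theta> * a j s)\<^sup>2)) s"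
    using am ai by (intro sp[symmetric]) (auto simp: indep_of_def)
  finally show ?case .
qed

section \<open>Sub-exponential sums by recursive halving\<close>

text \<open>A one-sided version of the Orlicz norm for exp u - 1 being at most \<open>K\<close>,
  uniformly in the coordinates outside \<open>I\<close>.\<close>

definition subexp :: "'i set \<Rightarrow> real \<Rightarrow> (('i \<Rightarrow> 'z) \<Rightarrow> real) \<Rightarrow> bool" where
  "subexp I K f \<longleftrightarrow> (\<forall>s\<in>space Q. avg I (\<lambda>s. exp (f s / K)) s \<le> 2)"

text \<open>The triangle inequality of the Orlicz norm: the scaled sum is a convex combination of
  the scaled terms, so convexity of \<open>exp\<close> suffices and dependence between
  \<open>f\<close> and \<open>g\<close> is harmless.\<close>

lemma subexp_add:
  assumes f: "bmeas f" "subexp I K f" "0 < K" and g: "bmeas g" "subexp I L g" "0 < L"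
  shows "subexp I (K + L) (\<lambda>s. f s + g s)"
  unfolding subexp_def
proof
  fix s assume s: "s \<in> space Q"
  define u where "u = K / (K + L)"
  define v where "v = L / (K + L)"
  have uv: "0 \<le> u" "0 \<le> v" "u + v = 1"
    using f g by (auto simp: u_def v_def simp flip: add_divide_distrib)
  have "avg I (\<lambda>s. exp ((f s + g s) / (K + L))) s
      \<le> avg I (\<lambda>s. u * exp (f s / K) + v * exp (g s / L)) s"
  proof (rule avg_mono)
    fix s
    have "(f s + g s) / (K + L) = u *\<^sub>R (f s / K) + v *\<^sub>R (g s / L)"
      using f(3) g(3) by (simp add: u_def v_def add_divide_distrib)
    moreover have u: "u = 1 - v"
      using uv by simp
    ultimately show "exp ((f s + g s) / (K + L)) \<le> u * exp (f s / K) + v * exp (g s / L)"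
      using convex_onD[OF exp_convex, of v "f s / K" "g s / L"] uv
      by (simp add: u)
  qed (use f g s in auto)
  also have "\<dots> = u * avg I (\<lambda>s. exp (f s / K)) s + v * avg I (\<lambda>s. exp (g s / L)) s"
    using f g s by (simp add: avg_add avg_cmult)
  also have "\<dots> \<le> u * 2 + v * 2"
    using f g s uv by (intro add_mono mult_left_mono) (auto simp: subexp_def)
  also have "\<dots> = 2"
    using uv by simp
  finally show "avg I (\<lambda>s. exp ((f s + g s) / (K + L))) s \<le> 2" .
qed

lemma subexp_mono:
  assumes f: "bmeas f" "subexp I K f" and "I \<subseteq> J"
  shows "subexp J K f"
  unfolding subexp_def
proof
  fix s assume s: "s \<in> space Q"
  have "avg J (\<lambda>s. exp (f s / K)) s = avg J (avg I (\<lambda>s. exp (f s / K))) s"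
    using assms s by (subst avg_avg) (auto simp: Un_absorb2)
  also have "\<dots> \<le> avg J (\<lambda>_. 2) s"
    using f s by (intro avg_mono) (auto simp: subexp_def)
  finally show "avg J (\<lambda>s. exp (f s / K)) s \<le> 2"
    by simp
qed

text \<open>
  Conditionally on the coordinates in \<open>J\<close>, the summands are independent and centred. The
  inequality \<open>exp x \<le> x + exp x\<^sup>2\<close> trades them for their squares, and these are controlled by
  averaging over \<open>J\<close> first.
\<close>

lemma subexp_block:
  assumes I: "finite I" "card I \<le> n" and J: "finite J" "card J \<le> n" and n: "0 < n" and c: "0 < c"
    and a: "\<And>i. i \<in> I \<Longrightarrow> bmeas (a i)"
    and ind: "\<And>i. i \<in> I \<Longrightarrow> indep_of (I - {i}) (a i)"
    and zi: "\<And>i s. i \<in> I \<Longrightarrow> s \<in> space Q \<Longrightarrow> avg {i} (a i) s = 0"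
    and zJ: "\<And>i s. i \<in> I \<Longrightarrow> s \<in> space Q \<Longrightarrow> avg J (a i) s = 0"
    and b: "\<And>i. i \<in> I \<Longrightarrow> bdiff c J (a i)"
  shows "subexp (I \<union> J) (6 * real n * c) (\<lambda>s. \<Sum>i\<in>I. a i s)"
proof (cases "I = {}")
  case True
  then show ?thesis
    by (simp add: subexp_def)
next
  case False
  define \<eta> where "\<eta> = 1 / (6 * real n * c)"
  define N where "N = real (card I)"
  have N: "0 < N" "N \<le> n"
    using I False by (auto simp: N_def card_gt_0_iff)
  have sq: "avg J (\<lambda>s. exp (N * (\<eta> * a i s)\<^sup>2)) s \<le> 2" if i: "i \<in> I" and s: "s \<in> space Q" for i s
  proof -
    \<comment> \<open>Chosen so that \<theta>^2 / 8 = N \<eta>^2, the exponent produced by Jensen's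
      inequality. The requirement of \<open>avg_exp_square_bdiff\<close> then reads 8 N card J \<le>
      36 n^2 / 4, whence the 6 in the constant.\<close>
    define \<theta> where "\<theta> = sqrt (8 * N) * \<eta>"
    have \<theta>2: "\<theta>\<^sup>2 = 8 * N * \<eta>\<^sup>2"
      using N by (simp add: \<theta>_def power_mult_distrib)
    have "N * real (card J) \<le> real n * real n"
      using N J by (intro mult_mono) auto
    then have "32 * (N * real (card J)) \<le> 36 * (real n * real n)"
      using zero_le_square[of "real n"] by linarith
    then have "\<theta>\<^sup>2 * c\<^sup>2 * card J \<le> 1 / 4"
      using n c unfolding \<theta>2 by (simp add: \<eta>_def power2_eq_square field_simps)
    from avg_exp_square_bdiff[OF J(1) a[OF i] b[OF i] _ s zJ[OF i] this]
    show ?thesis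
      using c by (simp add: \<theta>2 power_mult_distrib mult.assoc)
  qed
  show ?thesis
    unfolding subexp_def
  proof
    fix s assume s: "s \<in> space Q"
    have "avg (I \<union> J) (\<lambda>s. exp ((\<Sum>i\<in>I. a i s) / (6 * real n * c))) s
        = avg J (avg I (\<lambda>s. 1 * exp (\<Sum>i\<in>I. \<eta> * a i s))) s"
      using a s by (simp add: avg_avg Un_commute \<eta>_def sum_divide_distrib)
    also have "\<dots> \<le> avg J (avg I (\<lambda>s. 1 * exp (\<Sum>i\<in>I. (\<eta> * a i s)\<^sup>2))) s"
    proof (rule avg_mono)
      fix s assume s: "s \<in> space Q"
      show "avg I (\<lambda>s. 1 * exp (\<Sum>i\<in>I. \<eta> * a i s)) s \<le> avg I (\<lambda>s. 1 * exp (\<Sum>i\<in>I. (\<eta> * a i s)\<^sup>2)) s"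
        by (rule avg_exp_sum_le_exp_square_sum[OF I(1) a ind zi _ _ _ s]) (auto simp: indep_of_def)
    qed (use a s in auto)
    \<comment> \<open>Given \<open>I\<close>, the squares for different \<open>i\<close> are
      dependent through \<open>J\<close>; Jensen's inequality separates them.\<close>
    also have "\<dots> \<le> avg J (avg I (\<lambda>s. (\<Sum>i\<in>I. exp (N * (\<eta> * a i s)\<^sup>2)) / N)) s"
      using a s exp_sum_le_average[OF I(1) False]
      by (intro avg_mono) (auto simp: N_def)
    \<comment> \<open>With \<open>J\<close> averaged first, each \<open>a i\<close> is centred with
      bounded differences in the coordinates concerned.\<close>
    also have "\<dots> = avg I (avg J (\<lambda>s. (1 / N) * (\<Sum>i\<in>I. exp (N * (\<eta> * a i s)\<^sup>2)))) s"
      using a s by (simp add: avg_swap)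
    also have "\<dots> = avg I (\<lambda>s. (1 / N) * (\<Sum>i\<in>I. avg J (\<lambda>s. exp (N * (\<eta> * a i s)\<^sup>2)) s)) s"
    proof (rule avg_cong)
      fix s assume "s \<in> space Q"
      then show "avg J (\<lambda>s. (1 / N) * (\<Sum>i\<in>I. exp (N * (\<eta> * a i s)\<^sup>2))) s
          = (1 / N) * (\<Sum>i\<in>I. avg J (\<lambda>s. exp (N * (\<eta> * a i s)\<^sup>2)) s)"
        using a by (subst avg_cmult, subst avg_sum) auto
    qed fact
    also have "\<dots> \<le> avg I (\<lambda>_. (1 / N) * (\<Sum>i\<in>I. 2)) s"
      using N s a by (intro avg_mono mult_left_mono sum_mono sq) auto
    also have "\<dots> = 2"
      using N by (simp add: N_def)
    finally show "avg (I \<union> J) (\<lambda>s. exp ((\<Sum>i\<in>I. a i s) / (6 * real n * c))) s \<le> 2" .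
  qed
qed

text \<open>
  The recursive halving of Bousquet, Klochkov and Zhivotovskiy: averaging \<open>g i\<close> over the rest of
  the half of \<open>I\<close> that contains \<open>i\<close> leaves a term of the kind treated in the previous lemma,
  and the remainder satisfies the hypotheses on that half, conditionally on the other one.
\<close>

lemma subexp_sum:
  assumes "finite I" "card I \<le> 2 ^ k" and c: "0 < c"
    and "\<And>i. i \<in> I \<Longrightarrow> bmeas (g i)"
    and "\<And>i s. i \<in> I \<Longrightarrow> s \<in> space Q \<Longrightarrow> avg {i} (g i) s = 0"
    and "\<And>i s. i \<in> I \<Longrightarrow> s \<in> space Q \<Longrightarrow> avg (I - {i}) (g i) s = 0"
    and "\<And>i. i \<in> I \<Longrightarrow> bdiff c (I - {i}) (g i)"
  shows "subexp I (6 * (real k + 1) * 2 ^ k * c) (\<lambda>s. \<Sum>i\<in>I. g i s)"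
  using assms(1,2,4-)
proof (induction k arbitrary: I g)
  case 0
  \<comment> \<open>At most one index is left, so centring over \<open>I - {i}\<close> is averaging
    over the empty set, which changes nothing.\<close>
  have "g i s = 0" if i: "i \<in> I" and s: "s \<in> space Q" for i s
  proof -
    have "I - {i} = {}"
      using 0(1,2) i by (metis card_le_Suc0_iff_eq Diff_eq_empty_iff One_nat_def power_0 singletonI subsetI)
    then have "avg {} (g i) s = 0"
      using "0.prems"(5) i s by metis
    then show ?thesis
      by (simp add: avg_def prob_Q)
  qed
  then have "avg I (\<lambda>s. exp ((\<Sum>i\<in>I. g i s) / (6 * (real 0 + 1) * 2 ^ 0 * c))) s = avg I (\<lambda>_. 1) s"
    if "s \<in> space Q" for s
    using that by (intro avg_cong) auto
  then show ?case
    by (simp add: subexp_def)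
next
  case (Suc k)
  define L where "L = 6 * (real k + 1) * 2 ^ k * c"
  define n :: nat where "n = 2 ^ k"
  have Lp: "0 < L" and np: "0 < 6 * real n * c"
    using c by (auto simp: L_def n_def)
  have half: "subexp I (6 * real n * c + L) (\<lambda>s. \<Sum>i\<in>I1. g i s)"
    if I: "I = I1 \<union> I2" "I1 \<inter> I2 = {}" and card: "card I1 \<le> n" "card I2 \<le> n" for I1 I2
  proof -
    define a where "a i = avg (I1 - {i}) (g i)" for i
    define r where "r i s = g i s - a i s" for i s
    have fin: "finite I1" "finite I2"
      using I Suc.prems(1) by auto
    have gm: "bmeas (g i)" if "i \<in> I1" for i
      using Suc.prems(3) that I by auto
    have am: "bmeas (a i)" if "i \<in> I1" for i
      using gm that by (simp add: a_def)
    have rm: "bmeas (r i)" if "i \<in> I1" for i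
      unfolding r_def[abs_def] using gm am that by simp
    have ind: "indep_of (I1 - {i}) (a i)" for i
      unfolding a_def by (rule indep_of_avg)
    have zi: "avg {i} (a i) s = 0" if i: "i \<in> I1" and s: "s \<in> space Q" for i s
    proof -
      have "avg {i} (a i) s = avg (I1 - {i}) (avg {i} (g i)) s"
        unfolding a_def by (rule avg_swap[OF gm[OF i] s])
      also have "\<dots> = avg (I1 - {i}) (\<lambda>_. 0) s"
        using Suc.prems(4) i I s by (intro avg_cong) auto
      finally show ?thesis
        by simp
    qed
    \<comment> \<open>Averaging over the other half on top of the rest of this half covers all of
      \<open>I - {i}\<close>, over which \<open>g i\<close> is centred by assumption.\<close>
    have z2: "avg I2 (a i) s = 0" if i: "i \<in> I1" and s: "s \<in> space Q" for i s
    proof -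
      have "avg I2 (a i) s = avg (I2 \<union> (I1 - {i})) (g i) s"
        unfolding a_def by (rule avg_avg[OF gm[OF i] s])
      also have "I2 \<union> (I1 - {i}) = I - {i}"
        using I i by auto
      finally show ?thesis
        using Suc.prems(5) i I s by simp
    qed
    have "subexp (I1 \<union> I2) (6 * real n * c) (\<lambda>s. \<Sum>i\<in>I1. a i s)"
    proof (rule subexp_block)
      show "bdiff c I2 (a i)" if "i \<in> I1" for i
        unfolding a_def
      proof (rule bdiff_avg)
        show "bdiff c I2 (g i)"
          using Suc.prems(6)[of i] that I by (auto elim!: bdiff_mono)
      qed (use gm that c in auto)
    qed (use fin card c ind zi z2 am in \<open>auto simp: n_def\<close>)
    moreover have "subexp I1 L (\<lambda>s. \<Sum>i\<in>I1. r i s)"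
      unfolding L_def
    proof (rule Suc.IH)
      fix i assume i: "i \<in> I1"
      show "avg {i} (r i) s = 0" if s: "s \<in> space Q" for s
        unfolding r_def[abs_def] avg_diff[OF gm[OF i] am[OF i] s]
        using zi[OF i s] Suc.prems(4) i I s by simp
      show "avg (I1 - {i}) (r i) s = 0" if s: "s \<in> space Q" for s
        using gm[OF i] s unfolding r_def[abs_def] a_def by (subst avg_diff) (simp_all add: avg_avg)
      show "bdiff c (I1 - {i}) (r i)"
        unfolding bdiff_def
      proof (intro ballI)
        fix s t j assume *: "s \<in> space Q" "t \<in> space Q" "j \<in> I1 - {i}"
        \<comment> \<open>The subtracted average is constant in coordinate \<open>j\<close>, so the
          difference bound \<open>c\<close> is not doubled at each level of the recursion.\<close>
        have "indep_of {j} (a i)"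
          using ind[of i] *(3) by (auto elim: indep_of_mono)
        then have "a i (override_on s t {j}) = a i s"
          using * by (simp add: indep_of_def)
        moreover have "\<bar>g i (override_on s t {j}) - g i s\<bar> \<le> c"
          using Suc.prems(6)[of i] i I * by (auto simp: bdiff_def)
        ultimately show "\<bar>r i (override_on s t {j}) - r i s\<bar> \<le> c"
          by (simp add: r_def)
      qed
    qed (use fin card rm in \<open>auto simp: n_def\<close>)
    then have "subexp I L (\<lambda>s. \<Sum>i\<in>I1. r i s)"
      using rm I by (intro subexp_mono[of _ I1 L I]) auto
    ultimately have "subexp I (6 * real n * c + L) (\<lambda>s. (\<Sum>i\<in>I1. a i s) + (\<Sum>i\<in>I1. r i s))"
      using am rm Lp np I by (intro subexp_add) auto
    then show ?thesis
      by (simp add: r_def flip: sum.distrib)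
  qed
  obtain I1 where I1: "I1 \<subseteq> I" "card I1 = card I div 2"
    by (meson div_le_dividend obtain_subset_with_card_n)
  have "subexp I ((6 * real n * c + L) + (6 * real n * c + L)) (\<lambda>s. (\<Sum>i\<in>I1. g i s) + (\<Sum>i\<in>I - I1. g i s))"
  proof (rule subexp_add)
    have f1: "finite I1"
      using I1 Suc.prems(1) finite_subset by blast
    have "card (I - I1) = card I - card I div 2"
      using I1 f1 by (simp add: card_Diff_subset)
    then have "card I1 \<le> n" "card (I - I1) \<le> n"
      using I1(2) Suc.prems(2) by (auto simp: n_def)
    then show "subexp I (6 * real n * c + L) (\<lambda>s. \<Sum>i\<in>I1. g i s)"
        "subexp I (6 * real n * c + L) (\<lambda>s. \<Sum>i\<in>I - I1. g i s)"
      using I1(1) by (auto intro!: half[of I1 "I - I1"] half[of "I - I1" I1])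
    show "bmeas (\<lambda>s. \<Sum>i\<in>I1. g i s)" "bmeas (\<lambda>s. \<Sum>i\<in>I - I1. g i s)"
      using Suc.prems(3) I1(1) by (auto intro!: bmeas_sum)
    show "0 < 6 * real n * c + L" "0 < 6 * real n * c + L"
      using Lp np by linarith+
  qed
  moreover have "(\<Sum>i\<in>I1. g i s) + (\<Sum>i\<in>I - I1. g i s) = (\<Sum>i\<in>I. g i s)" for s
    using sum.subset_diff[OF I1(1) Suc.prems(1), of "\<lambda>i. g i s"] by simp
  \<comment> \<open>Each half is charged its own block and the recursive remainder. After doubling,
    every level has added one unit of 6 * 2^(k+1) * c, which is where the logarithm of the sample
    size comes from.\<close>
  moreover have "(6 * real n * c + L) + (6 * real n * c + L) = 6 * (real (Suc k) + 1) * 2 ^ Suc k * c"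
    by (simp add: L_def n_def algebra_simps)
  ultimately show ?case
    by simp
qed

lemma prob_space_Q: "prob_space Q"
  by unfold_locales

lemma chernoff:
  assumes f: "bmeas f"
  shows "measure Q {s \<in> space Q. t \<le> f s} \<le> exp (- t) * (\<integral>s. exp (f s) \<partial>Q)"
proof -
  have "measure Q {s \<in> space Q. exp t \<le> exp (f s)} \<le> (\<integral>s. exp (f s) \<partial>Q) / exp t"
    using f by (intro integral_Markov_inequality_measure[where A="{}"] bmeas_integrable) auto
  then show ?thesis
    by (simp add: exp_minus divide_inverse mult.commute)
qed

section \<open>The generalization gap of a stable map\<close>

text \<open>The gap at point \<open>i\<close> is replaced by a decoupled version \<open>g i\<close>,
  at cost 2\<gamma> each, and \<open>g i\<close> is split into its conditional mean
  \<open>b i\<close> given coordinate \<open>i\<close> and a remainder \<open>r i\<close>. The three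
  terms of the threshold are the decoupling cost, \<open>subexp_sum\<close> with difference bound
  2\<gamma> for the remainders, and a Hoeffding bound for the independent \<open>b i\<close>. The
  last two are each allowed probability \<beta> / 2.\<close>

lemma generalization_tail:
  fixes h :: "('i \<Rightarrow> 'z) \<Rightarrow> 'z \<Rightarrow> real" and m \<gamma> \<beta> :: real
  assumes h: "(\<lambda>(s, z). h s z) \<in> borel_measurable (Q \<Otimes>\<^sub>M P)"
    and hm: "\<And>s z. s \<in> space Q \<Longrightarrow> z \<in> space P \<Longrightarrow> \<bar>h s z\<bar> \<le> m" and m: "0 < m"
    and stable: "\<And>s t j z. s \<in> space Q \<Longrightarrow> t \<in> space Q \<Longrightarrow> j \<in> U \<Longrightarrow> z \<in> space P \<Longrightarrow>
        \<bar>h (override_on s t {j}) z - h s z\<bar> \<le> \<gamma>" and \<gamma>: "0 < \<gamma>"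
    and U: "U \<noteq> {}" "card U \<le> 2 ^ k" and \<beta>: "0 < \<beta>" "\<beta> < 1"
  shows "measure Q {s \<in> space Q.
      2 * \<gamma> * card U + 12 * (real k + 1) * 2 ^ k * \<gamma> * ln (4 / \<beta>)
        + 4 * m * sqrt (card U * ln (2 / \<beta>))
      < (\<Sum>i\<in>U. (\<integral>z. h s z \<partial>P) - h s (s i))} \<le> \<beta>"
proof -
  interpret QP: pair_prob_space Q P ..
  define N where "N = real (card U)"
  have N: "0 < N"
    using U finite_U by (simp add: N_def card_gt_0_iff)
  define H where "H s = (\<integral>z. h s z \<partial>P)" for s
  \<comment> \<open>The loss at the point \<open>s i\<close> of the output computed with that point
    replaced by a fresh one. This removes the dependence of the output on the point at which it is
    tested.\<close>
  define w where "w i s = (\<integral>t. h (override_on s t {i}) (s i) \<partial>Q)" for i s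
  define g where "g i s = avg {i} H s - w i s" for i s
  have sp: "s i \<in> space P" if "s \<in> space Q" "i \<in> U" for s i
    using that by (auto simp: space_PiM)
  have hz: "h s \<in> borel_measurable P" if "s \<in> space Q" for s
    using measurable_Pair2[OF h that] by simp
  have Hbm: "bmeas H"
  proof (rule bmeasI[of _ m])
    show "H \<in> borel_measurable Q"
      unfolding H_def[abs_def] using h by (rule borel_measurable_lebesgue_integral)
    show "\<bar>H s\<bar> \<le> m" if "s \<in> space Q" for s
      unfolding H_def using hz[OF that] hm[OF that] by (rule integral_abs_le_const)
  qed
  have Hb: "bdiff \<gamma> U H"
    unfolding bdiff_def
  proof (intro ballI)
    fix s t j assume *: "s \<in> space Q" "t \<in> space Q" "j \<in> U"
    have st: "override_on s t {j} \<in> space Q"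
      using * by (simp add: override_space)
    have "integrable P (h (override_on s t {j}))" "integrable P (h s)"
      using hm[OF st] hm[OF *(1)] hz[OF st] hz[OF *(1)]
      by (auto intro!: integrable_const_bound[where B=m])
    then have "H (override_on s t {j}) - H s = (\<integral>z. h (override_on s t {j}) z - h s z \<partial>P)"
      unfolding H_def by simp
    also have "\<bar>\<dots>\<bar> \<le> \<gamma>"
      using hz[OF st] hz[OF *(1)] by (intro integral_abs_le_const stable[OF *]) auto
    finally show "\<bar>H (override_on s t {j}) - H s\<bar> \<le> \<gamma>" .
  qed
  have m2: "(\<lambda>(s, t). h (override_on s t {i}) (s i)) \<in> borel_measurable (Q \<Otimes>\<^sub>M Q)" if i: "i \<in> U" for i
  proof -
    have "(\<lambda>p. s_i p) \<in> Q \<Otimes>\<^sub>M Q \<rightarrow>\<^sub>M P" if "s_i = (\<lambda>p. fst p i)" for s_i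
      unfolding that using i by measurable
    then have "(\<lambda>p. (case p of (s, t) \<Rightarrow> override_on s t {i}, fst p i)) \<in> Q \<Otimes>\<^sub>M Q \<rightarrow>\<^sub>M Q \<Otimes>\<^sub>M P"
      by (intro measurable_Pair measurable_override) auto
    from measurable_compose[OF this h] show ?thesis
      by (simp add: split_beta')
  qed
  have m1: "(\<lambda>t. h (override_on s t {i}) (s i)) \<in> borel_measurable Q"
    if i: "i \<in> U" and s: "s \<in> space Q" for i s
    using measurable_Pair2[OF m2[OF i] s] by simp
  have wbm: "bmeas (w i)" if i: "i \<in> U" for i
  proof (rule bmeasI[of _ m])
    show "w i \<in> borel_measurable Q"
      unfolding w_def[abs_def] using m2[OF i] by (rule PF.borel_measurable_lebesgue_integral)
    show "\<bar>w i s\<bar> \<le> m" if "s \<in> space Q" for s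
      unfolding w_def using m1[OF i that]
      by (rule PF.integral_abs_le_const) (auto intro!: hm override_space sp that i)
  qed
  have gbm: "bmeas (g i)" if "i \<in> U" for i
    unfolding g_def[abs_def] using Hbm wbm[OF that] by simp
  have gm: "\<bar>g i s\<bar> \<le> 2 * m" if i: "i \<in> U" and s: "s \<in> space Q" for i s
  proof -
    have "\<bar>avg {i} H s\<bar> \<le> m"
    proof (rule avg_abs_le[OF Hbm s])
      fix t assume "t \<in> space Q"
      then have st: "override_on s t {i} \<in> space Q"
        using s by (simp add: override_space)
      show "\<bar>H (override_on s t {i})\<bar> \<le> m"
        unfolding H_def using hz[OF st] hm[OF st] by (rule integral_abs_le_const)
    qed
    moreover have "\<bar>w i s\<bar> \<le> m"
      unfolding w_def using m1[OF i s]
      by (rule PF.integral_abs_le_const) (auto intro!: hm override_space sp s i)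
    ultimately show ?thesis
      unfolding g_def by linarith
  qed
  \<comment> \<open>Once coordinate \<open>i\<close> is resampled in the output, \<open>s i\<close>
    is an independent test point with law \<open>P\<close>, so Fubini's theorem identifies the
    averaged \<open>w i\<close> with the averaged risk.\<close>
  have gz: "avg {i} (g i) s = 0" if i: "i \<in> U" and s: "s \<in> space Q" for i s
  proof -
    let ?h = "\<lambda>t z. h (override_on s t {i}) z"
    have hP: "(\<lambda>(t, z). ?h t z) \<in> borel_measurable (Q \<Otimes>\<^sub>M P)"
    proof -
      have "(\<lambda>p. (override_on s (fst p) {i}, snd p)) \<in> Q \<Otimes>\<^sub>M P \<rightarrow>\<^sub>M Q \<Otimes>\<^sub>M P"
        using measurable_override1[OF s]
        by (intro measurable_Pair measurable_compose[OF measurable_fst]) auto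
      from measurable_compose[OF this h] show ?thesis
        by (simp add: split_beta')
    qed
    have int: "integrable (Q \<Otimes>\<^sub>M P) (\<lambda>(t, z). ?h t z)"
      using hP by (intro QP.integrable_const_bound[where B=m])
        (auto simp: space_pair_measure intro!: AE_I2 hm override_space s)
    have "avg {i} (w i) s = (\<integral>t'. (\<integral>t. ?h t (t' i) \<partial>Q) \<partial>Q)"
      unfolding avg_def w_def
    proof (intro Bochner_Integration.integral_cong refl)
      fix t' t
      have "override_on (override_on s t' {i}) t {i} = override_on s t {i}"
        by (auto simp: override_on_def fun_eq_iff)
      moreover have "override_on s t' {i} i = t' i"
        by (simp add: override_on_def)
      ultimately show "h (override_on (override_on s t' {i}) t {i}) (override_on s t' {i} i) = ?h t (t' i)"
        by simp
    qed
    also have "\<dots> = (\<integral>z. (\<integral>t. ?h t z \<partial>Q) \<partial>distr Q P (\<lambda>t. t i))"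
    proof (rule integral_distr[symmetric])
      have "(\<lambda>(z, t). ?h t z) \<in> borel_measurable (P \<Otimes>\<^sub>M Q)"
        using measurable_compose[OF measurable_pair_swap' hP] by (simp add: split_beta')
      then show "(\<lambda>z. \<integral>t. ?h t z \<partial>Q) \<in> borel_measurable P"
        by (rule PF.borel_measurable_lebesgue_integral)
    qed (use i in simp)
    also have "distr Q P (\<lambda>t. t i) = P"
      using i by (intro distr_PiM_component) (rule prob_space_axioms)
    also have "(\<integral>z. (\<integral>t. ?h t z \<partial>Q) \<partial>P) = (\<integral>t. (\<integral>z. ?h t z \<partial>P) \<partial>Q)"
      using int by (rule QP.Fubini_integral)
    also have "\<dots> = avg {i} H s"
      by (simp add: avg_def H_def)
    finally have "avg {i} (w i) s = avg {i} H s" .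
    moreover have "avg {i} (g i) s = avg {i} (avg {i} H) s - avg {i} (w i) s"
      unfolding g_def[abs_def] using Hbm wbm[OF i] s by (intro avg_diff) auto
    ultimately show ?thesis
      using Hbm s by (simp add: avg_avg)
  qed
  have gb: "bdiff (2 * \<gamma>) (U - {i}) (g i)" if i: "i \<in> U" for i
    unfolding bdiff_def
  proof (intro ballI)
    fix s u j assume *: "s \<in> space Q" "u \<in> space Q" "j \<in> U - {i}"
    have su: "override_on s u {j} \<in> space Q"
      using * by (simp add: override_space)
    have "bdiff \<gamma> U (avg {i} H)"
      using Hbm Hb \<gamma> by (intro bdiff_avg) auto
    then have 1: "\<bar>avg {i} H (override_on s u {j}) - avg {i} H s\<bar> \<le> \<gamma>"
      using * by (simp add: bdiff_def)
    have d: "\<bar>h (override_on (override_on s u {j}) t {i}) (override_on s u {j} i) - h (override_on s t {i}) (s i)\<bar> \<le> \<gamma>"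
      if t: "t \<in> space Q" for t
    proof -
      have "override_on (override_on s u {j}) t {i} = override_on (override_on s t {i}) u {j}"
        using * by (auto simp: override_on_def fun_eq_iff)
      moreover have "override_on s u {j} i = s i"
        using * by (auto simp: override_on_def)
      ultimately show ?thesis
        using * t i by (simp add: stable override_space sp)
    qed
    have "integrable Q (\<lambda>t. h (override_on s t {i}) (s i))" if "s \<in> space Q" for s
      using m1[OF i that] by (intro PF.integrable_const_bound[where B=m])
        (auto intro!: hm override_space sp that i)
    from this[OF su] this[OF *(1)]
    have "w i (override_on s u {j}) - w i s
       = (\<integral>t. h (override_on (override_on s u {j}) t {i}) (override_on s u {j} i) - h (override_on s t {i}) (s i) \<partial>Q)"
      unfolding w_def by simp
    also have "\<bar>\<dots>\<bar> \<le> \<gamma>"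
      using m1[OF i su] m1[OF i *(1)] by (intro PF.integral_abs_le_const d borel_measurable_diff)
    finally show "\<bar>g i (override_on s u {j}) - g i s\<bar> \<le> 2 * \<gamma>"
      using 1 unfolding g_def by linarith
  qed
  \<comment> \<open>Resampling one point moves the risk and the loss at \<open>s i\<close> by at
    most \<gamma> each.\<close>
  have close: "H s - h s (s i) \<le> g i s + 2 * \<gamma>" if i: "i \<in> U" and s: "s \<in> space Q" for i s
  proof -
    have "\<bar>avg {i} (\<lambda>t. H t - H s) s\<bar> \<le> \<gamma>"
      using Hbm s Hb i by (intro avg_abs_le) (auto simp: bdiff_def)
    then have 1: "\<bar>avg {i} H s - H s\<bar> \<le> \<gamma>"
      using Hbm s by (simp add: avg_diff)
    have "integrable Q (\<lambda>t. h (override_on s t {i}) (s i))"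
      using m1[OF i s] by (intro PF.integrable_const_bound[where B=m])
        (auto intro!: hm override_space sp s i)
    then have "w i s - h s (s i) = (\<integral>t. h (override_on s t {i}) (s i) - h s (s i) \<partial>Q)"
      unfolding w_def by (simp add: prob_Q)
    also have "\<bar>\<dots>\<bar> \<le> \<gamma>"
      using m1[OF i s] by (intro PF.integral_abs_le_const) (auto intro!: stable sp s i)
    finally show ?thesis
      using 1 unfolding g_def by linarith
  qed
  \<comment> \<open>A function of coordinate \<open>i\<close> alone, of size up to 2m and not small;
    but such terms are independent, so their sum is of order m sqrt N. The remainders are centred in
    both senses required by \<open>subexp_sum\<close>.\<close>
  define b where "b i = avg (U - {i}) (g i)" for i
  have bbm: "bmeas (b i)" if "i \<in> U" for i
    using gbm[OF that] by (simp add: b_def)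
  have bz: "avg {i} (b i) s = 0" if i: "i \<in> U" and s: "s \<in> space Q" for i s
  proof -
    have "avg {i} (b i) s = avg (U - {i}) (avg {i} (g i)) s"
      unfolding b_def by (rule avg_swap[OF gbm[OF i] s])
    also have "\<dots> = avg (U - {i}) (\<lambda>_. 0) s"
      using gz i s by (intro avg_cong) auto
    finally show ?thesis
      by simp
  qed
  have bm: "\<bar>b i s\<bar> \<le> 2 * m" if i: "i \<in> U" and s: "s \<in> space Q" for i s
    unfolding b_def using gbm[OF i] s by (rule avg_abs_le) (intro gm i override_space s)
  define r where "r i s = g i s - b i s" for i s
  have rbm: "bmeas (r i)" if "i \<in> U" for i
    unfolding r_def[abs_def] using gbm bbm that by simp
  obtain s0 where s0: "s0 \<in> space Q"
    using prob_space.not_empty[OF prob_space_Q] by blast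
  define K where "K = 6 * (real k + 1) * 2 ^ k * (2 * \<gamma>)"
  have K: "0 < K"
    using \<gamma> by (simp add: K_def)
  have "subexp U K (\<lambda>s. \<Sum>i\<in>U. r i s)"
    unfolding K_def
  proof (rule subexp_sum)
    fix i assume i: "i \<in> U"
    show "avg {i} (r i) s = 0" if s: "s \<in> space Q" for s
      unfolding r_def[abs_def] avg_diff[OF gbm[OF i] bbm[OF i] s]
      using bz[OF i s] gz[OF i s] by simp
    show "avg (U - {i}) (r i) s = 0" if s: "s \<in> space Q" for s
      using gbm[OF i] s unfolding r_def[abs_def] b_def by (subst avg_diff) (simp_all add: avg_avg)
    show "bdiff (2 * \<gamma>) (U - {i}) (r i)"
      unfolding bdiff_def
    proof (intro ballI)
      fix s t j assume *: "s \<in> space Q" "t \<in> space Q" "j \<in> U - {i}"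
      \<comment> \<open>As in the halving, subtracting the average leaves the difference bound
        2\<gamma> unchanged.\<close>
      have "indep_of (U - {i}) (b i)"
        unfolding b_def by (rule indep_of_avg)
      then have "indep_of {j} (b i)"
        by (rule indep_of_mono) (use * in auto)
      then have "b i (override_on s t {j}) = b i s"
        using * by (simp add: indep_of_def)
      moreover have "\<bar>g i (override_on s t {j}) - g i s\<bar> \<le> 2 * \<gamma>"
        using gb[OF i] * by (auto simp: bdiff_def)
      ultimately show "\<bar>r i (override_on s t {j}) - r i s\<bar> \<le> 2 * \<gamma>"
        by (simp add: r_def)
    qed
  qed (use rbm finite_U U \<gamma> in auto)
  then have "(\<integral>s. exp ((\<Sum>i\<in>U. r i s) / K) \<partial>Q) \<le> 2"
    using s0 by (auto simp: subexp_def avg_UNIV)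
  then have "exp (- ln (4 / \<beta>)) * (\<integral>s. exp ((\<Sum>i\<in>U. r i s) / K) \<partial>Q) \<le> exp (- ln (4 / \<beta>)) * 2"
    by (intro mult_left_mono) auto
  also have "\<dots> = \<beta> / 2"
    using \<beta> by (simp add: exp_minus)
  finally have R: "measure Q {s \<in> space Q. ln (4 / \<beta>) \<le> (\<Sum>i\<in>U. r i s) / K} \<le> \<beta> / 2"
    using chernoff[of "\<lambda>s. (\<Sum>i\<in>U. r i s) / K" "ln (4 / \<beta>)"] rbm by simp
  define T where "T = ln (2 / \<beta>)"
  have T: "0 < T"
    using \<beta> by (simp add: T_def)
  \<comment> \<open>This \<theta> makes the sum of the squared bounds (2 m \<theta>)^2 equal to
    \<open>T\<close>. Chernoff's bound at level 2T then gives exp (-2T) exp T = exp (-T) = \<beta> /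
    2.\<close>
  define \<theta> where "\<theta> = sqrt (T / N) / (2 * m)"
  have \<theta>2: "\<theta>\<^sup>2 = T / (4 * m\<^sup>2 * N)"
    using T N by (simp add: \<theta>_def power_divide power_mult_distrib)
  have \<theta>p: "0 < \<theta>"
    using T N m by (simp add: \<theta>_def)
  have Tsq: "sqrt (T / N) * sqrt (N * T) = T"
    using T N by (simp flip: real_sqrt_mult)
  have "(\<integral>s. exp (\<Sum>i\<in>U. \<theta> * b i s) \<partial>Q) = avg U (\<lambda>s. 1 * exp (\<Sum>i\<in>U. \<theta> * b i s)) s0"
    using s0 by (simp add: avg_UNIV)
  also have "\<dots> \<le> avg U (\<lambda>s. 1 * exp (\<Sum>i\<in>U. (\<theta> * b i s)\<^sup>2)) s0"
  proof (rule avg_exp_sum_le_exp_square_sum[OF finite_U bbm _ bz _ _ _ s0])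
    show "indep_of (U - {i}) (b i)" for i
      unfolding b_def by (rule indep_of_avg)
  qed (auto simp: indep_of_def)
  also have "\<dots> \<le> avg U (\<lambda>s. exp T) s0"
  proof (rule avg_mono)
    fix s assume s: "s \<in> space Q"
    have "(\<Sum>i\<in>U. (\<theta> * b i s)\<^sup>2) \<le> (\<Sum>i\<in>U. \<theta>\<^sup>2 * (2 * m)\<^sup>2)"
    proof (rule sum_mono)
      fix i assume "i \<in> U"
      from bm[OF this s] have "(b i s)\<^sup>2 \<le> (2 * m)\<^sup>2"
        by (metis abs_ge_zero power2_abs power_mono)
      then show "(\<theta> * b i s)\<^sup>2 \<le> \<theta>\<^sup>2 * (2 * m)\<^sup>2"
        unfolding power_mult_distrib by (intro mult_left_mono) auto
    qed
    also have "\<dots> = T"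
      using N m by (simp add: \<theta>2 N_def power_mult_distrib)
    finally show "1 * exp (\<Sum>i\<in>U. (\<theta> * b i s)\<^sup>2) \<le> exp T"
      by simp
  qed (use bbm s0 in auto)
  finally have "(\<integral>s. exp (\<Sum>i\<in>U. \<theta> * b i s) \<partial>Q) \<le> exp T"
    by simp
  then have "exp (- (2 * T)) * (\<integral>s. exp (\<Sum>i\<in>U. \<theta> * b i s) \<partial>Q) \<le> exp (- (2 * T)) * exp T"
    by (intro mult_left_mono) auto
  also have "\<dots> = exp (- T)"
    by (simp flip: exp_add)
  also have "\<dots> = \<beta> / 2"
    using \<beta> by (simp add: T_def exp_minus)
  finally have Bt: "measure Q {s \<in> space Q. 2 * T \<le> (\<Sum>i\<in>U. \<theta> * b i s)} \<le> \<beta> / 2"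
    using chernoff[of "\<lambda>s. \<Sum>i\<in>U. \<theta> * b i s" "2 * T"] bbm by simp
  let ?R = "{s \<in> space Q. ln (4 / \<beta>) \<le> (\<Sum>i\<in>U. r i s) / K}"
  let ?B = "{s \<in> space Q. 2 * T \<le> (\<Sum>i\<in>U. \<theta> * b i s)}"
  let ?E = "{s \<in> space Q.
      2 * \<gamma> * card U + 12 * (real k + 1) * 2 ^ k * \<gamma> * ln (4 / \<beta>)
        + 4 * m * sqrt (card U * ln (2 / \<beta>))
      < (\<Sum>i\<in>U. (\<integral>z. h s z \<partial>P) - h s (s i))}"
  have RB: "?R \<in> sets Q" "?B \<in> sets Q"
  proof -
    have [measurable]: "(\<lambda>s. (\<Sum>i\<in>U. r i s) / K) \<in> borel_measurable Q"
      by (intro bmeas_meas bmeas_divide bmeas_sum rbm)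
    have [measurable]: "(\<lambda>s. \<Sum>i\<in>U. \<theta> * b i s) \<in> borel_measurable Q"
      by (intro bmeas_meas bmeas_sum bmeas_mult bmeas_const bbm)
    show "?R \<in> sets Q" "?B \<in> sets Q"
      by measurable
  qed
  have "?E \<subseteq> ?R \<union> ?B"
  proof
    fix s assume "s \<in> ?E"
    then have s: "s \<in> space Q" and E: "2 * \<gamma> * N + K * ln (4 / \<beta>) + 4 * m * sqrt (N * T)
      < (\<Sum>i\<in>U. H s - h s (s i))"
      by (auto simp: H_def N_def K_def T_def algebra_simps)
    have "(\<Sum>i\<in>U. H s - h s (s i)) \<le> (\<Sum>i\<in>U. g i s + 2 * \<gamma>)"
      using close s by (intro sum_mono) auto
    also have "\<dots> = (\<Sum>i\<in>U. r i s) + (\<Sum>i\<in>U. b i s) + 2 * \<gamma> * N"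
      by (simp add: r_def sum.distrib sum_subtractf N_def)
    finally have "K * ln (4 / \<beta>) \<le> (\<Sum>i\<in>U. r i s) \<or> 4 * m * sqrt (N * T) \<le> (\<Sum>i\<in>U. b i s)"
      using E by linarith
    then show "s \<in> ?R \<union> ?B"
    proof
      assume "K * ln (4 / \<beta>) \<le> (\<Sum>i\<in>U. r i s)"
      then show ?thesis
        using K s by (simp add: pos_le_divide_eq mult.commute)
    next
      assume "4 * m * sqrt (N * T) \<le> (\<Sum>i\<in>U. b i s)"
      then have "\<theta> * (4 * m * sqrt (N * T)) \<le> (\<Sum>i\<in>U. \<theta> * b i s)"
        using \<theta>p unfolding sum_distrib_left[symmetric] by (intro mult_left_mono) auto
      moreover have "\<theta> * (4 * m * sqrt (N * T)) = 2 * T"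
        using Tsq m by (simp add: \<theta>_def field_simps)
      ultimately show ?thesis
        using s by simp
    qed
  qed
  then have "measure Q ?E \<le> measure Q (?R \<union> ?B)"
    using RB by (intro PF.finite_measure_mono) auto
  also have "\<dots> \<le> measure Q ?R + measure Q ?B"
    using RB by (rule measure_Un_le)
  also have "\<dots> \<le> \<beta>"
    using R Bt by linarith
  finally show ?thesis .
qed

end

section \<open>Strong convexity of the regularizer\<close>

text \<open>Young's inequality with \<open>c\<close>, the convex combination of the two points, is
  the tangent bound at \<open>c\<close>; averaging it over \<open>u\<close> and \<open>v\<close>
  gives the claim multiplied by c^(1-r), which is why \<open>c = 0\<close> is treated apart.\<close>

lemma powr_concave_le:
  fixes u v \<theta> r :: real
  assumes r: "0 < r" "r \<le> 1" and uv: "0 \<le> u" "0 \<le> v" and \<theta>: "0 \<le> \<theta>" "\<theta> \<le> 1"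
  shows "\<theta> * u powr r + (1 - \<theta>) * v powr r \<le> (\<theta> * u + (1 - \<theta>) * v) powr r"
proof -
  define c where "c = \<theta> * u + (1 - \<theta>) * v"
  have c0: "0 \<le> \<theta> * u" "0 \<le> (1 - \<theta>) * v"
    using uv \<theta> by auto
  show ?thesis
  proof (cases "c = 0")
    case True
    then have "\<theta> * u = 0" "(1 - \<theta>) * v = 0"
      using c0 unfolding c_def by linarith+
    then have "\<theta> * u powr r = 0" "(1 - \<theta>) * v powr r = 0"
      by auto
    then show ?thesis
      using powr_ge_zero[of "\<theta> * u + (1 - \<theta>) * v" r] by linarith
  next
    case False
    then have c: "0 < c"
      using c0 unfolding c_def by linarith
    have young: "x powr r * c powr (1 - r) \<le> r * x + (1 - r) * c" if "0 \<le> x" for x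
      using Youngs_inequality_0[of r "1 - r" x c] r c that by (cases "x = 0") auto
    have "(\<theta> * u powr r + (1 - \<theta>) * v powr r) * c powr (1 - r)
        = \<theta> * (u powr r * c powr (1 - r)) + (1 - \<theta>) * (v powr r * c powr (1 - r))"
      by (simp add: algebra_simps)
    also have "\<dots> \<le> \<theta> * (r * u + (1 - r) * c) + (1 - \<theta>) * (r * v + (1 - r) * c)"
      using young uv \<theta> by (intro add_mono mult_left_mono) auto
    also have "\<dots> = r * (\<theta> * u + (1 - \<theta>) * v) + (1 - r) * c"
      by (simp add: algebra_simps)
    also have "\<dots> = c"
      unfolding c_def[symmetric] by (simp add: algebra_simps)
    also have "\<dots> = c powr r * c powr (1 - r)"
      using c by (simp flip: powr_add)
    finally show ?thesis
      using c by (simp add: c_def)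
  qed
qed

text \<open>Both vectors are scaled to unit size, and concavity of the r-th power is applied
  coordinatewise with weights U / (U + V) and V / (U + V). It will be used on squares with r = p/2,
  which turns squared p-norms into the expressions here.\<close>

lemma reverse_minkowski:
  fixes u v :: "'i \<Rightarrow> real"
  assumes r: "0 < r" "r \<le> 1" and fin: "finite I" and uv: "\<And>i. i \<in> I \<Longrightarrow> 0 \<le> u i" "\<And>i. i \<in> I \<Longrightarrow> 0 \<le> v i"
  shows "(\<Sum>i\<in>I. u i powr r) powr (1 / r) + (\<Sum>i\<in>I. v i powr r) powr (1 / r)
    \<le> (\<Sum>i\<in>I. (u i + v i) powr r) powr (1 / r)"
proof -
  define U where "U = (\<Sum>i\<in>I. u i powr r) powr (1 / r)"
  define V where "V = (\<Sum>i\<in>I. v i powr r) powr (1 / r)"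
  have s0: "0 \<le> (\<Sum>i\<in>I. u i powr r)" "0 \<le> (\<Sum>i\<in>I. v i powr r)"
    by (auto intro: sum_nonneg)
  have Ur: "U powr r = (\<Sum>i\<in>I. u i powr r)" and Vr: "V powr r = (\<Sum>i\<in>I. v i powr r)"
    using s0 r by (auto simp: U_def V_def powr_powr)
  have "0 \<le> U" "0 \<le> V"
    by (auto simp: U_def V_def)
  then consider "U = 0" | "V = 0" | "0 < U" "0 < V"
    by linarith
  then show ?thesis
  proof cases
    case 1
    have "V \<le> (\<Sum>i\<in>I. (u i + v i) powr r) powr (1 / r)"
      unfolding V_def using r uv by (intro powr_mono2 sum_mono sum_nonneg) auto
    then show ?thesis
      using 1 unfolding U_def V_def by simp
  next
    case 2
    have "U \<le> (\<Sum>i\<in>I. (u i + v i) powr r) powr (1 / r)"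
      unfolding U_def using r uv by (intro powr_mono2 sum_mono sum_nonneg) auto
    then show ?thesis
      using 2 unfolding U_def V_def by simp
  next
    case 3
    define \<theta> where "\<theta> = U / (U + V)"
    have \<theta>: "0 \<le> \<theta>" "\<theta> \<le> 1" "1 - \<theta> = V / (U + V)"
      using 3 by (auto simp: \<theta>_def field_simps)
    have mix: "\<theta> * (u i / U) + (1 - \<theta>) * (v i / V) = (u i + v i) / (U + V)" for i
      using 3 unfolding \<theta>(3) by (simp add: \<theta>_def add_divide_distrib)
    have "1 = \<theta> * ((\<Sum>i\<in>I. u i powr r) / U powr r) + (1 - \<theta>) * ((\<Sum>i\<in>I. v i powr r) / V powr r)"
      using 3 unfolding Ur[symmetric] Vr[symmetric] by simp
    also have "\<dots> = (\<Sum>i\<in>I. \<theta> * (u i / U) powr r + (1 - \<theta>) * (v i / V) powr r)"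
      using 3 uv by (simp add: powr_divide sum.distrib sum_distrib_left sum_divide_distrib)
    also have "\<dots> \<le> (\<Sum>i\<in>I. (\<theta> * (u i / U) + (1 - \<theta>) * (v i / V)) powr r)"
      using 3 uv \<theta> r by (intro sum_mono powr_concave_le) auto
    also have "\<dots> = (\<Sum>i\<in>I. ((u i + v i) / (U + V)) powr r)"
      by (simp only: mix)
    also have "\<dots> = (\<Sum>i\<in>I. (u i + v i) powr r) / (U + V) powr r"
      using 3 uv by (simp add: powr_divide sum_divide_distrib)
    finally have "(U + V) powr r \<le> (\<Sum>i\<in>I. (u i + v i) powr r)"
      using 3 by (simp add: pos_le_divide_eq)
    then have "((U + V) powr r) powr (1 / r) \<le> (\<Sum>i\<in>I. (u i + v i) powr r) powr (1 / r)"
      using r by (intro powr_mono2) auto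
    then show ?thesis
      using 3 r by (simp add: powr_powr U_def V_def)
  qed
qed

text \<open>The right side minus the quadratic has second derivative p (p-1) ((1+x)^(p-2) +
  (1-x)^(p-2) - 2). This is nonnegative by the arithmetic-geometric mean inequality, as the product
  (1-x^2)^(p-2) is at least 1 for p \<le> 2.\<close>

lemma two_plus_quadratic_le_powr:
  fixes p t :: real
  assumes p: "1 < p" "p \<le> 2" and t: "0 \<le> t" "t \<le> 1"
  shows "2 + p * (p - 1) * t\<^sup>2 \<le> (1 + t) powr p + (1 - t) powr p"
proof -
  have d2: "2 \<le> (1 + x) powr (p - 2) + (1 - x) powr (p - 2)" if x: "0 \<le> x" "x < 1" for x :: real
  proof -
    let ?u = "(1 + x) powr (p - 2)" and ?v = "(1 - x) powr (p - 2)"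
    have "x * x \<le> 1"
      using x by (simp add: mult_le_one)
    moreover have "x * x < 1"
      using x by (simp add: mult_less_le_imp_less less_1_mult' mult_strict_mono' power2_eq_square[symmetric] power_less_one_iff abs_square_less_1)
    ultimately have "1 \<le> ((1 + x) * (1 - x)) powr (p - 2)"
      using p powr_mono_both'[of "2 - p" "2 - p" "(1 + x) * (1 - x)" 1]
        powr_mono2'[of "p - 2" "(1 + x) * (1 - x)" 1] x
      by (simp add: algebra_simps)
    then have "1 \<le> ?u * ?v"
      using x by (simp add: powr_mult)
    moreover have "(?u + ?v)\<^sup>2 = (?u - ?v)\<^sup>2 + 4 * (?u * ?v)"
      by (simp add: power2_eq_square algebra_simps)
    ultimately have "4 \<le> (?u + ?v)\<^sup>2"
      using zero_le_power2[of "?u - ?v"] by linarith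
    then have "2\<^sup>2 \<le> (?u + ?v)\<^sup>2"
      by simp
    then show ?thesis
      by (rule power2_le_imp_le) simp
  qed
  define \<psi> where "\<psi> x = p * (1 + x) powr (p - 1) - p * (1 - x) powr (p - 1) - 2 * p * (p - 1) * x" for x
  have \<psi>: "0 \<le> \<psi> x" if x: "0 \<le> x" "x < 1" for x
  proof -
    have "\<psi> 0 \<le> \<psi> x"
    proof (rule DERIV_nonneg_imp_nondecreasing[OF x(1)])
      fix y assume y: "0 \<le> y" "y \<le> x"
      have "(\<psi> has_real_derivative
          p * (p - 1) * ((1 + y) powr (p - 2) + (1 - y) powr (p - 2) - 2)) (at y)"
        unfolding \<psi>_def[abs_def] using x y
        by (auto intro!: derivative_eq_intros simp: algebra_simps)
      moreover have "0 \<le> p * (p - 1) * ((1 + y) powr (p - 2) + (1 - y) powr (p - 2) - 2)"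
        using d2[of y] x y p by (intro mult_nonneg_nonneg) auto
      ultimately show "\<exists>D. (\<psi> has_real_derivative D) (at y) \<and> 0 \<le> D"
        by blast
    qed
    then show ?thesis
      by (simp add: \<psi>_def)
  qed
  define \<phi> where "\<phi> x = (1 + x) powr p + (1 - x) powr p - p * (p - 1) * x\<^sup>2" for x
  \<comment> \<open>At t = 1 the base 1 - x vanishes, so derivatives are taken on the open interval
    only and continuity covers the endpoint.\<close>
  have "\<phi> 0 \<le> \<phi> t"
  proof (rule DERIV_nonneg_imp_increasing_open[OF t(1)])
    fix y assume y: "0 < y" "y < t"
    then have "(\<phi> has_real_derivative \<psi> y) (at y)"
      unfolding \<phi>_def[abs_def] \<psi>_def using t
      by (auto intro!: derivative_eq_intros simp: algebra_simps)
    then show "\<exists>D. (\<phi> has_real_derivative D) (at y) \<and> 0 \<le> D"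
      using \<psi>[of y] y t by auto
  next
    show "continuous_on {0..t} \<phi>"
      unfolding \<phi>_def[abs_def] using p t
      by (auto intro!: continuous_intros continuous_on_powr')
  qed
  then show ?thesis
    by (simp add: \<phi>_def)
qed

text \<open>The scalar core of the theorem of Ball, Carlen and Lieb. By homogeneity only the ratio t
  = b/a matters, and the case of |b| above |a| is reduced to the other by exchanging the
  two.\<close>

lemma two_point_inequality:
  fixes a b p :: real
  assumes p: "1 < p" "p \<le> 2"
  shows "2 * (a\<^sup>2 + (p - 1) * b\<^sup>2) powr (p / 2) \<le> \<bar>a + b\<bar> powr p + \<bar>a - b\<bar> powr p"
proof -
  have main: "2 * (a\<^sup>2 + (p - 1) * b\<^sup>2) powr (p / 2) \<le> \<bar>a + b\<bar> powr p + \<bar>a - b\<bar> powr p"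
    if "0 \<le> b" "b \<le> a" for a b :: real
  proof (cases "a = 0")
    case True
    then show ?thesis
      using that by simp
  next
    case False
    define t where "t = b / a"
    have a: "0 < a" and t: "0 \<le> t" "t \<le> 1" and b: "b = a * t"
      using that False by (auto simp: t_def)
    \<comment> \<open>Young's inequality with second factor 1 is Bernoulli's inequality for the
      exponent p/2 \<le> 1; it reduces the claim to the quadratic lower bound.\<close>
    have "(1 + (p - 1) * t\<^sup>2) powr (p / 2) * 1 powr (1 - p / 2)
        \<le> (p / 2) * (1 + (p - 1) * t\<^sup>2) + (1 - p / 2) * 1"
      using p by (intro Youngs_inequality_0 add_pos_nonneg) auto
    then have "2 * (1 + (p - 1) * t\<^sup>2) powr (p / 2) \<le> 2 + p * (p - 1) * t\<^sup>2"
      by (simp add: algebra_simps)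
    also have "\<dots> \<le> (1 + t) powr p + (1 - t) powr p"
      by (rule two_plus_quadratic_le_powr[OF p t])
    finally have "a powr p * (2 * (1 + (p - 1) * t\<^sup>2) powr (p / 2))
        \<le> a powr p * ((1 + t) powr p + (1 - t) powr p)"
      by (rule mult_left_mono) simp
    moreover have "(a\<^sup>2 + (p - 1) * b\<^sup>2) powr (p / 2) = a powr p * (1 + (p - 1) * t\<^sup>2) powr (p / 2)"
    proof -
      have "a\<^sup>2 + (p - 1) * b\<^sup>2 = a\<^sup>2 * (1 + (p - 1) * t\<^sup>2)"
        by (simp add: b algebra_simps power_mult_distrib)
      moreover have "(a\<^sup>2) powr (p / 2) = a powr p"
        using a by (simp add: powr_powr flip: powr_numeral)
      ultimately show ?thesis
        by (simp add: powr_mult)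
    qed
    moreover have "\<bar>a + b\<bar> powr p = a powr p * (1 + t) powr p"
    proof -
      have "\<bar>a + b\<bar> = a * (1 + t)"
        using that by (simp add: b algebra_simps)
      then show ?thesis
        using a t by (simp add: powr_mult)
    qed
    moreover have "\<bar>a - b\<bar> powr p = a powr p * (1 - t) powr p"
    proof -
      have "\<bar>a - b\<bar> = a * (1 - t)"
        using that by (simp add: b algebra_simps)
      then show ?thesis
        using a t by (simp add: powr_mult)
    qed
    ultimately show ?thesis
      by (simp add: algebra_simps)
  qed
  have abs_swap: "\<bar>a + b\<bar> powr p + \<bar>a - b\<bar> powr p = \<bar>\<bar>a\<bar> + \<bar>b\<bar>\<bar> powr p + \<bar>\<bar>a\<bar> - \<bar>b\<bar>\<bar> powr p"
  proof -
    have "\<bar>a + b\<bar> = \<bar>\<bar>a\<bar> + \<bar>b\<bar>\<bar> \<and> \<bar>a - b\<bar> = \<bar>\<bar>a\<bar> - \<bar>b\<bar>\<bar>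
        \<or> \<bar>a + b\<bar> = \<bar>\<bar>a\<bar> - \<bar>b\<bar>\<bar> \<and> \<bar>a - b\<bar> = \<bar>\<bar>a\<bar> + \<bar>b\<bar>\<bar>"
      by arith
    then show ?thesis
      by auto
  qed
  show ?thesis
  proof (cases "\<bar>b\<bar> \<le> \<bar>a\<bar>")
    case True
    then show ?thesis
      using main[of "\<bar>b\<bar>" "\<bar>a\<bar>"] unfolding abs_swap by simp
  next
    case False
    \<comment> \<open>Exchanging \<open>a\<close> and \<open>b\<close> leaves the right side alone
      and can only increase the left side, as p - 1 \<le> 1.\<close>
    then have "a\<^sup>2 \<le> b\<^sup>2"
      by (simp add: abs_le_square_iff[symmetric])
    then have "(2 - p) * a\<^sup>2 \<le> (2 - p) * b\<^sup>2"
      using p by (intro mult_left_mono) auto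
    then have "a\<^sup>2 + (p - 1) * b\<^sup>2 \<le> b\<^sup>2 + (p - 1) * a\<^sup>2"
      by (simp add: algebra_simps)
    then have "(a\<^sup>2 + (p - 1) * b\<^sup>2) powr (p / 2) \<le> (b\<^sup>2 + (p - 1) * a\<^sup>2) powr (p / 2)"
      using p by (intro powr_mono2) auto
    then show ?thesis
      using main[of "\<bar>a\<bar>" "\<bar>b\<bar>"] False unfolding abs_swap
      by (simp add: abs_minus_commute add.commute)
  qed
qed

lemma pnorm_nonneg: "0 \<le> pnorm n p x"
  by (simp add: pnorm_def)

lemma pnorm_powr: "p \<noteq> 0 \<Longrightarrow> pnorm n p x powr p = (\<Sum>i<n. \<bar>x i\<bar> powr p)"
  by (simp add: pnorm_def powr_powr sum_nonneg)

lemma pnorm_power2: "0 < p \<Longrightarrow> (pnorm n p x)\<^sup>2 = (\<Sum>i<n. ((x i)\<^sup>2) powr (p / 2)) powr (1 / (p / 2))"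
proof -
  assume p: "0 < p"
  have "\<bar>x i\<bar> powr p = ((x i)\<^sup>2) powr (p / 2)" for i
    using powr_powr[of "\<bar>x i\<bar>" 2 "p / 2"] by simp
  moreover have "y powr (1 / (p / 2)) = (y powr (1 / p))\<^sup>2" if "0 \<le> y" for y
    using powr_powr[of y "1 / p" 2] p by simp
  ultimately show ?thesis
    by (simp add: pnorm_def sum_nonneg)
qed

lemma pnorm_cong: "(\<And>i. i < n \<Longrightarrow> \<bar>x i\<bar> = \<bar>y i\<bar>) \<Longrightarrow> pnorm n p x = pnorm n p y"
  by (simp add: pnorm_def)

lemma pnorm_cmult: "0 < p \<Longrightarrow> pnorm n p (\<lambda>i. c * x i) = \<bar>c\<bar> * pnorm n p x"
proof -
  assume p: "0 < p"
  have "pnorm n p (\<lambda>i. c * x i) = (\<bar>c\<bar> powr p * (\<Sum>i<n. \<bar>x i\<bar> powr p)) powr (1 / p)"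
    by (simp add: pnorm_def abs_mult powr_mult sum_distrib_left)
  also have "\<dots> = \<bar>c\<bar> * pnorm n p x"
    using p by (simp add: pnorm_def powr_mult powr_powr sum_nonneg)
  finally show ?thesis .
qed

text \<open>The squared p-norm is a quasi-norm of exponent p/2 applied to the squared coordinates.
  Reverse Minkowski merges the two terms on the left, the two-point inequality acts in each
  coordinate, and concavity of the power p/2 turns the mean of p-th powers into a mean of
  squares.\<close>

lemma pnorm_two_uniformly_convex:
  assumes p: "1 < p" "p \<le> 2"
  shows "(pnorm n p a)\<^sup>2 + (p - 1) * (pnorm n p b)\<^sup>2
    \<le> ((pnorm n p (\<lambda>i. a i + b i))\<^sup>2 + (pnorm n p (\<lambda>i. a i - b i))\<^sup>2) / 2"
proof -
  define r where "r = p / 2"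
  have r: "0 < r" "r \<le> 1"
    using p by (auto simp: r_def)
  let ?A = "pnorm n p (\<lambda>i. a i + b i)" and ?B = "pnorm n p (\<lambda>i. a i - b i)"
  have V: "(p - 1) * (pnorm n p b)\<^sup>2 = (\<Sum>i<n. ((p - 1) * (b i)\<^sup>2) powr r) powr (1 / r)"
  proof -
    have "(\<Sum>i<n. ((p - 1) * (b i)\<^sup>2) powr r) powr (1 / r)
        = ((p - 1) powr r * (\<Sum>i<n. ((b i)\<^sup>2) powr r)) powr (1 / r)"
      using p by (simp add: powr_mult sum_distrib_left)
    also have "\<dots> = (p - 1) * (\<Sum>i<n. ((b i)\<^sup>2) powr r) powr (1 / r)"
      using p r by (simp add: powr_mult powr_powr sum_nonneg)
    finally show ?thesis
      using p by (simp add: pnorm_power2 r_def)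
  qed
  have "(pnorm n p a)\<^sup>2 + (p - 1) * (pnorm n p b)\<^sup>2
      = (\<Sum>i<n. ((a i)\<^sup>2) powr r) powr (1 / r) + (\<Sum>i<n. ((p - 1) * (b i)\<^sup>2) powr r) powr (1 / r)"
    using p V by (simp add: pnorm_power2 r_def)
  also have "\<dots> \<le> (\<Sum>i<n. ((a i)\<^sup>2 + (p - 1) * (b i)\<^sup>2) powr r) powr (1 / r)"
    using p r by (intro reverse_minkowski) auto
  also have "\<dots> \<le> (\<Sum>i<n. (\<bar>a i + b i\<bar> powr p + \<bar>a i - b i\<bar> powr p) / 2) powr (1 / r)"
  proof (intro powr_mono2 sum_mono)
    show "((a i)\<^sup>2 + (p - 1) * (b i)\<^sup>2) powr r \<le> (\<bar>a i + b i\<bar> powr p + \<bar>a i - b i\<bar> powr p) / 2" for i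
      using two_point_inequality[OF p, of "a i" "b i"] by (simp add: r_def)
  qed (use r in \<open>auto intro: sum_nonneg\<close>)
  also have "(\<Sum>i<n. (\<bar>a i + b i\<bar> powr p + \<bar>a i - b i\<bar> powr p) / 2) = (?A powr p + ?B powr p) / 2"
    using p by (simp add: pnorm_powr sum.distrib sum_divide_distrib[symmetric])
  also have "\<dots> = (1 / 2) * (?A\<^sup>2) powr r + (1 - 1 / 2) * (?B\<^sup>2) powr r"
    using powr_powr[of ?A 2 r] powr_powr[of ?B 2 r] by (simp add: r_def pnorm_nonneg)
  also have "\<dots> powr (1 / r) \<le> (((1 / 2) * ?A\<^sup>2 + (1 - 1 / 2) * ?B\<^sup>2) powr r) powr (1 / r)"
    using r by (intro powr_mono2 powr_concave_le) auto
  also have "\<dots> = (?A\<^sup>2 + ?B\<^sup>2) / 2"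
    using r by (simp add: powr_powr add_divide_distrib)
  finally show ?thesis .
qed

text \<open>Each coordinate is at most the p-norm, so |x i|^q \<le> |x i|^p N^(q-p). This is where
  q' \<le> q enters: Lipschitz bounds in the \<open>q\<close>-norm transfer to the
  \<open>q'\<close>-norm in which the regularizer is strongly convex.\<close>

lemma pnorm_antimono:
  assumes "0 < p" "p \<le> q"
  shows "pnorm n q x \<le> pnorm n p x"
proof -
  define N where "N = pnorm n p x"
  have Np: "N powr p = (\<Sum>i<n. \<bar>x i\<bar> powr p)"
    using assms by (simp add: N_def pnorm_powr)
  have N0: "0 \<le> N"
    by (simp add: N_def pnorm_nonneg)
  have le: "\<bar>x i\<bar> \<le> N" if "i < n" for i
  proof -
    have "\<bar>x i\<bar> powr p \<le> N powr p"
      unfolding Np using that by (intro member_le_sum) auto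
    then show ?thesis
      using assms N0 powr_less_mono2[of p N "\<bar>x i\<bar>"] by linarith
  qed
  have "(\<Sum>i<n. \<bar>x i\<bar> powr q) \<le> (\<Sum>i<n. \<bar>x i\<bar> powr p * N powr (q - p))"
  proof (rule sum_mono)
    fix i assume "i \<in> {..<n}"
    then have "\<bar>x i\<bar> powr (q - p) \<le> N powr (q - p)"
      using le assms by (intro powr_mono2) auto
    then have "\<bar>x i\<bar> powr p * \<bar>x i\<bar> powr (q - p) \<le> \<bar>x i\<bar> powr p * N powr (q - p)"
      by (rule mult_left_mono) simp
    then show "\<bar>x i\<bar> powr q \<le> \<bar>x i\<bar> powr p * N powr (q - p)"
      by (simp flip: powr_add)
  qed
  also have "\<dots> = N powr q"
    by (simp flip: sum_distrib_right Np powr_add)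
  finally have "pnorm n q x \<le> (N powr q) powr (1 / q)"
    unfolding pnorm_def using assms by (intro powr_mono2) (auto intro: sum_nonneg)
  then show ?thesis
    using assms N0 by (simp add: powr_powr N_def)
qed

lemma pnorm_vdiff_commute: "pnorm n p (vdiff n x y) = pnorm n p (vdiff n y x)"
  by (rule pnorm_cong) (simp add: vdiff_def abs_minus_commute)

lemma pnorm_vdiff_midpoint:
  "0 < p \<Longrightarrow> pnorm n p (vdiff n (lincomb n (1 / 2) y (1 / 2) x) x) = pnorm n p (vdiff n y x) / 2"
proof -
  assume "0 < p"
  then have "pnorm n p (\<lambda>i. (1 / 2) * vdiff n y x i) = pnorm n p (vdiff n y x) / 2"
    by (subst pnorm_cmult) auto
  then show ?thesis
    by (subst pnorm_cong[where y="\<lambda>i. (1 / 2) * vdiff n y x i"])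
      (auto simp: vdiff_def lincomb_def field_simps)
qed

text \<open>Uniform convexity with \<open>a\<close> the midpoint minus \<open>x0\<close> and
  \<open>b\<close> half the difference, so that a + b and a - b are y - x0 and x - x0.\<close>

lemma regularizer_midpoint:
  assumes p: "1 < p" "p \<le> 2"
  shows "regularizer n p x0 (lincomb n (1 / 2) y (1 / 2) x)
    \<le> (regularizer n p x0 x + regularizer n p x0 y) / 2 - (p - 1) / 8 * (pnorm n p (vdiff n y x))\<^sup>2"
proof -
  define a where "a = vdiff n (lincomb n (1 / 2) y (1 / 2) x) x0"
  define b where "b i = (1 / 2) * vdiff n y x i" for i
  have "a i + b i = vdiff n y x0 i" "a i - b i = vdiff n x x0 i" if "i < n" for i
    using that by (simp_all add: a_def b_def vdiff_def lincomb_def field_simps)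
  then have "pnorm n p (\<lambda>i. a i + b i) = pnorm n p (vdiff n y x0)"
      "pnorm n p (\<lambda>i. a i - b i) = pnorm n p (vdiff n x x0)"
    by (auto intro!: pnorm_cong)
  moreover have "(pnorm n p (vdiff n y x))\<^sup>2 = 4 * (pnorm n p b)\<^sup>2"
    unfolding b_def[abs_def] using p by (subst pnorm_cmult) (auto simp: power_divide)
  ultimately show ?thesis
    using pnorm_two_uniformly_convex[OF p, of n a b]
    by (simp add: regularizer_def a_def field_simps)
qed

section \<open>Stability of approximate solutions\<close>

lemma approximate_solution_le:
  assumes sol: "approximate_solution m d \<Xi> B X f q' x0 lam0 N \<delta> q xt"
    and s: "s \<in> (\<Pi>\<^sub>E j\<in>{1..N}. \<Xi>)" and x: "x \<in> X" and XB: "X \<subseteq> B"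
  shows "regularized_SAA d f q' x0 lam0 N s (xt s)
    \<le> regularized_SAA d f q' x0 lam0 N s x + \<delta> * pnorm d q (vdiff d x (xt s))"
proof -
  obtain g where g: "g \<in> subdifferential d B (regularized_SAA d f q' x0 lam0 N s) (xt s)"
    and "dot d g (vdiff d x (xt s)) \<ge> - \<delta> * pnorm d q (vdiff d x (xt s))"
    using sol s x unfolding approximate_solution_def by blast
  moreover have "regularized_SAA d f q' x0 lam0 N s x
      \<ge> regularized_SAA d f q' x0 lam0 N s (xt s) + dot d g (vdiff d x (xt s))"
    using g x XB by (auto simp: subdifferential_def)
  ultimately show ?thesis
    by simp
qed

lemma approximate_solution_in:
  assumes "approximate_solution m d \<Xi> B X f q' x0 lam0 N \<delta> q xt"
    and "s \<in> (\<Pi>\<^sub>E j\<in>{1..N}. \<Xi>)"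
  shows "xt s \<in> X"
  using assms unfolding approximate_solution_def by blast

lemma regularized_SAA_midpoint:
  assumes conv: "\<And>z. z \<in> \<Xi> \<Longrightarrow> convex_on_Rn d B (\<lambda>x. f x z)"
    and s: "s \<in> (\<Pi>\<^sub>E j\<in>{1..N}. \<Xi>)" and xy: "x \<in> B" "y \<in> B"
    and q': "1 < q'" "q' \<le> 2" and lam0: "0 \<le> lam0"
  shows "regularized_SAA d f q' x0 lam0 N s (lincomb d (1 / 2) y (1 / 2) x)
    \<le> (regularized_SAA d f q' x0 lam0 N s x + regularized_SAA d f q' x0 lam0 N s y) / 2
      - lam0 * (q' - 1) / 8 * (pnorm d q' (vdiff d y x))\<^sup>2"
proof -
  let ?mid = "lincomb d (1 / 2) y (1 / 2) x"
  have "f ?mid (s j) \<le> (f x (s j) + f y (s j)) / 2" if "j \<in> {1..N}" for j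
  proof -
    have "s j \<in> \<Xi>"
      using s that by auto
    from conv[OF this] have "\<forall>x\<in>B. \<forall>y\<in>B. \<forall>u\<ge>0. \<forall>v\<ge>0. u + v = 1 \<longrightarrow>
        f (lincomb d u x v y) (s j) \<le> u * f x (s j) + v * f y (s j)"
      by (simp add: convex_on_Rn_def)
    from this[rule_format, OF xy(2,1), of "1 / 2" "1 / 2"] show ?thesis
      by simp
  qed
  then have "(\<Sum>j=1..N. f ?mid (s j)) \<le> (\<Sum>j=1..N. (f x (s j) + f y (s j)) / 2)"
    by (rule sum_mono)
  also have "\<dots> = ((\<Sum>j=1..N. f x (s j)) + (\<Sum>j=1..N. f y (s j))) / 2"
    by (simp add: sum.distrib sum_divide_distrib[symmetric])
  finally have "(1 / N) * (\<Sum>j=1..N. f ?mid (s j))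
      \<le> (1 / N) * (((\<Sum>j=1..N. f x (s j)) + (\<Sum>j=1..N. f y (s j))) / 2)"
    by (rule mult_left_mono) simp
  then have "SAA f N s ?mid \<le> (SAA f N s x + SAA f N s y) / 2"
    by (simp add: SAA_def add_divide_distrib)
  moreover have "lam0 * regularizer d q' x0 ?mid \<le> lam0 *
      ((regularizer d q' x0 x + regularizer d q' x0 y) / 2 - (q' - 1) / 8 * (pnorm d q' (vdiff d y x))\<^sup>2)"
    using regularizer_midpoint[OF q'] lam0 by (rule mult_left_mono)
  ultimately show ?thesis
    by (simp add: regularized_SAA_def algebra_simps)
qed

text \<open>
  Quadratic growth is obtained from the value at the midpoint of \<open>x\<close> and \<open>xt s\<close>, so that no
  subdifferential calculus is needed.
\<close>

lemma approximate_solution_growth: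
  assumes sol: "approximate_solution m d \<Xi> B X f q' x0 lam0 N \<delta> q xt"
    and conv: "\<And>z. z \<in> \<Xi> \<Longrightarrow> convex_on_Rn d B (\<lambda>x. f x z)"
    and X: "X \<subseteq> B" "convex_Rn d X"
    and s: "s \<in> (\<Pi>\<^sub>E j\<in>{1..N}. \<Xi>)" and x: "x \<in> X"
    and q': "1 < q'" "q' \<le> 2" "0 < q" and lam0: "0 \<le> lam0"
  shows "regularized_SAA d f q' x0 lam0 N s (xt s)
      + lam0 * (q' - 1) / 4 * (pnorm d q' (vdiff d x (xt s)))\<^sup>2
    \<le> regularized_SAA d f q' x0 lam0 N s x + \<delta> * pnorm d q (vdiff d x (xt s))"
proof -
  let ?y = "xt s"
  let ?mid = "lincomb d (1 / 2) x (1 / 2) ?y"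
  have y: "?y \<in> X"
    using sol s by (rule approximate_solution_in)
  have "?mid \<in> X"
    using X(2) x y unfolding convex_Rn_def by (auto simp: field_simps)
  from approximate_solution_le[OF sol s this X(1)]
  have "regularized_SAA d f q' x0 lam0 N s ?y
      \<le> regularized_SAA d f q' x0 lam0 N s ?mid + \<delta> * (pnorm d q (vdiff d x ?y) / 2)"
    using q' by (simp add: pnorm_vdiff_midpoint)
  also have "regularized_SAA d f q' x0 lam0 N s ?mid
      \<le> (regularized_SAA d f q' x0 lam0 N s ?y + regularized_SAA d f q' x0 lam0 N s x) / 2
        - lam0 * (q' - 1) / 8 * (pnorm d q' (vdiff d x ?y))\<^sup>2"
    using conv s x y X q' lam0 by (intro regularized_SAA_midpoint[where B=B and \<Xi>=\<Xi>]) auto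
  finally show ?thesis
    by (simp add: field_simps)
qed

text \<open>The growth inequalities for the two samples, each tested at the other solution, are
  added. Regularizers and common sample points cancel, leaving only the terms at index
  \<open>i\<close>: a quadratic in the distance \<open>r\<close> is bounded by a linear term in
  \<open>r\<close>, and \<open>r\<close> is divided out.\<close>

lemma approximate_solution_stable:
  assumes sol: "approximate_solution m d \<Xi> B X f q' x0 lam0 N \<delta> q xt"
    and conv: "\<And>z. z \<in> \<Xi> \<Longrightarrow> convex_on_Rn d B (\<lambda>x. f x z)"
    and X: "X \<subseteq> B" "convex_Rn d X"
    and lip: "\<And>x y z. x \<in> X \<Longrightarrow> y \<in> X \<Longrightarrow> z \<in> \<Xi> \<Longrightarrow> \<bar>f x z - f y z\<bar> \<le> L * pnorm d q (vdiff d x y)"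
    and s: "s \<in> (\<Pi>\<^sub>E j\<in>{1..N}. \<Xi>)" "s' \<in> (\<Pi>\<^sub>E j\<in>{1..N}. \<Xi>)"
    and i: "i \<in> {1..N}" "\<And>j. j \<noteq> i \<Longrightarrow> s' j = s j"
    and q': "1 < q'" "q' \<le> 2" "q' \<le> q" and lam0: "0 < lam0" and L: "0 \<le> L" and \<delta>: "0 \<le> \<delta>"
  shows "pnorm d q' (vdiff d (xt s') (xt s)) \<le> 4 * (L / N + \<delta>) / (lam0 * (q' - 1))"
proof -
  define x where "x = xt s"
  define x' where "x' = xt s'"
  define r where "r = pnorm d q' (vdiff d x' x)"
  have xX: "x \<in> X" "x' \<in> X"
    unfolding x_def x'_def using sol s approximate_solution_in by blast+
  have r0: "0 \<le> r"
    by (simp add: r_def pnorm_nonneg)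
  have rq: "pnorm d q (vdiff d x' x) \<le> r"
    unfolding r_def using q' by (intro pnorm_antimono) auto
  have N: "0 < real N"
    using i by auto
  let ?R = "regularized_SAA d f q' x0 lam0 N"
  have 1: "?R s x + lam0 * (q' - 1) / 4 * r\<^sup>2 \<le> ?R s x' + \<delta> * pnorm d q (vdiff d x' x)"
    unfolding x_def r_def
    using sol conv X s(1) xX q' lam0 by (intro approximate_solution_growth) (auto simp: x'_def)
  have 2: "?R s' x' + lam0 * (q' - 1) / 4 * r\<^sup>2 \<le> ?R s' x + \<delta> * pnorm d q (vdiff d x' x)"
    unfolding x'_def r_def pnorm_vdiff_commute[of d _ "xt s'"]
    using sol conv X s(2) xX q' lam0 by (intro approximate_solution_growth) (auto simp: x_def)
  have sums: "SAA f N s x' - SAA f N s x + SAA f N s' x - SAA f N s' x'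
      = (f x' (s i) - f x (s i) + f x (s' i) - f x' (s' i)) / N"
  proof -
    have "(\<Sum>j=1..N. f y (t j)) = f y (t i) + (\<Sum>j\<in>{1..N} - {i}. f y (t j))" for y t
      using i by (intro sum.remove) auto
    moreover have "(\<Sum>j\<in>{1..N} - {i}. f y (s' j)) = (\<Sum>j\<in>{1..N} - {i}. f y (s j))" for y
      using i by (intro sum.cong) auto
    ultimately show ?thesis
      unfolding SAA_def by (simp add: algebra_simps add_divide_distrib diff_divide_distrib)
  qed
  have si: "s i \<in> \<Xi>" "s' i \<in> \<Xi>"
    using s i by auto
  have "f x' (s i) - f x (s i) + f x (s' i) - f x' (s' i) \<le> 2 * L * pnorm d q (vdiff d x' x)"
    using lip[OF xX(2,1) si(1)] lip[OF xX(2,1) si(2)] by linarith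
  also have "\<dots> \<le> 2 * L * r"
    using rq L by (intro mult_left_mono) auto
  finally have "(f x' (s i) - f x (s i) + f x (s' i) - f x' (s' i)) / N \<le> 2 * L * r / N"
    by (rule divide_right_mono) simp
  moreover have "lam0 * (q' - 1) / 2 * r\<^sup>2
      \<le> SAA f N s x' - SAA f N s x + SAA f N s' x - SAA f N s' x' + 2 * (\<delta> * pnorm d q (vdiff d x' x))"
    using 1 2 by (simp add: regularized_SAA_def)
  moreover have "\<delta> * pnorm d q (vdiff d x' x) \<le> \<delta> * r"
    using rq \<delta> by (rule mult_left_mono)
  ultimately have "lam0 * (q' - 1) / 2 * r\<^sup>2 \<le> 2 * L * r / N + 2 * (\<delta> * r)"
    unfolding sums by linarith
  then have *: "(lam0 * (q' - 1) * r) * r \<le> (4 * (L / N + \<delta>)) * r"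
    by (simp add: power2_eq_square algebra_simps)
  have "lam0 * (q' - 1) * r \<le> 4 * (L / N + \<delta>)"
  proof (cases "r = 0")
    case True
    then show ?thesis
      using L \<delta> N by simp
  next
    case False
    then show ?thesis
      using r0 by (intro mult_right_le_imp_le[OF *]) simp
  qed
  then have "r \<le> 4 * (L / N + \<delta>) / (lam0 * (q' - 1))"
    using lam0 q' by (simp add: pos_le_divide_eq mult.commute)
  then show ?thesis
    by (simp add: r_def x_def x'_def)
qed

section \<open>Arithmetic of the sample size\<close>

lemma ln_ge_one:
  assumes "3 \<le> x"
  shows "1 \<le> ln (x :: real)"
proof -
  have "exp 1 \<le> x"
    using exp_le assms by linarith
  then show ?thesis
    using assms by (subst ln_ge_iff) auto
qed

text \<open>The halving argument needs a power of two above the sample size; the least one costs a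
  factor 2, and its exponent becomes the factor ln N.\<close>

lemma ex_power2_between:
  assumes "3 \<le> N"
  obtains k :: nat where "N \<le> 2 ^ k" "2 ^ k \<le> 2 * N" "real k + 1 \<le> 4 * ln (real N)"
proof -
  define k where "k = (LEAST k. N \<le> 2 ^ k)"
  have k: "N \<le> 2 ^ k"
    unfolding k_def by (rule LeastI_ex) (metis less_exp less_imp_le)
  have "k \<noteq> 0"
    using k assms by (intro notI) auto
  then obtain k' where k': "k = Suc k'"
    by (cases k) auto
  have "\<not> N \<le> 2 ^ k'"
    using k' not_less_Least[of k' "\<lambda>k. N \<le> 2 ^ k"] by (simp add: k_def)
  then have le: "(2::nat) ^ k \<le> 2 * N" and k'N: "(2::nat) ^ k' \<le> N"
    by (auto simp: k')
  have "real k' * ln 2 = ln (2 ^ k')"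
    by (simp add: ln_realpow)
  also have "\<dots> \<le> ln (real N)"
    using k'N assms by (subst ln_le_cancel_iff) (auto simp flip: of_nat_le_iff)
  finally have "real k' * ln 2 \<le> ln (real N)" .
  moreover have "real k' * (2 / 3) \<le> real k' * ln 2"
    using ln2_ge_two_thirds by (intro mult_left_mono) auto
  ultimately have "real k + 1 \<le> 2 + 3 / 2 * ln (real N)"
    by (simp add: k')
  also have "\<dots> \<le> 4 * ln (real N)"
    using ln_ge_one[of "real N"] assms by simp
  finally show ?thesis
    using that k le by blast
qed

text \<open>Numerical factors inside the logarithm are absorbed because c \<beta> \<le> 9 \<le> N^2,
  so that c / \<beta> is at most the square of N / \<beta>.\<close>

lemma ln_over_le:
  fixes N \<beta> c :: real
  assumes "3 \<le> N" "0 < \<beta>" "\<beta> < 1" "0 < c" "c \<le> 8"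
  shows "ln (c / \<beta>) \<le> 2 * ln (N / \<beta>)"
proof -
  have "c * \<beta> \<le> 9 * 1"
    using assms by (intro mult_mono) auto
  also have "\<dots> \<le> N * N"
    using assms mult_mono[of 3 N 3 N] by simp
  finally have "c / \<beta> \<le> (N / \<beta>)\<^sup>2"
    using assms by (simp add: power2_eq_square field_simps)
  then have "ln (c / \<beta>) \<le> ln ((N / \<beta>)\<^sup>2)"
    using assms by (subst ln_le_cancel_iff) auto
  then show ?thesis
    using assms by (simp add: ln_realpow)
qed

text \<open>
  All error terms are compared with \<open>W\<close>; the constants are those of \<open>generalization_tail\<close> for a
  confidence of \<open>\<beta> / 2\<close> and the stability constant \<open>\<gamma>\<close> of an \<open>L\<close>-Lipschitz problem.
\<close>

lemma sample_size_bounds: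
  fixes N k :: nat and R L \<epsilon> \<beta> q' D W \<gamma> :: real
  assumes N: "3 \<le> N" and R: "1 \<le> R" and L: "1 \<le> L" and \<epsilon>: "0 < \<epsilon>" "\<epsilon> \<le> 1" and \<beta>: "0 < \<beta>" "\<beta> < 1"
    and q': "1 < q'" "q' \<le> 2" and D: "0 \<le> D" "D\<^sup>2 \<le> R"
    and k: "2 ^ k \<le> 2 * N" "real k + 1 \<le> 4 * ln (real N)"
    and W: "W = R * L\<^sup>2 / \<epsilon>\<^sup>2 * (ln (real N) * ln (real N / \<beta>) / (q' - 1))"
    and big: "25000 * W \<le> N"
    and \<gamma>: "\<gamma> = 16 * R * L\<^sup>2 / (\<epsilon> * (q' - 1) * N)"
  shows "2 * \<gamma> * N + 12 * (real k + 1) * 2 ^ k * \<gamma> * ln (8 / \<beta>)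
        + 4 * (L * sqrt R) * sqrt (N * ln (4 / \<beta>)) \<le> N * (\<epsilon> / 4)"
    and "D / N \<le> \<epsilon> / 4" and "64 * L * sqrt R / \<epsilon> \<le> N"
proof -
  define l where "l = ln (real N)"
  define b where "b = ln (real N / \<beta>)"
  have Np: "0 < real N"
    using N by simp
  have l: "1 \<le> l"
    unfolding l_def using N by (intro ln_ge_one) auto
  have "real N * \<beta> \<le> real N * 1"
    using \<beta> Np by (intro mult_left_mono) auto
  then have "real N \<le> real N / \<beta>"
    using \<beta> by (simp add: pos_le_divide_eq)
  then have b: "1 \<le> b"
    unfolding b_def using N by (intro ln_ge_one) linarith
  have lb: "1 \<le> l * b"
    using l b mult_mono[of 1 l 1 b] by simp
  have g0: "0 < \<gamma>"
    unfolding \<gamma> using R L \<epsilon> q' N by (intro divide_pos_pos mult_pos_pos) auto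
  have gW: "\<gamma> * (l * b) = 16 * \<epsilon> * W / N"
    unfolding \<gamma> W l_def b_def using \<epsilon> q' Np by (simp add: power2_eq_square field_simps)
  have "25000 * (\<gamma> * (l * b)) = 16 * \<epsilon> * (25000 * W) / N"
    unfolding gW by simp
  also have "\<dots> \<le> 16 * \<epsilon> * N / N"
    using big \<epsilon> by (intro divide_right_mono mult_left_mono) auto
  also have "\<dots> = 16 * \<epsilon>"
    using Np by simp
  finally have gle: "25000 * (\<gamma> * (l * b)) \<le> 16 * \<epsilon>" .
  \<comment> \<open>The product 12 * 4 * 2 * 2 = 192 comes from the bounds on the exponent, on the
    power of two and on the logarithm.\<close>
  have "12 * (real k + 1) * 2 ^ k * \<gamma> * ln (8 / \<beta>) \<le> 12 * (4 * l) * (2 * N) * \<gamma> * (2 * b)"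
  proof (intro mult_mono)
    show "(2::real) ^ k \<le> real (2 * N)"
      using k(1) by (metis of_nat_le_iff of_nat_numeral of_nat_power)
    show "ln (8 / \<beta>) \<le> 2 * b"
      unfolding b_def using N \<beta> by (intro ln_over_le) auto
    show "0 \<le> ln (8 / \<beta>)"
      using \<beta> by (intro ln_ge_zero) (auto simp: field_simps)
  qed (use k l g0 in \<open>auto simp: l_def\<close>)
  also have "\<dots> = N * (192 * (\<gamma> * (l * b)))"
    by simp
  finally have t2: "12 * (real k + 1) * 2 ^ k * \<gamma> * ln (8 / \<beta>) \<le> N * (192 * (\<gamma> * (l * b)))" .
  have "\<gamma> * 1 \<le> \<gamma> * (l * b)"
    using lb g0 by (intro mult_left_mono) auto
  from mult_left_mono[OF this, of "2 * real N"]
  have t1: "2 * \<gamma> * N \<le> N * (2 * (\<gamma> * (l * b)))"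
    by (simp add: mult_ac)
  have W2: "R * L\<^sup>2 / \<epsilon>\<^sup>2 * b \<le> W"
  proof -
    have "b * 1 \<le> (l * b) / (q' - 1)"
    proof -
      have "b * (q' - 1) \<le> b * 1"
        using b q' by (intro mult_left_mono) auto
      also have "\<dots> \<le> l * b"
        using l b by simp
      finally show ?thesis
        using q' by (simp add: pos_le_divide_eq)
    qed
    then show ?thesis
      unfolding W l_def[symmetric] b_def[symmetric] using R L
      by (intro mult_left_mono) auto
  qed
  have "(4 * (L * sqrt R) * sqrt (N * ln (4 / \<beta>)))\<^sup>2 = 16 * (L\<^sup>2 * R) * (N * ln (4 / \<beta>))"
  proof -
    have "0 \<le> ln (4 / \<beta>)"
      using \<beta> by (intro ln_ge_zero) (auto simp: field_simps)
    then show ?thesis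
      using R by (simp add: power_mult_distrib)
  qed
  also have "\<dots> \<le> 16 * (L\<^sup>2 * R) * (N * (2 * b))"
    unfolding b_def using N R \<beta> by (intro mult_left_mono ln_over_le) auto
  also have "\<dots> = N * \<epsilon>\<^sup>2 * 32 * (R * L\<^sup>2 / \<epsilon>\<^sup>2 * b)"
    using \<epsilon> by simp
  also have "\<dots> \<le> N * \<epsilon>\<^sup>2 * 32 * W"
    using W2 by (intro mult_left_mono) auto
  also have "\<dots> \<le> N * \<epsilon>\<^sup>2 * 32 * (N / 25000)"
    using big by (intro mult_left_mono) auto
  also have "\<dots> \<le> (N * (\<epsilon> / 8))\<^sup>2"
    using Np \<epsilon> by (simp add: power2_eq_square)
  finally have t3: "4 * (L * sqrt R) * sqrt (N * ln (4 / \<beta>)) \<le> N * (\<epsilon> / 8)"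
    by (rule power2_le_imp_le) (use Np \<epsilon> in auto)
  \<comment> \<open>The origin of 25000: 192 and the 2 from decoupling make 194, and 194 * 16 * 8 =
    24832.\<close>
  have "194 * (\<gamma> * (l * b)) \<le> \<epsilon> / 8"
    using gle \<epsilon> by linarith
  then have "N * (194 * (\<gamma> * (l * b))) \<le> N * (\<epsilon> / 8)"
    by (rule mult_left_mono) simp
  with t1 t2 t3 show "2 * \<gamma> * N + 12 * (real k + 1) * 2 ^ k * \<gamma> * ln (8 / \<beta>)
        + 4 * (L * sqrt R) * sqrt (N * ln (4 / \<beta>)) \<le> N * (\<epsilon> / 4)"
    by (simp add: algebra_simps)
  have sR: "1 \<le> sqrt R" "sqrt R * sqrt R = R"
    using R by auto
  have sRL: "1 * (L * sqrt R) \<le> (L * sqrt R) * (L * sqrt R)"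
    using sR L mult_mono[of 1 L 1 "sqrt R"] by (intro mult_right_mono) auto
  have sRL2: "(L * sqrt R) * (L * sqrt R) = R * L\<^sup>2"
    using sR(2) by (simp add: power2_eq_square mult_ac)
  have RLW: "L * sqrt R / \<epsilon> \<le> W"
  proof -
    have "\<epsilon>\<^sup>2 \<le> \<epsilon>"
      using \<epsilon> by (simp add: power2_eq_square mult_le_cancel_left1)
    then have "L * sqrt R / \<epsilon> \<le> R * L\<^sup>2 / \<epsilon>\<^sup>2"
      using sRL sRL2 \<epsilon> L R by (intro frac_le) auto
    also have "\<dots> * 1 \<le> R * L\<^sup>2 / \<epsilon>\<^sup>2 * b"
      using b R by (intro mult_left_mono) auto
    finally show ?thesis
      using W2 by simp
  qed
  have RL0: "0 \<le> L * sqrt R / \<epsilon>"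
    using L R \<epsilon> by simp
  show "64 * L * sqrt R / \<epsilon> \<le> N"
    using RLW RL0 big by simp
  have "D \<le> sqrt R"
    using D by (simp add: real_le_rsqrt)
  also have "\<dots> \<le> L * sqrt R"
    using L R by (simp add: mult_le_cancel_right1)
  finally have "4 * D / \<epsilon> \<le> 4 * (L * sqrt R / \<epsilon>)"
    using \<epsilon> by (simp add: divide_right_mono)
  also have "\<dots> \<le> N"
    using RLW RL0 big by simp
  finally show "D / N \<le> \<epsilon> / 4"
    using \<epsilon> Np by (simp add: field_simps)
qed

section \<open>Sample complexity\<close>

lemma space_Borel_on: "S \<in> sets (Rn_borel n) \<Longrightarrow> space (Borel_on n S) = S"
  unfolding Borel_on_def by (simp add: sets.sets_into_space space_restrict_space Int_absorb2)

lemma measurable_Borel_on_mono: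
  assumes "g \<in> M \<rightarrow>\<^sub>M Borel_on n S" "S \<subseteq> T"
  shows "g \<in> M \<rightarrow>\<^sub>M Borel_on n T"
proof -
  have "g \<in> M \<rightarrow>\<^sub>M Rn_borel n" "g \<in> space M \<rightarrow> S"
    using assms(1) unfolding Borel_on_def by (auto simp: measurable_restrict_space2_iff)
  then show ?thesis
    using assms(2) unfolding Borel_on_def by (auto simp: measurable_restrict_space2_iff)
qed

text \<open>The generalization bound is applied to the increments of \<open>f\<close> relative to
  the fixed point \<open>x1\<close>: these are bounded by \<open>L\<close> times the diameter even
  if \<open>f\<close> is not, and their empirical mean is controlled by approximate optimality.
  Bias, inexactness and gap take \<epsilon> / 4 each.\<close>

lemma bounded_lipschitz_case:
  fixes P :: "rvec measure" and N :: nat and R L \<epsilon> \<beta> q q' D \<delta> :: real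
  assumes P: "prob_space P" and setsP: "sets P = sets (Borel_on m \<Xi>)" and \<Xi>: "\<Xi> \<in> sets (Rn_borel m)"
    and sol: "approximate_solution m d \<Xi> B X f q' x0 (\<epsilon> / (2 * R)) N \<delta> q xt"
    and fm: "(\<lambda>(x, z). f x z) \<in> borel_measurable (Borel_on d B \<Otimes>\<^sub>M Borel_on m \<Xi>)"
    and conv: "\<And>z. z \<in> \<Xi> \<Longrightarrow> convex_on_Rn d B (\<lambda>x. f x z)"
    and X: "X \<subseteq> B" "convex_Rn d X" and x1: "x1 \<in> X" and x0: "x0 \<in> X"
    and lip: "\<And>x y z. x \<in> X \<Longrightarrow> y \<in> X \<Longrightarrow> z \<in> \<Xi> \<Longrightarrow> \<bar>f x z - f y z\<bar> \<le> L * pnorm d q (vdiff d x y)"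
    and diam: "\<And>x y. x \<in> X \<Longrightarrow> y \<in> X \<Longrightarrow> pnorm d q' (vdiff d x y) \<le> D"
    and R: "1 \<le> R" "D\<^sup>2 \<le> R" and L: "1 \<le> L" and \<epsilon>: "0 < \<epsilon>" "\<epsilon> \<le> 1" and \<beta>: "0 < \<beta>" "\<beta> < 1"
    and q': "1 < q'" "q' \<le> 2" "q' \<le> q" and \<delta>: "0 \<le> \<delta>" "\<delta> \<le> 1 / N" and N: "3 \<le> N"
    and big: "25000 * (R * L\<^sup>2 / \<epsilon>\<^sup>2 * (ln (real N) * ln (real N / \<beta>) / (q' - 1))) \<le> N"
  shows "{s \<in> space (\<Pi>\<^sub>M j\<in>{1..N}. P). 3 * \<epsilon> / 4 < (\<integral>z. f (xt s) z - f x1 z \<partial>P)}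
      \<in> sets (\<Pi>\<^sub>M j\<in>{1..N}. P)"
    and "measure (\<Pi>\<^sub>M j\<in>{1..N}. P) {s \<in> space (\<Pi>\<^sub>M j\<in>{1..N}. P).
      3 * \<epsilon> / 4 < (\<integral>z. f (xt s) z - f x1 z \<partial>P)} \<le> \<beta> / 2"
proof -
  interpret P: prob_space P by fact
  interpret coordinate_average P "{1..N}"
    by unfold_locales auto
  have spP: "space P = \<Xi>"
    using sets_eq_imp_space_eq[OF setsP] space_Borel_on[OF \<Xi>] by simp
  have spQ: "space Q = (\<Pi>\<^sub>E j\<in>{1..N}. \<Xi>)"
    by (simp add: space_PiM spP)
  have xX: "xt s \<in> X" if "s \<in> space Q" for s
    using approximate_solution_in[OF sol] that spQ by auto
  have Np: "0 < real N"
    using N by simp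
  have D0: "0 \<le> D"
    using diam[OF x1 x1] pnorm_nonneg order_trans by blast
  have DR: "D \<le> sqrt R"
    using D0 R by (simp add: real_le_rsqrt)
  have pq: "pnorm d q (vdiff d x y) \<le> pnorm d q' (vdiff d x y)" for x y
    using q' by (intro pnorm_antimono) auto
  \<comment> \<open>Subtracting the same \<open>f x1 z\<close> for every sample makes
    \<open>h\<close> bounded and does not affect stability.\<close>
  define h where "h s z = f (xt s) z - f x1 z" for s z
  define mm where "mm = L * sqrt R"
  define \<gamma> where "\<gamma> = 16 * R * L\<^sup>2 / (\<epsilon> * (q' - 1) * N)"
  have g0: "0 < \<gamma>"
    unfolding \<gamma>_def using R L \<epsilon> q' N by (intro divide_pos_pos mult_pos_pos) auto
  obtain k :: nat where k: "N \<le> 2 ^ k" "2 ^ k \<le> 2 * N" "real k + 1 \<le> 4 * ln (real N)"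
    using ex_power2_between[OF N] by blast
  have fP: "(\<lambda>(x, z). f x z) \<in> borel_measurable (Borel_on d B \<Otimes>\<^sub>M P)"
    using fm by (simp add: measurable_def sets_pair_measure_cong[OF refl setsP]
        space_pair_measure sets_eq_imp_space_eq[OF setsP] cong: sets_pair_measure_cong)
  have xtQ: "xt \<in> Q \<rightarrow>\<^sub>M Borel_on d B"
  proof (rule measurable_Borel_on_mono[OF _ X(1)])
    have "sets (\<Pi>\<^sub>M j\<in>{1..N}. Borel_on m \<Xi>) = sets Q"
      by (intro sets_PiM_cong) (auto simp: setsP)
    then show "xt \<in> Q \<rightarrow>\<^sub>M Borel_on d X"
      using sol by (simp add: approximate_solution_def cong: measurable_cong_sets)
  qed
  have x1B: "x1 \<in> space (Borel_on d B)"
    using x1 X by (auto simp: Borel_on_def Rn_borel_def space_restrict_space space_PiM convex_Rn_def Rn_def)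
  have hmeas: "(\<lambda>(s, z). h s z) \<in> borel_measurable (Q \<Otimes>\<^sub>M P)"
  proof -
    have "(\<lambda>p. (xt (fst p), snd p)) \<in> Q \<Otimes>\<^sub>M P \<rightarrow>\<^sub>M Borel_on d B \<Otimes>\<^sub>M P"
      by (intro measurable_Pair measurable_compose[OF measurable_fst xtQ]) auto
    from measurable_compose[OF this fP]
    have "(\<lambda>p. f (xt (fst p)) (snd p)) \<in> borel_measurable (Q \<Otimes>\<^sub>M P)"
      by simp
    moreover have "(\<lambda>p. f x1 (snd p)) \<in> borel_measurable (Q \<Otimes>\<^sub>M P)"
      using measurable_compose[OF measurable_snd measurable_Pair2[OF fP x1B]] by simp
    ultimately show ?thesis
      by (simp add: h_def split_beta')
  qed
  have Hm: "(\<lambda>s. \<integral>z. h s z \<partial>P) \<in> borel_measurable Q"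
    using hmeas by (rule P.borel_measurable_lebesgue_integral)
  show "{s \<in> space Q. 3 * \<epsilon> / 4 < (\<integral>z. f (xt s) z - f x1 z \<partial>P)} \<in> sets Q"
    using Hm unfolding h_def by (rule borel_measurable_less[OF borel_measurable_const])
  have hb: "\<bar>h s z\<bar> \<le> mm" if "s \<in> space Q" "z \<in> space P" for s z
  proof -
    have "\<bar>h s z\<bar> \<le> L * pnorm d q (vdiff d (xt s) x1)"
      unfolding h_def using xX that x1 spP by (intro lip) auto
    also have "\<dots> \<le> L * sqrt R"
      using order_trans[OF order_trans[OF pq diam[OF xX[OF that(1)] x1]] DR] L
      by (intro mult_left_mono) auto
    finally show ?thesis
      by (simp add: mm_def)
  qed
  have hs: "\<bar>h (override_on s t {j}) z - h s z\<bar> \<le> \<gamma>"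
    if "s \<in> space Q" "t \<in> space Q" "j \<in> {1..N}" "z \<in> space P" for s t j z
  proof -
    have st: "override_on s t {j} \<in> space Q"
      using that(1,2) by (rule override_space)
    have "h (override_on s t {j}) z - h s z = f (xt (override_on s t {j})) z - f (xt s) z"
      by (simp add: h_def)
    also have "\<bar>\<dots>\<bar> \<le> L * pnorm d q (vdiff d (xt (override_on s t {j})) (xt s))"
      using xX[OF st] xX that spP by (intro lip) auto
    also have "\<dots> \<le> L * (4 * (L / N + \<delta>) / (\<epsilon> / (2 * R) * (q' - 1)))"
    proof (intro mult_left_mono order_trans[OF pq])
      show "pnorm d q' (vdiff d (xt (override_on s t {j})) (xt s))
          \<le> 4 * (L / N + \<delta>) / (\<epsilon> / (2 * R) * (q' - 1))"
        by (rule approximate_solution_stable[OF sol conv X lip, where i=j])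
          (use st[unfolded spQ] that(1)[unfolded spQ] that(3) q' \<epsilon> R L \<delta> in \<open>simp_all add: override_on_def spQ\<close>)
    qed (use L in auto)
    also have "\<dots> \<le> L * (4 * (2 * L / N) / (\<epsilon> / (2 * R) * (q' - 1)))"
    proof (intro mult_left_mono divide_right_mono)
      have "\<delta> \<le> L / N"
        using \<delta> L Np by (meson divide_right_mono less_imp_le order_trans)
      then show "L / N + \<delta> \<le> 2 * L / N"
        by simp
    qed (use L \<epsilon> R q' in auto)
    \<comment> \<open>The 16 is 4 from the stability lemma, 2 from \<delta> \<le> L/N, and 2 from
      the denominator of \<open>lam0\<close>.\<close>
    also have "\<dots> = \<gamma>"
      unfolding \<gamma>_def using \<epsilon> q' R Np by (simp add: field_simps power2_eq_square)
    finally show ?thesis .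
  qed
  have "measure Q {s \<in> space Q.
      2 * \<gamma> * card {1..N} + 12 * (real k + 1) * 2 ^ k * \<gamma> * ln (4 / (\<beta> / 2))
        + 4 * mm * sqrt (card {1..N} * ln (2 / (\<beta> / 2)))
      < (\<Sum>i\<in>{1..N}. (\<integral>z. h s z \<partial>P) - h s (s i))} \<le> \<beta> / 2" (is "measure Q ?G \<le> _")
    by (rule generalization_tail[OF hmeas hb _ hs g0]) (use N k(1) \<beta> L R in \<open>auto simp: mm_def\<close>)
  moreover have "measure Q {s \<in> space Q. 3 * \<epsilon> / 4 < (\<integral>z. f (xt s) z - f x1 z \<partial>P)} \<le> measure Q ?G"
  proof (rule finite_measure.finite_measure_mono)
    show "finite_measure Q"
      using prob_space_Q by (simp add: prob_space_def)
    show "?G \<in> sets Q"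
    proof -
      have "(\<lambda>s. h s (s i)) \<in> borel_measurable Q" if "i \<in> {1..N}" for i
      proof -
        have "(\<lambda>s. (s, s i)) \<in> Q \<rightarrow>\<^sub>M Q \<Otimes>\<^sub>M P"
          using that by (intro measurable_Pair) auto
        from measurable_compose[OF this hmeas] show ?thesis
          by simp
      qed
      then have [measurable]: "(\<lambda>s. \<Sum>i\<in>{1..N}. (\<integral>z. h s z \<partial>P) - h s (s i)) \<in> borel_measurable Q"
        by (intro borel_measurable_sum borel_measurable_diff Hm)
      show ?thesis
        by measurable
    qed
    show "{s \<in> space Q. 3 * \<epsilon> / 4 < (\<integral>z. f (xt s) z - f x1 z \<partial>P)} \<subseteq> ?G"
    proof
      fix s assume "s \<in> {s \<in> space Q. 3 * \<epsilon> / 4 < (\<integral>z. f (xt s) z - f x1 z \<partial>P)}"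
      then have s: "s \<in> space Q" and E: "3 * \<epsilon> / 4 < (\<integral>z. h s z \<partial>P)"
        by (auto simp: h_def)
      note size = sample_size_bounds[OF N R(1) L \<epsilon> \<beta> q'(1,2) D0 R(2) k(2,3) refl big \<gamma>_def]
      have "regularized_SAA d f q' x0 (\<epsilon> / (2 * R)) N s (xt s)
          \<le> regularized_SAA d f q' x0 (\<epsilon> / (2 * R)) N s x1 + \<delta> * pnorm d q (vdiff d x1 (xt s))"
        using sol s x1 X(1) unfolding spQ by (rule approximate_solution_le)
      moreover have "0 \<le> \<epsilon> / (2 * R) * regularizer d q' x0 (xt s)"
        using \<epsilon> R by (simp add: regularizer_def)
      \<comment> \<open>The choice of \<open>lam0\<close> balances here: the regularizer is at most
        D^2 / 2 \<le> R / 2, so the bias is at most \<epsilon> / 4.\<close>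
      moreover have "\<epsilon> / (2 * R) * regularizer d q' x0 x1 \<le> \<epsilon> / 4"
      proof -
        have "(pnorm d q' (vdiff d x1 x0))\<^sup>2 \<le> D\<^sup>2"
          using diam[OF x1 x0] pnorm_nonneg by (intro power_mono) auto
        then have "\<epsilon> / (2 * R) * regularizer d q' x0 x1 \<le> \<epsilon> / (2 * R) * (1 / 2 * R)"
          unfolding regularizer_def using \<epsilon> R by (intro mult_left_mono) auto
        then show ?thesis
          using R by simp
      qed
      moreover have "\<delta> * pnorm d q (vdiff d x1 (xt s)) \<le> \<epsilon> / 4"
      proof -
        have "\<delta> * pnorm d q (vdiff d x1 (xt s)) \<le> 1 / N * D"
          using \<delta> order_trans[OF pq diam[OF x1 xX[OF s]]] by (intro mult_mono pnorm_nonneg) auto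
        also have "\<dots> = D / N"
          by simp
        also note size(2)
        finally show ?thesis .
      qed
      ultimately have "SAA f N s (xt s) - SAA f N s x1 \<le> \<epsilon> / 2"
        unfolding regularized_SAA_def by linarith
      moreover have "SAA f N s (xt s) - SAA f N s x1 = (1 / N) * (\<Sum>i\<in>{1..N}. h s (s i))"
        by (simp add: SAA_def h_def sum_subtractf right_diff_distrib)
      ultimately have "(\<Sum>i\<in>{1..N}. h s (s i)) \<le> N * (\<epsilon> / 2)"
        using Np by (simp add: field_simps)
      moreover have "N * (3 * \<epsilon> / 4) < N * (\<integral>z. h s z \<partial>P)"
        using E Np by (intro mult_strict_left_mono) auto
      moreover have "N * (3 * \<epsilon> / 4) = N * (\<epsilon> / 4) + N * (\<epsilon> / 2)"
        by (simp add: field_simps)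
      ultimately have "N * (\<epsilon> / 4) < (\<Sum>i\<in>{1..N}. (\<integral>z. h s z \<partial>P) - h s (s i))"
        by (simp add: sum_subtractf)
      then show "s \<in> ?G"
        using size(1) s by (simp add: mm_def)
    qed
  qed
  ultimately show "measure Q {s \<in> space Q. 3 * \<epsilon> / 4 < (\<integral>z. f (xt s) z - f x1 z \<partial>P)} \<le> \<beta> / 2"
    by linarith
qed

section \<open>Truncation of the sample points\<close>

lemma regularized_SAA_truncate:
  "regularized_SAA d (\<lambda>x z. f x (\<rho> z)) q' x0 lam0 N s
    = regularized_SAA d f q' x0 lam0 N (\<lambda>j\<in>{1..N}. \<rho> (s j))"
  by (rule ext) (simp add: regularized_SAA_def SAA_def)

text \<open>Solving the truncated problem on a sample is solving the original one on the truncated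
  sample. The latter is a legitimate sample value, and the definition asks for approximate
  optimality at every such value.\<close>

lemma approximate_solution_truncate:
  assumes sol: "approximate_solution m d \<Xi> B X f q' x0 lam0 N \<delta> q xt"
    and \<rho>: "\<rho> \<in> Borel_on m \<Xi> \<rightarrow>\<^sub>M Borel_on m \<Xi>" and \<Xi>: "\<Xi> \<in> sets (Rn_borel m)"
  shows "approximate_solution m d \<Xi> B X (\<lambda>x z. f x (\<rho> z)) q' x0 lam0 N \<delta> q
    (\<lambda>s. xt (\<lambda>j\<in>{1..N}. \<rho> (s j)))"
  unfolding approximate_solution_def
proof (intro conjI ballI)
  let ?S = "Borel_on m \<Xi>"
  have "(\<lambda>s. \<lambda>j\<in>{1..N}. \<rho> (s j)) \<in> (\<Pi>\<^sub>M j\<in>{1..N}. ?S) \<rightarrow>\<^sub>M (\<Pi>\<^sub>M j\<in>{1..N}. ?S)"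
  proof (rule measurable_restrict)
    fix j assume "j \<in> {1..N}"
    then have "(\<lambda>s. s j) \<in> (\<Pi>\<^sub>M j\<in>{1..N}. ?S) \<rightarrow>\<^sub>M ?S"
      by (rule measurable_component_singleton)
    then show "(\<lambda>s. \<rho> (s j)) \<in> (\<Pi>\<^sub>M j\<in>{1..N}. ?S) \<rightarrow>\<^sub>M ?S"
      using \<rho> by (rule measurable_compose)
  qed
  moreover have "xt \<in> (\<Pi>\<^sub>M j\<in>{1..N}. ?S) \<rightarrow>\<^sub>M Borel_on d X"
    using sol unfolding approximate_solution_def by blast
  ultimately show "(\<lambda>s. xt (\<lambda>j\<in>{1..N}. \<rho> (s j))) \<in> (\<Pi>\<^sub>M j\<in>{1..N}. ?S) \<rightarrow>\<^sub>M Borel_on d X"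
    by (rule measurable_compose)
next
  fix s assume s: "s \<in> (\<Pi>\<^sub>E j\<in>{1..N}. \<Xi>)"
  have "\<rho> z \<in> \<Xi>" if "z \<in> \<Xi>" for z
    using measurable_space[OF \<rho>] that by (simp add: space_Borel_on[OF \<Xi>])
  then have s': "(\<lambda>j\<in>{1..N}. \<rho> (s j)) \<in> (\<Pi>\<^sub>E j\<in>{1..N}. \<Xi>)"
    using s by auto
  then show "xt (\<lambda>j\<in>{1..N}. \<rho> (s j)) \<in> X"
    using sol by (rule approximate_solution_in[rotated])
  show "\<exists>g\<in>subdifferential d B (regularized_SAA d (\<lambda>x z. f x (\<rho> z)) q' x0 lam0 N s) (xt (\<lambda>j\<in>{1..N}. \<rho> (s j))).
      \<forall>x\<in>X. - \<delta> * pnorm d q (vdiff d x (xt (\<lambda>j\<in>{1..N}. \<rho> (s j))))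
        \<le> dot d g (vdiff d x (xt (\<lambda>j\<in>{1..N}. \<rho> (s j))))"
    using sol s' unfolding approximate_solution_def regularized_SAA_truncate by blast
qed

context stochastic_program
begin

lemma space_Xi: "space (Borel_on m \<Xi>) = \<Xi>"
  using Xi_borel by (rule space_Borel_on)

lemma X_Borel_on: "x \<in> X \<Longrightarrow> x \<in> space (Borel_on d B)"
  using X_subset X_convex
  by (auto simp: Borel_on_def Rn_borel_def space_restrict_space space_PiM convex_Rn_def Rn_def)

lemma f_section_measurable: "x \<in> X \<Longrightarrow> f x \<in> borel_measurable (Borel_on m \<Xi>)"
  using measurable_Pair2[OF f_measurable X_Borel_on] by simp

lemma expected_value_measurable:
  "expected_value \<Omega> \<xi> f \<in> borel_measurable (Borel_on d B)"
proof -
  have "(\<lambda>p. (fst p, \<xi> (snd p))) \<in> Borel_on d B \<Otimes>\<^sub>M \<Omega> \<rightarrow>\<^sub>M Borel_on d B \<Otimes>\<^sub>M Borel_on m \<Xi>"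
    by (intro measurable_Pair measurable_compose[OF measurable_snd xi_measurable]) auto
  from measurable_compose[OF this f_measurable]
  have "(\<lambda>(x, \<omega>). f x (\<xi> \<omega>)) \<in> borel_measurable (Borel_on d B \<Otimes>\<^sub>M \<Omega>)"
    by (simp add: split_beta')
  then show ?thesis
    unfolding expected_value_def[abs_def] by (rule borel_measurable_lebesgue_integral)
qed

lemma sample_measurable:
  assumes "iid_sample \<Omega> (Borel_on m \<Xi>) \<xi> N \<xi>s"
  shows "sample N \<xi>s \<in> \<Omega> \<rightarrow>\<^sub>M (\<Pi>\<^sub>M j\<in>{1..N}. Borel_on m \<Xi>)"
  using assms unfolding iid_sample_def sample_def[abs_def] indep_vars_def
  by (intro measurable_restrict) auto

lemma distr_sample:
  assumes iid: "iid_sample \<Omega> (Borel_on m \<Xi>) \<xi> N \<xi>s" and N: "1 \<le> N"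
  shows "distr \<Omega> (\<Pi>\<^sub>M j\<in>{1..N}. Borel_on m \<Xi>) (sample N \<xi>s)
    = (\<Pi>\<^sub>M j\<in>{1..N}. distr \<Omega> (Borel_on m \<Xi>) \<xi>)"
proof -
  have rv: "\<xi>s j \<in> \<Omega> \<rightarrow>\<^sub>M Borel_on m \<Xi>" if "j \<in> {1..N}" for j
    using iid that unfolding iid_sample_def indep_vars_def by auto
  have "distr \<Omega> (\<Pi>\<^sub>M j\<in>{1..N}. Borel_on m \<Xi>) (sample N \<xi>s)
      = (\<Pi>\<^sub>M j\<in>{1..N}. distr \<Omega> (Borel_on m \<Xi>) (\<xi>s j))"
    unfolding sample_def[abs_def]
    using iid indep_vars_iff_distr_eq_PiM'[where I="{1..N}" and M'="\<lambda>_. Borel_on m \<Xi>" and X=\<xi>s] rv N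
    by (simp add: iid_sample_def)
  also have "\<dots> = (\<Pi>\<^sub>M j\<in>{1..N}. distr \<Omega> (Borel_on m \<Xi>) \<xi>)"
    using iid by (intro PiM_cong) (auto simp: iid_sample_def)
  finally show ?thesis .
qed

lemma excess_risk_measurable:
  assumes iid: "iid_sample \<Omega> (Borel_on m \<Xi>) \<xi> N \<xi>s"
    and sol: "approximate_solution m d \<Xi> B X f q' x0 lam0 N \<delta> q xt"
  shows "(\<lambda>\<omega>. expected_value \<Omega> \<xi> f (xt (sample N \<xi>s \<omega>))) \<in> borel_measurable \<Omega>"
proof -
  have "xt \<in> (\<Pi>\<^sub>M j\<in>{1..N}. Borel_on m \<Xi>) \<rightarrow>\<^sub>M Borel_on d X"
    using sol unfolding approximate_solution_def by blast
  then have "xt \<in> (\<Pi>\<^sub>M j\<in>{1..N}. Borel_on m \<Xi>) \<rightarrow>\<^sub>M Borel_on d B"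
    using X_subset by (rule measurable_Borel_on_mono)
  from measurable_compose[OF measurable_compose[OF sample_measurable[OF iid] this] expected_value_measurable]
  show ?thesis .
qed

text \<open>The common form of the three parts, with the level \<open>L\<close> still free:
  \<open>tail\<close> pays for a union bound over the sample, \<open>trunc\<close> for the change of
  the expected objective, and \<open>big\<close> for the bounded Lipschitz case.\<close>

theorem success_probability:
  fixes N :: nat and R L \<epsilon> \<beta> q q' D \<delta> \<tau> :: real
  assumes x0: "x0 \<in> X" and iid: "iid_sample \<Omega> (Borel_on m \<Xi>) \<xi> N \<xi>s"
    and sol: "approximate_solution m d \<Xi> B X f q' x0 (\<epsilon> / (2 * R)) N \<delta> q xt"
    and conv: "\<And>z. z \<in> \<Xi> \<Longrightarrow> convex_on_Rn d B (\<lambda>x. f x z)"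
    and diam: "\<And>x y. x \<in> X \<Longrightarrow> y \<in> X \<Longrightarrow> pnorm d q' (vdiff d x y) \<le> D"
    and M: "M \<in> borel_measurable (Borel_on m \<Xi>)"
    and lip: "\<And>x y z. x \<in> X \<Longrightarrow> y \<in> X \<Longrightarrow> z \<in> \<Xi> \<Longrightarrow> \<bar>f x z - f y z\<bar> \<le> M z * pnorm d q (vdiff d x y)"
    and R: "1 \<le> R" "D\<^sup>2 \<le> R" and L: "1 \<le> L" and \<epsilon>: "0 < \<epsilon>" "\<epsilon> \<le> 1" and \<beta>: "0 < \<beta>" "\<beta> < 1"
    and q': "1 < q'" "q' \<le> 2" "q' \<le> q" and \<delta>: "0 \<le> \<delta>" "\<delta> \<le> 1 / N" and N: "3 \<le> N"
    and Mint: "integrable \<Omega> (\<lambda>\<omega>. M (\<xi> \<omega>) * indicator {\<omega>. L < M (\<xi> \<omega>)} \<omega>)"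
    and trunc: "(\<integral>\<omega>. M (\<xi> \<omega>) * indicator {\<omega>. L < M (\<xi> \<omega>)} \<omega> \<partial>\<Omega>) \<le> \<tau>" "8 * D * \<tau> \<le> \<epsilon>"
    and tail: "measure \<Omega> {\<omega> \<in> space \<Omega>. L < M (\<xi> \<omega>)} \<le> \<beta> / (2 * N)"
    and big: "25000 * (R * L\<^sup>2 / \<epsilon>\<^sup>2 * (ln (real N) * ln (real N / \<beta>) / (q' - 1))) \<le> N"
  shows "1 - \<beta> \<le> measure \<Omega> {\<omega> \<in> space \<Omega>.
    expected_value \<Omega> \<xi> f (xt (sample N \<xi>s \<omega>)) - expected_value \<Omega> \<xi> f xstar \<le> \<epsilon>}"
proof -
  let ?S = "Borel_on m \<Xi>"
  let ?F = "expected_value \<Omega> \<xi> f"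
  define P where "P = distr \<Omega> ?S \<xi>"
  define Q where "Q = (\<Pi>\<^sub>M j\<in>{1..N}. P)"
  have Np: "0 < real N"
    using N by simp
  have setsP: "sets P = sets ?S"
    by (simp add: P_def)
  have spP: "space P = \<Xi>"
    by (simp add: P_def space_Xi)
  have P: "prob_space P"
    unfolding P_def by (rule prob_space_distr[OF xi_measurable])
  have setsQ: "sets Q = sets (\<Pi>\<^sub>M j\<in>{1..N}. ?S)"
    unfolding Q_def by (intro sets_PiM_cong) (auto simp: setsP)
  have spQ: "space Q = (\<Pi>\<^sub>E j\<in>{1..N}. \<Xi>)"
    by (simp add: Q_def space_PiM spP)
  have xi_in: "\<xi> \<omega> \<in> \<Xi>" if "\<omega> \<in> space \<Omega>" for \<omega>
    using measurable_space[OF xi_measurable that] by (simp add: space_Xi)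
  have Mxi: "(\<lambda>\<omega>. M (\<xi> \<omega>)) \<in> borel_measurable \<Omega>"
    using xi_measurable M by (rule measurable_compose)
  have D0: "0 \<le> D"
    using diam[OF x0 x0] pnorm_nonneg order_trans by blast
  have pq: "pnorm d q (vdiff d x y) \<le> D" if "x \<in> X" "y \<in> X" for x y
    using q' diam[OF that] pnorm_antimono[of q' q d "vdiff d x y"] by linarith
  have smp: "sample N \<xi>s \<in> \<Omega> \<rightarrow>\<^sub>M Q"
    using sample_measurable[OF iid] setsQ by (simp cong: measurable_cong_sets)
  have dsmp: "distr \<Omega> Q (sample N \<xi>s) = Q"
  proof -
    have "distr \<Omega> Q (sample N \<xi>s) = distr \<Omega> (\<Pi>\<^sub>M j\<in>{1..N}. ?S) (sample N \<xi>s)"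
      by (intro distr_cong setsQ) auto
    then show ?thesis
      using distr_sample[OF iid] N by (simp add: Q_def P_def)
  qed

  \<comment> \<open>Otherwise the tail probability would be 1, which exceeds \<beta> / (2N).\<close>
  have "\<exists>z0\<in>\<Xi>. M z0 \<le> L"
  proof (rule ccontr)
    assume "\<not> ?thesis"
    then have "{\<omega> \<in> space \<Omega>. L < M (\<xi> \<omega>)} = space \<Omega>"
      using xi_in by fastforce
    then have "1 \<le> \<beta> / (2 * N)"
      using tail prob_space by simp
    then show False
      using Np \<beta> N by (simp add: pos_le_divide_eq)
  qed
  then obtain z0 where z0: "z0 \<in> \<Xi>" "M z0 \<le> L"
    by blast
  define \<rho> where "\<rho> z = (if M z \<le> L then z else z0)" for z
  have \<rho>: "\<rho> \<in> ?S \<rightarrow>\<^sub>M ?S"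
  proof -
    have "{z \<in> space ?S. M z \<le> L} \<in> sets ?S"
      using M by measurable
    then show ?thesis
      unfolding \<rho>_def[abs_def] using z0 by (intro measurable_If) (auto simp: space_Xi)
  qed
  have \<rho>in: "\<rho> z \<in> \<Xi>" "M (\<rho> z) \<le> L" if "z \<in> \<Xi>" for z
    using that z0 by (auto simp: \<rho>_def)
  define f' where "f' x z = f x (\<rho> z)" for x z
  define xt' where "xt' s = xt (\<lambda>j\<in>{1..N}. \<rho> (s j))" for s
  let ?E = "{s \<in> space Q. 3 * \<epsilon> / 4 < (\<integral>z. f' (xt' s) z - f' xstar z \<partial>P)}"
  have sol': "approximate_solution m d \<Xi> B X f' q' x0 (\<epsilon> / (2 * R)) N \<delta> q xt'"
    unfolding f'_def[abs_def] xt'_def[abs_def] using sol \<rho> Xi_borel by (rule approximate_solution_truncate)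
  have fm': "(\<lambda>(x, z). f' x z) \<in> borel_measurable (Borel_on d B \<Otimes>\<^sub>M ?S)"
  proof -
    have "(\<lambda>p. (fst p, \<rho> (snd p))) \<in> Borel_on d B \<Otimes>\<^sub>M ?S \<rightarrow>\<^sub>M Borel_on d B \<Otimes>\<^sub>M ?S"
      by (intro measurable_Pair measurable_compose[OF measurable_snd \<rho>]) auto
    from measurable_compose[OF this f_measurable] show ?thesis
      by (simp add: f'_def split_beta')
  qed
  have conv': "convex_on_Rn d B (\<lambda>x. f' x z)" if "z \<in> \<Xi>" for z
    unfolding f'_def using conv \<rho>in(1) that by blast
  have lip': "\<bar>f' x z - f' y z\<bar> \<le> L * pnorm d q (vdiff d x y)" if "x \<in> X" "y \<in> X" "z \<in> \<Xi>" for x y z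
  proof -
    have "\<bar>f' x z - f' y z\<bar> \<le> M (\<rho> z) * pnorm d q (vdiff d x y)"
      unfolding f'_def using lip that \<rho>in by blast
    also have "\<dots> \<le> L * pnorm d q (vdiff d x y)"
      using \<rho>in that by (intro mult_right_mono pnorm_nonneg) auto
    finally show ?thesis .
  qed
  note bounded = bounded_lipschitz_case[OF P setsP Xi_borel sol' fm' conv' X_subset X_convex
      xstar_in_X x0 lip' diam R L \<epsilon> \<beta> q' \<delta> N big, folded Q_def]
  have E: "?E \<in> sets Q" and mE: "measure Q ?E \<le> \<beta> / 2"
    by (rule bounded; assumption)+

  \<comment> \<open>Where \<open>M\<close> exceeds \<open>L\<close>, the increments of
    \<open>f\<close> and of the truncated \<open>f'\<close> are both at most \<open>M\<close> times
    \<open>D\<close>, so the expectations differ by at most 2 D \<tau>; this explains the 8 in the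
    assumption on \<tau>.\<close>
  have close: "?F x - ?F xstar \<le> (\<integral>z. f' x z - f' xstar z \<partial>P) + \<epsilon> / 4" if x: "x \<in> X" for x
  proof -
    let ?g = "\<lambda>\<omega>. f x (\<xi> \<omega>) - f xstar (\<xi> \<omega>)"
    let ?g' = "\<lambda>\<omega>. f' x (\<xi> \<omega>) - f' xstar (\<xi> \<omega>)"
    have f's: "f' x \<in> borel_measurable ?S" if "x \<in> X" for x
      using measurable_Pair2[OF fm' X_Borel_on[OF that]] by simp
    have "\<bar>?g' \<omega>\<bar> \<le> L * D" if "\<omega> \<in> space \<Omega>" for \<omega>
    proof -
      have "\<bar>?g' \<omega>\<bar> \<le> L * pnorm d q (vdiff d x xstar)"
        using lip' x xstar_in_X xi_in that by blast
      also have "\<dots> \<le> L * D"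
        using pq[OF x xstar_in_X] L by (intro mult_left_mono) auto
      finally show ?thesis .
    qed
    then have int': "integrable \<Omega> ?g'"
      using f's[OF x] f's[OF xstar_in_X]
      by (intro integrable_const_bound[where B="L * D"] AE_I2)
         (auto intro!: borel_measurable_diff measurable_compose[OF xi_measurable])
    have int: "integrable \<Omega> ?g"
      using F_finite x xstar_in_X by (intro Bochner_Integration.integrable_diff) auto
    have "?F x - ?F xstar = (\<integral>\<omega>. ?g \<omega> \<partial>\<Omega>)"
      unfolding expected_value_def using F_finite x xstar_in_X by simp
    also have "\<dots> \<le> (\<integral>\<omega>. ?g' \<omega> + 2 * D * (M (\<xi> \<omega>) * indicator {\<omega>. L < M (\<xi> \<omega>)} \<omega>) \<partial>\<Omega>)"
    proof (rule integral_mono[OF int])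
      fix \<omega> assume w: "\<omega> \<in> space \<Omega>"
      show "?g \<omega> \<le> ?g' \<omega> + 2 * D * (M (\<xi> \<omega>) * indicator {\<omega>. L < M (\<xi> \<omega>)} \<omega>)"
      proof (cases "L < M (\<xi> \<omega>)")
        case False
        then show ?thesis
          by (simp add: f'_def \<rho>_def)
      next
        case True
        have "\<bar>?g \<omega>\<bar> \<le> M (\<xi> \<omega>) * pnorm d q (vdiff d x xstar)"
          using lip x xstar_in_X xi_in w by blast
        also have "\<dots> \<le> M (\<xi> \<omega>) * D"
          using pq[OF x xstar_in_X] True L by (intro mult_left_mono) auto
        finally have "\<bar>?g \<omega>\<bar> \<le> M (\<xi> \<omega>) * D" .
        moreover have "\<bar>?g' \<omega>\<bar> \<le> M (\<xi> \<omega>) * D"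
        proof -
          have "\<bar>?g' \<omega>\<bar> \<le> L * pnorm d q (vdiff d x xstar)"
            using lip' x xstar_in_X xi_in w by blast
          also have "\<dots> \<le> M (\<xi> \<omega>) * D"
            using pq[OF x xstar_in_X] True L by (intro mult_mono pnorm_nonneg) auto
          finally show ?thesis .
        qed
        ultimately have "?g \<omega> \<le> ?g' \<omega> + 2 * (M (\<xi> \<omega>) * D)"
          by linarith
        then show ?thesis
          using True by (simp add: mult_ac)
      qed
    qed (intro Bochner_Integration.integrable_add integrable_mult_right int' Mint)
    also have "\<dots> = (\<integral>\<omega>. ?g' \<omega> \<partial>\<Omega>)
        + 2 * D * (\<integral>\<omega>. M (\<xi> \<omega>) * indicator {\<omega>. L < M (\<xi> \<omega>)} \<omega> \<partial>\<Omega>)"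
      by (subst Bochner_Integration.integral_add[OF int' integrable_mult_right[OF Mint]]) simp
    also have "\<dots> \<le> (\<integral>\<omega>. ?g' \<omega> \<partial>\<Omega>) + 2 * D * \<tau>"
      using trunc(1) D0 by (intro add_left_mono mult_left_mono) auto
    also have "\<dots> \<le> (\<integral>\<omega>. ?g' \<omega> \<partial>\<Omega>) + \<epsilon> / 4"
      using trunc(2) by simp
    also have "(\<integral>\<omega>. ?g' \<omega> \<partial>\<Omega>) = (\<integral>z. f' x z - f' xstar z \<partial>P)"
      unfolding P_def using f's[OF x] f's[OF xstar_in_X]
      by (intro integral_distr[OF xi_measurable, symmetric] borel_measurable_diff)
    finally show ?thesis .
  qed

  define A where "A j = {\<omega> \<in> space \<Omega>. L < M (\<xi>s j \<omega>)}" for j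
  have rv: "\<xi>s j \<in> \<Omega> \<rightarrow>\<^sub>M ?S" if "j \<in> {1..N}" for j
    using iid that unfolding iid_sample_def indep_vars_def by auto
  have Asets: "A j \<in> sets \<Omega>" if "j \<in> {1..N}" for j
    unfolding A_def using measurable_compose[OF rv[OF that] M] by measurable
  have Aprob: "prob (A j) \<le> \<beta> / (2 * N)" if j: "j \<in> {1..N}" for j
  proof -
    have eq: "measure (distr \<Omega> ?S g) {z \<in> space ?S. L < M z} = prob {\<omega> \<in> space \<Omega>. L < M (g \<omega>)}"
      if g: "g \<in> \<Omega> \<rightarrow>\<^sub>M ?S" for g
    proof -
      have "{z \<in> space ?S. L < M z} \<in> sets ?S"
        using M by measurable
      moreover have "g -` {z \<in> space ?S. L < M z} \<inter> space \<Omega> = {\<omega> \<in> space \<Omega>. L < M (g \<omega>)}"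
        using measurable_space[OF g] by auto
      ultimately show ?thesis
        using g by (simp add: measure_distr)
    qed
    have "prob (A j) = prob {\<omega> \<in> space \<Omega>. L < M (\<xi> \<omega>)}"
      unfolding A_def eq[OF rv[OF j], symmetric] eq[OF xi_measurable, symmetric]
      using iid j by (simp add: iid_sample_def)
    then show ?thesis
      using tail by simp
  qed
  define G where "G = sample N \<xi>s -` ?E \<inter> space \<Omega>"
  have Gsets: "G \<in> sets \<Omega>"
    unfolding G_def using smp E by (rule measurable_sets)
  have "prob G = measure (distr \<Omega> Q (sample N \<xi>s)) ?E"
    unfolding G_def by (rule measure_distr[OF smp E, symmetric])
  then have Gprob: "prob G \<le> \<beta> / 2"
    using mE by (simp add: dsmp)
  let ?bad = "{\<omega> \<in> space \<Omega>. \<not> ?F (xt (sample N \<xi>s \<omega>)) - ?F xstar \<le> \<epsilon>}"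
  \<comment> \<open>If no sample point exceeds \<open>L\<close>, truncation leaves the sample and
    hence the output unchanged, and a large excess risk forces the truncated one above
    3\<epsilon>/4.\<close>
  have "?bad \<subseteq> (\<Union>j\<in>{1..N}. A j) \<union> G"
  proof
    fix \<omega> assume "\<omega> \<in> ?bad"
    then have w: "\<omega> \<in> space \<Omega>" and big: "\<epsilon> < ?F (xt (sample N \<xi>s \<omega>)) - ?F xstar"
      by auto
    have sQ: "sample N \<xi>s \<omega> \<in> space Q"
      using measurable_space[OF smp w] .
    show "\<omega> \<in> (\<Union>j\<in>{1..N}. A j) \<union> G"
    proof (cases "\<omega> \<in> (\<Union>j\<in>{1..N}. A j)")
      case False
      then have "\<rho> (\<xi>s j \<omega>) = \<xi>s j \<omega>" if "j \<in> {1..N}" for j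
        using that w by (force simp: A_def \<rho>_def)
      then have "(\<lambda>j\<in>{1..N}. \<rho> (sample N \<xi>s \<omega> j)) = sample N \<xi>s \<omega>"
        by (auto simp: sample_def fun_eq_iff)
      then have "xt' (sample N \<xi>s \<omega>) = xt (sample N \<xi>s \<omega>)"
        by (simp add: xt'_def)
      moreover have "xt (sample N \<xi>s \<omega>) \<in> X"
        using sol sQ spQ by (intro approximate_solution_in[OF sol]) simp
      ultimately have "3 * \<epsilon> / 4 < (\<integral>z. f' (xt' (sample N \<xi>s \<omega>)) z - f' xstar z \<partial>P)"
        using close big by fastforce
      then show ?thesis
        using w sQ by (simp add: G_def)
    qed simp
  qed
  then have "prob ?bad \<le> prob ((\<Union>j\<in>{1..N}. A j) \<union> G)"
    using Asets Gsets by (intro finite_measure_mono) auto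
  also have "\<dots> \<le> prob (\<Union>j\<in>{1..N}. A j) + prob G"
    using Asets Gsets by (intro measure_Un_le) auto
  also have "prob (\<Union>j\<in>{1..N}. A j) \<le> (\<Sum>j\<in>{1..N}. prob (A j))"
    using Asets by (intro finite_measure_subadditive_finite) auto
  also have "\<dots> \<le> (\<Sum>j\<in>{1..N}. \<beta> / (2 * N))"
    by (intro sum_mono Aprob)
  also have "\<dots> = \<beta> / 2"
    using Np by simp
  finally have bad: "prob ?bad \<le> \<beta>"
    using Gprob by simp
  let ?good = "{\<omega> \<in> space \<Omega>. ?F (xt (sample N \<xi>s \<omega>)) - ?F xstar \<le> \<epsilon>}"
  have "?good \<in> sets \<Omega>"
    using excess_risk_measurable[OF iid sol] by measurable
  then have "prob ?bad = 1 - prob ?good"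
    by (rule prob_neg)
  then show ?thesis
    using bad by simp
qed

end

section \<open>Truncation errors from tail and moment bounds\<close>

text \<open>A layer-cake estimate in steps of \<open>L\<close>: if \<open>Y\<close> has passed
  exactly n \<ge> 1 multiples of \<open>L\<close>, it is at most (n+1) L \<le> n * 2L, that is, 2L
  for each level passed. Summing the tails gives 4Lr / (1 - r) \<le> 8Lr.\<close>

lemma (in prob_space) geometric_tail_expectation:
  fixes Y :: "'a \<Rightarrow> real" and L r :: real
  assumes Y: "Y \<in> borel_measurable M" and L: "0 < L" and r: "0 \<le> r" "r \<le> 1 / 2"
    and tail: "\<And>k::nat. 1 \<le> k \<Longrightarrow> prob {\<omega> \<in> space M. k * L \<le> Y \<omega>} \<le> 2 * r ^ k"
  shows "integrable M (\<lambda>\<omega>. Y \<omega> * indicator {\<omega>. L < Y \<omega>} \<omega>)"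
    and "(\<integral>\<omega>. Y \<omega> * indicator {\<omega>. L < Y \<omega>} \<omega> \<partial>M) \<le> 8 * L * r"
proof -
  let ?Z = "\<lambda>\<omega>. Y \<omega> * indicator {\<omega>. L < Y \<omega>} \<omega>"
  define A where "A k = {\<omega> \<in> space M. real (Suc k) * L \<le> Y \<omega>}" for k
  have A [measurable]: "A k \<in> events" for k
    unfolding A_def using Y by measurable
  have Zm: "?Z \<in> borel_measurable M"
    using Y by (auto intro!: borel_measurable_times borel_measurable_indicator')
  have Z0: "0 \<le> ?Z \<omega>" for \<omega>
    using L by (simp add: indicator_def)
  have pt: "ennreal (?Z \<omega>) \<le> (\<Sum>k. ennreal (2 * L) * indicator (A k) \<omega>)" if w: "\<omega> \<in> space M" for \<omega>
  proof (cases "L < Y \<omega>")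
    case True
    define n where "n = nat \<lfloor>Y \<omega> / L\<rfloor>"
    have "1 \<le> \<lfloor>Y \<omega> / L\<rfloor>"
      using True L by (simp add: le_floor_iff)
    then have rn: "real n = \<lfloor>Y \<omega> / L\<rfloor>" and "1 \<le> real_of_int \<lfloor>Y \<omega> / L\<rfloor>"
      by (simp_all add: n_def)
    then have n: "1 \<le> real n" "real n \<le> Y \<omega> / L" "Y \<omega> / L < real n + 1"
      unfolding rn by linarith+
    have "Y \<omega> \<le> (real n + 1) * L"
      using n(3) L by (simp add: pos_divide_less_eq less_imp_le)
    also have "\<dots> \<le> real n * (2 * L)"
      using mult_right_mono[OF n(1), of L] L by (simp add: algebra_simps)
    finally have "ennreal (?Z \<omega>) \<le> ennreal (real n * (2 * L))"
      using True by (simp add: ennreal_leI)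
    also have "\<dots> = (\<Sum>k<n. ennreal (2 * L) * indicator (A k) \<omega>)"
    proof -
      have "indicator (A k) \<omega> = (1::ennreal)" if "k < n" for k
      proof -
        have "real (Suc k) \<le> Y \<omega> / L"
          using that n(2) by linarith
        then show ?thesis
          using w L by (simp add: A_def pos_le_divide_eq)
      qed
      then show ?thesis
        using L by (simp add: ennreal_mult' ennreal_of_nat_eq_real_of_nat)
    qed
    also have "\<dots> \<le> (\<Sum>k. ennreal (2 * L) * indicator (A k) \<omega>)"
      by (rule sum_le_suminf) auto
    finally show ?thesis .
  qed simp
  have "(\<integral>\<^sup>+\<omega>. ennreal (?Z \<omega>) \<partial>M) \<le> (\<integral>\<^sup>+\<omega>. (\<Sum>k. ennreal (2 * L) * indicator (A k) \<omega>) \<partial>M)"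
    by (intro nn_integral_mono pt)
  also have "\<dots> = (\<Sum>k. \<integral>\<^sup>+\<omega>. ennreal (2 * L) * indicator (A k) \<omega> \<partial>M)"
    by (rule nn_integral_suminf) measurable
  also have "\<dots> = (\<Sum>k. ennreal (2 * L) * emeasure M (A k))"
    by (simp add: nn_integral_cmult_indicator)
  also have "\<dots> \<le> (\<Sum>k. ennreal (4 * L * r * r ^ k))"
  proof (intro suminf_le)
    fix k
    have "2 * L * prob (A k) \<le> 2 * L * (2 * r ^ Suc k)"
      unfolding A_def using tail[of "Suc k"] L by (intro mult_left_mono) auto
    then show "ennreal (2 * L) * emeasure M (A k) \<le> ennreal (4 * L * r * r ^ k)"
      using L by (simp add: emeasure_eq_measure ennreal_leI mult_ac flip: ennreal_mult)
  qed auto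
  also have "\<dots> = ennreal (4 * L * r * (1 / (1 - r)))"
    using r L by (intro suminf_ennreal_eq sums_mult geometric_sums) auto
  also have "\<dots> \<le> ennreal (8 * L * r)"
  proof (rule ennreal_leI)
    have "4 * L * r * (1 / (1 - r)) \<le> 4 * L * r * 2"
      using r L by (intro mult_left_mono) (auto simp: field_simps)
    then show "4 * L * r * (1 / (1 - r)) \<le> 8 * L * r"
      by simp
  qed
  finally have le: "(\<integral>\<^sup>+\<omega>. ennreal (?Z \<omega>) \<partial>M) \<le> ennreal (8 * L * r)" .
  show "integrable M ?Z"
    by (rule integrableI_nonneg[OF Zm]) (use Z0 le in \<open>auto intro: le_less_trans\<close>)
  show "(\<integral>\<omega>. ?Z \<omega> \<partial>M) \<le> 8 * L * r"
    using le L r by (intro integral_real_bounded) auto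
qed

text \<open>Markov's inequality for the p-th power, and the pointwise bound of \<open>Y\<close> by
  L^(1-p) Y^p wherever \<open>Y\<close> exceeds \<open>L\<close>.\<close>

lemma (in prob_space) moment_tail:
  fixes Y :: "'a \<Rightarrow> real"
  assumes Y: "Y \<in> borel_measurable M" and mom: "Lp_norm_le M p Y c" and p: "1 < p" and L: "0 < L" and c: "0 < c"
  shows "prob {\<omega> \<in> space M. L < Y \<omega>} \<le> (c / L) powr p"
    and "integrable M (\<lambda>\<omega>. Y \<omega> * indicator {\<omega>. L < Y \<omega>} \<omega>)"
    and "(\<integral>\<omega>. Y \<omega> * indicator {\<omega>. L < Y \<omega>} \<omega> \<partial>M) \<le> L * (c / L) powr p"
proof -
  let ?Z = "\<lambda>\<omega>. Y \<omega> * indicator {\<omega>. L < Y \<omega>} \<omega>"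
  have int: "integrable M (\<lambda>\<omega>. \<bar>Y \<omega>\<bar> powr p)"
    using mom by (simp add: Lp_norm_le_def)
  have I0: "0 \<le> (\<integral>\<omega>. \<bar>Y \<omega>\<bar> powr p \<partial>M)"
    by (intro Bochner_Integration.integral_nonneg) simp
  have "(\<integral>\<omega>. \<bar>Y \<omega>\<bar> powr p \<partial>M) powr (1 / p) \<le> c"
    using mom by (simp add: Lp_norm_le_def)
  then have "((\<integral>\<omega>. \<bar>Y \<omega>\<bar> powr p \<partial>M) powr (1 / p)) powr p \<le> c powr p"
    using p by (intro powr_mono2) auto
  then have I: "(\<integral>\<omega>. \<bar>Y \<omega>\<bar> powr p \<partial>M) \<le> c powr p"
    using p I0 by (simp add: powr_powr)
  have "prob {\<omega> \<in> space M. L < Y \<omega>} \<le> prob {\<omega> \<in> space M. L powr p \<le> \<bar>Y \<omega>\<bar> powr p}"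
  proof (rule finite_measure_mono)
    show "{\<omega> \<in> space M. L < Y \<omega>} \<subseteq> {\<omega> \<in> space M. L powr p \<le> \<bar>Y \<omega>\<bar> powr p}"
      using L p by (auto intro!: powr_mono2)
    show "{\<omega> \<in> space M. L powr p \<le> \<bar>Y \<omega>\<bar> powr p} \<in> events"
      using Y by measurable
  qed
  also have "\<dots> \<le> (\<integral>\<omega>. \<bar>Y \<omega>\<bar> powr p \<partial>M) / L powr p"
    using L by (intro integral_Markov_inequality_measure[OF int, where A="{}"]) auto
  also have "\<dots> \<le> c powr p / L powr p"
    using I by (intro divide_right_mono) auto
  also have "\<dots> = (c / L) powr p"
    using c L by (simp add: powr_divide)
  finally show "prob {\<omega> \<in> space M. L < Y \<omega>} \<le> (c / L) powr p" .
  have Zm: "?Z \<in> borel_measurable M"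
    using Y by (auto intro!: borel_measurable_times borel_measurable_indicator')
  have pt: "?Z \<omega> \<le> L powr (1 - p) * \<bar>Y \<omega>\<bar> powr p" and Z0: "0 \<le> ?Z \<omega>" for \<omega>
  proof -
    show "?Z \<omega> \<le> L powr (1 - p) * \<bar>Y \<omega>\<bar> powr p"
    proof (cases "L < Y \<omega>")
      case True
      then have "Y \<omega> = Y \<omega> powr (1 - p) * Y \<omega> powr p"
        using L by (simp flip: powr_add)
      also have "\<dots> \<le> L powr (1 - p) * Y \<omega> powr p"
        using True L p by (intro mult_right_mono powr_mono2') auto
      finally show ?thesis
        using True L by simp
    qed simp
    show "0 \<le> ?Z \<omega>"
      using L by (simp add: indicator_def)
  qed
  show Zi: "integrable M ?Z"
  proof (rule Bochner_Integration.integrable_bound)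
    show "integrable M (\<lambda>\<omega>. L powr (1 - p) * \<bar>Y \<omega>\<bar> powr p)"
      using int by simp
    show "AE \<omega> in M. norm (?Z \<omega>) \<le> norm (L powr (1 - p) * \<bar>Y \<omega>\<bar> powr p)"
    proof (rule AE_I2)
      fix \<omega>
      show "norm (?Z \<omega>) \<le> norm (L powr (1 - p) * \<bar>Y \<omega>\<bar> powr p)"
        using pt[of \<omega>] Z0[of \<omega>] unfolding real_norm_def by linarith
    qed
  qed (rule Zm)
  have "(\<integral>\<omega>. ?Z \<omega> \<partial>M) \<le> (\<integral>\<omega>. L powr (1 - p) * \<bar>Y \<omega>\<bar> powr p \<partial>M)"
    using int by (intro integral_mono Zi pt) auto
  also have "\<dots> \<le> L powr (1 - p) * c powr p"
    using I by (simp add: mult_left_mono)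
  also have "\<dots> = L * (c / L) powr p"
    using c L by (simp add: powr_divide powr_diff)
  finally show "(\<integral>\<omega>. ?Z \<omega> \<partial>M) \<le> L * (c / L) powr p" .
qed

text \<open>The exponents in part (a) are those that turn the implicit condition on \<open>N\<close> into an explicit one.\<close>

lemma powr_sample_size:
  fixes N p \<beta> T :: real
  assumes "2 < p" "0 < \<beta>" "0 < N" "0 \<le> T"
    and "T powr (p / (p - 2)) * \<beta> powr (- 2 / (p - 2)) \<le> N"
  shows "T * (N / \<beta>) powr (2 / p) \<le> N"
proof -
  have e: "0 < 1 - 2 / p" "p / (p - 2) * (1 - 2 / p) = 1" "- 2 / (p - 2) * (1 - 2 / p) = - (2 / p)"
    using assms(1) by (auto simp: field_simps)
  have "(T powr (p / (p - 2)) * \<beta> powr (- 2 / (p - 2))) powr (1 - 2 / p) \<le> N powr (1 - 2 / p)"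
    using assms e(1) by (intro powr_mono2) auto
  then have "T * \<beta> powr (- (2 / p)) \<le> N powr (1 - 2 / p)"
    using assms by (simp only: powr_mult powr_powr e powr_one)
  then have "T * \<beta> powr (- (2 / p)) * N powr (2 / p) \<le> N powr (1 - 2 / p) * N powr (2 / p)"
    by (rule mult_right_mono) simp
  also have "\<dots> = N"
    using assms by (simp flip: powr_add)
  finally have "T * \<beta> powr (- (2 / p)) * N powr (2 / p) \<le> N" .
  moreover have "(N / \<beta>) powr (2 / p) = \<beta> powr (- (2 / p)) * N powr (2 / p)"
    by (simp add: powr_divide powr_minus_divide)
  ultimately show ?thesis
    by (simp add: mult.assoc)
qed

text \<open>The counterpart for the second summand of the condition on \<open>N\<close>, the one
  that controls the truncation bias.\<close>

lemma powr_sample_size':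
  fixes N p \<beta> T :: real
  assumes "1 < p" "0 < \<beta>" "0 \<le> T" "T powr (p / (p - 1)) * \<beta> \<le> N"
  shows "T \<le> (N / \<beta>) powr (1 - 1 / p)"
proof -
  have e: "1 - 1 / p = (p - 1) / p"
    using assms by (simp add: field_simps)
  have "T powr (p / (p - 1)) \<le> N / \<beta>"
    using assms by (simp add: pos_le_divide_eq)
  then have "(T powr (p / (p - 1))) powr ((p - 1) / p) \<le> (N / \<beta>) powr ((p - 1) / p)"
    using assms by (intro powr_mono2) auto
  then show ?thesis
    using assms by (simp add: powr_powr e)
qed

text \<open>What remains is to choose the level \<open>L\<close> in each part. The moment case
  balances Markov's inequality against the union bound; both exponential cases choose
  \<open>L\<close> so that the tails at its multiples decay geometrically with ratio
  \<open>r\<close>.\<close>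

theorem sample_complexity_constants_explicit:
  "sample_complexity_constants TYPE('w) 50000 225000 75000"
  unfolding sample_complexity_constants_def Let_def
proof (intro allI impI)
  fix \<Omega> :: "'w measure" and m d \<Xi> \<xi> B X f xstar x0 N \<xi>s
    and q \<epsilon> \<beta> q' D R lam0 \<delta> :: real and xt M
  assume sp: "stochastic_program \<Omega> m d \<Xi> \<xi> B X f xstar"
    and x0: "x0 \<in> X"
    and iid: "iid_sample \<Omega> (Borel_on m \<Xi>) \<xi> N \<xi>s"
    and q: "1 < q" "q \<le> 2" and \<epsilon>: "0 < \<epsilon>" "\<epsilon> \<le> 1" and \<beta>: "0 < \<beta>" "\<beta> < 1"
    and q': "1 < q'" "q' \<le> 2" "q' \<le> q"
    and R': "max 1 (D\<^sup>2) \<le> R" and lam0: "lam0 = \<epsilon> / (2 * R)"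
    and \<delta>: "0 \<le> \<delta>" "\<delta> \<le> 1 / real N"
    and sol: "approximate_solution m d \<Xi> B X f q' x0 lam0 N \<delta> q xt"
    and N: "3 \<le> N"
    and conv: "\<forall>z\<in>\<Xi>. convex_on_Rn d B (\<lambda>x. f x z)"
    and diam: "\<forall>x1\<in>X. \<forall>x2\<in>X. pnorm d q' (vdiff d x1 x2) \<le> D"
    and M: "M \<in> borel_measurable (Borel_on m \<Xi>)"
    and M0: "\<forall>z\<in>\<Xi>. 0 \<le> M z"
    and lip: "\<forall>x\<in>X. \<forall>y\<in>X. \<forall>z\<in>\<Xi>. \<bar>f x z - f y z\<bar> \<le> M z * pnorm d q (vdiff d x y)"
  interpret stochastic_program \<Omega> m d \<Xi> \<xi> B X f xstar by fact
  let ?F = "expected_value \<Omega> \<xi> f"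
  let ?success = "1 - \<beta> \<le> measure \<Omega> {\<omega> \<in> space \<Omega>. ?F (xt (sample N \<xi>s \<omega>)) - ?F xstar \<le> \<epsilon>}"
  define Y where "Y \<omega> = M (\<xi> \<omega>)" for \<omega>
  define b where "b = ln (real N / \<beta>)"
  define \<Lambda> where "\<Lambda> = ln (real N) * b / (q' - 1)"
  have Y: "Y \<in> borel_measurable \<Omega>"
    unfolding Y_def[abs_def] using xi_measurable M by (rule measurable_compose)
  have R: "1 \<le> R" "D\<^sup>2 \<le> R"
    using R' by auto
  have D0: "0 \<le> D"
    using diam x0 pnorm_nonneg order_trans by blast
  have Np: "0 < real N"
    using N by simp
  have "real N * \<beta> \<le> real N * 1"
    using \<beta> Np by (intro mult_left_mono) auto
  then have Nb: "3 \<le> real N / \<beta>"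
    using \<beta> N by (simp add: pos_le_divide_eq)
  then have b: "1 \<le> b"
    unfolding b_def by (rule ln_ge_one)
  have l: "1 \<le> ln (real N)"
    using N by (intro ln_ge_one) simp
  have \<Lambda>0: "0 \<le> \<Lambda>"
    unfolding \<Lambda>_def using b l q' by auto
  have core: "?success" if "1 \<le> L"
    and "integrable \<Omega> (\<lambda>\<omega>. Y \<omega> * indicator {\<omega>. L < Y \<omega>} \<omega>)"
    and "(\<integral>\<omega>. Y \<omega> * indicator {\<omega>. L < Y \<omega>} \<omega> \<partial>\<Omega>) \<le> \<tau>" "8 * D * \<tau> \<le> \<epsilon>"
    and "prob {\<omega> \<in> space \<Omega>. L < Y \<omega>} \<le> \<beta> / (2 * N)"
    and "25000 * (R * L\<^sup>2 / \<epsilon>\<^sup>2 * \<Lambda>) \<le> N" for L \<tau>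
    using that conv diam lip unfolding Y_def \<Lambda>_def b_def
    by (intro success_probability[OF x0 iid sol[unfolded lam0] _ _ M _ R _ \<epsilon> \<beta> q' \<delta> N]) auto
  have exp_b: "exp (- b) = \<beta> / N"
    unfolding b_def using \<beta> Np by (simp add: exp_minus)
  \<comment> \<open>One factor exp (-b) is \<beta> / N, and the other two are together at most 1/4.
    Hence 2r is within the budget \<beta> / (2N) of one sample point, and r \<le> 1/N makes the
    truncation bias small.\<close>
  define r where "r = exp (- (3 * b))"
  have r: "0 \<le> r" "r \<le> \<beta> / (4 * N)"
  proof -
    have "exp (- 2 * b) \<le> exp (- 2)"
      using b by simp
    also have "\<dots> = inverse (exp 1 * exp 1)"
      by (simp add: exp_minus flip: exp_add)
    also have "\<dots> \<le> inverse (2 * 2 :: real)"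
      using exp_ge_add_one_self[of 1] by (intro le_imp_inverse_le mult_mono) auto
    finally have "exp (- b) * exp (- 2 * b) \<le> exp (- b) * (1 / 4)"
      by (intro mult_left_mono) auto
    also have "exp (- b) * exp (- 2 * b) = r"
      by (simp add: r_def flip: exp_add)
    finally show "r \<le> \<beta> / (4 * N)"
      by (simp add: exp_b)
  qed (simp add: r_def)
  have r1: "r \<le> 1 / N" "r \<le> 1 / 2"
  proof -
    have "\<beta> / (4 * N) \<le> 1 / N"
      using \<beta> Np by (simp add: field_simps)
    then show "r \<le> 1 / N"
      using r by linarith
    also have "\<dots> \<le> 1 / 2"
      using N by (intro divide_left_mono) auto
    finally show "r \<le> 1 / 2" .
  qed
  have geometric: "?success" if L: "1 \<le> L"
    and tail: "\<And>k::nat. 1 \<le> k \<Longrightarrow> prob {\<omega> \<in> space \<Omega>. k * L \<le> Y \<omega>} \<le> 2 * r ^ k"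
    and big: "25000 * (R * L\<^sup>2 / \<epsilon>\<^sup>2 * \<Lambda>) \<le> N" for L :: real
  proof (rule core[OF L _ _ _ _ big])
    have "0 < L"
      using L by simp
    note tails = geometric_tail_expectation[OF Y this r(1) r1(2) tail]
    show "integrable \<Omega> (\<lambda>\<omega>. Y \<omega> * indicator {\<omega>. L < Y \<omega>} \<omega>)"
      and "(\<integral>\<omega>. Y \<omega> * indicator {\<omega>. L < Y \<omega>} \<omega> \<partial>\<Omega>) \<le> 8 * L * r"
      using tails by simp_all
    have "prob {\<omega> \<in> space \<Omega>. L < Y \<omega>} \<le> prob {\<omega> \<in> space \<Omega>. real 1 * L \<le> Y \<omega>}"
      using Y by (intro finite_measure_mono) auto
    also have "\<dots> \<le> 2 * r"
      using tail[of 1] by simp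
    also have "\<dots> \<le> \<beta> / (2 * N)"
      using r by (simp add: field_simps)
    finally show "prob {\<omega> \<in> space \<Omega>. L < Y \<omega>} \<le> \<beta> / (2 * N)" .
    obtain k :: nat where k: "2 ^ k \<le> 2 * N" "real k + 1 \<le> 4 * ln (real N)"
      using ex_power2_between[OF N] by blast
    have "64 * L * sqrt R / \<epsilon> \<le> N"
      using sample_size_bounds(3)[OF N R(1) L \<epsilon> \<beta> q'(1,2) D0 R(2) k refl _ refl] big
      unfolding \<Lambda>_def b_def by blast
    then have "64 * L * sqrt R \<le> N * \<epsilon>"
      using \<epsilon> by (simp add: pos_divide_le_eq)
    \<comment> \<open>The truncation bias is thus at most 64 L sqrt R / N, which the third bound of
      \<open>sample_size_bounds\<close> was made for.\<close>
    moreover have "8 * D * (8 * L * r) \<le> 8 * sqrt R * (8 * L * (1 / N))"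
      using D0 R L r r1 real_le_rsqrt[OF R(2)] by (intro mult_mono) auto
    moreover have "8 * sqrt R * (8 * L * (1 / N)) = 64 * L * sqrt R / N"
      by simp
    ultimately show "8 * D * (8 * L * r) \<le> \<epsilon>"
      using Np by (smt (verit) pos_divide_le_eq mult.commute)
  qed
  show "(\<forall>p \<psi>. 2 < p \<longrightarrow> 1 \<le> \<psi> \<longrightarrow> Lp_norm_le \<Omega> p (\<lambda>\<omega>. M (\<xi> \<omega>)) \<psi> \<longrightarrow>
       (50000 * (\<psi>\<^sup>2 / \<epsilon>\<^sup>2) * (1 / (q' - 1) * ln (real N) * ln (real N / \<beta>)) * R) powr (p / (p - 2)) *
         \<beta> powr (- 2 / (p - 2)) + (50000 * (p * D / (p - 1)) * (\<psi> / \<epsilon>)) powr (p / (p - 1)) * \<beta>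
         \<le> real N \<longrightarrow> ?success) \<and>
    (\<forall>\<phi>. 1 \<le> \<phi> \<longrightarrow>
       (\<forall>t\<ge>0. prob {\<omega> \<in> space \<Omega>. t \<le> M (\<xi> \<omega>)} \<le> 2 * exp (- t / \<phi>)) \<longrightarrow>
       225000 * R * (\<phi>\<^sup>2 / \<epsilon>\<^sup>2) * (ln (real N) * ln (real N / \<beta>) ^ 3 / (q' - 1)) \<le> real N \<longrightarrow> ?success) \<and>
    (\<forall>\<phi>. 1 \<le> \<phi> \<longrightarrow>
       (\<forall>t\<ge>0. prob {\<omega> \<in> space \<Omega>. t \<le> M (\<xi> \<omega>)} \<le> 2 * exp (- t\<^sup>2 / \<phi>\<^sup>2)) \<longrightarrow>
       75000 * R * (\<phi>\<^sup>2 / \<epsilon>\<^sup>2) * (ln (real N) * (ln (real N / \<beta>))\<^sup>2 / (q' - 1)) \<le> real N \<longrightarrow> ?success)"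
    (is "?a \<and> ?b \<and> ?c")
  proof (intro conjI)
    show ?a
    proof (intro allI impI)
      fix p \<psi> :: real
      assume p: "2 < p" and \<psi>: "1 \<le> \<psi>" and mom: "Lp_norm_le \<Omega> p (\<lambda>\<omega>. M (\<xi> \<omega>)) \<psi>"
        and big: "(50000 * (\<psi>\<^sup>2 / \<epsilon>\<^sup>2) * (1 / (q' - 1) * ln (real N) * ln (real N / \<beta>)) * R) powr (p / (p - 2)) *
         \<beta> powr (- 2 / (p - 2)) + (50000 * (p * D / (p - 1)) * (\<psi> / \<epsilon>)) powr (p / (p - 1)) * \<beta> \<le> real N"
        (is "?T1 powr _ * _ + ?T2 powr _ * _ \<le> _")
      \<comment> \<open>With this level Markov's bound on the tail is exactly \<beta> /
        (2N).\<close>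
      define L where "L = \<psi> * (2 * N / \<beta>) powr (1 / p)"
      have "1 \<le> (2 * N / \<beta>) powr (1 / p)"
        using Nb p by (intro ge_one_powr_ge_zero) auto
      then have L: "1 \<le> L"
        unfolding L_def using \<psi> mult_mono[of 1 \<psi> 1 "(2 * N / \<beta>) powr (1 / p)"] by simp
      have T1: "?T1 = 50000 * (R * \<psi>\<^sup>2 / \<epsilon>\<^sup>2 * \<Lambda>)"
        by (simp add: \<Lambda>_def b_def)
      have cL: "(\<psi> / L) powr p = \<beta> / (2 * N)"
      proof -
        have "\<psi> / L = (2 * N / \<beta>) powr (- (1 / p))"
          using \<psi> by (simp add: L_def powr_minus divide_inverse)
        then have "(\<psi> / L) powr p = (2 * N / \<beta>) powr (- 1)"
          using p by (simp add: powr_powr)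
        then show ?thesis
          using Np \<beta> by (simp add: powr_minus)
      qed
      have mom': "Lp_norm_le \<Omega> p Y \<psi>"
        using mom by (simp add: Y_def[abs_def])
      have p1: "1 < p" and L0: "0 < L" and \<psi>0: "0 < \<psi>"
        using p L \<psi> by auto
      note moments = moment_tail[OF Y mom' p1 L0 \<psi>0, unfolded cL]
      show ?success
      proof (rule core[OF L moments(2,3) _ moments(1)])
        \<comment> \<open>The second summand alone is at most \<open>N\<close>. It yields the bias
          condition, which for this \<open>L\<close> says that 8 D \<psi> / \<epsilon> is at most
          (2N/\<beta>)^(1 - 1/p).\<close>
        have "?T2 powr (p / (p - 1)) * \<beta> \<le> real N"
          using big by (meson add_increasing order_trans order_refl mult_nonneg_nonneg powr_ge_zero)
        then have "?T2 \<le> (N / \<beta>) powr (1 - 1 / p)"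
          using p \<beta> D0 \<psi> \<epsilon> by (intro powr_sample_size') auto
        moreover have "8 * (D * (\<psi> / \<epsilon>)) \<le> ?T2"
        proof -
          have "1 \<le> p / (p - 1)"
            using p by (simp add: pos_le_divide_eq)
          then have "8 * 1 * (D * (\<psi> / \<epsilon>)) \<le> 50000 * (p / (p - 1)) * (D * (\<psi> / \<epsilon>))"
            using D0 \<psi> \<epsilon> by (intro mult_right_mono mult_mono) auto
          then show ?thesis
            by simp
        qed
        moreover have "(N / \<beta>) powr (1 - 1 / p) \<le> (2 * N / \<beta>) powr (1 - 1 / p)"
          using Np \<beta> p by (intro powr_mono2) (auto simp: divide_right_mono)
        ultimately have "8 * (D * (\<psi> / \<epsilon>)) \<le> (2 * N / \<beta>) powr (1 - 1 / p)"
          by linarith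
        moreover have "(2 * N / \<beta>) powr (1 - 1 / p) = (2 * N / \<beta>) / (2 * N / \<beta>) powr (1 / p)"
          using Np \<beta> by (simp add: powr_diff)
        ultimately have "8 * (D * (\<psi> / \<epsilon>)) \<le> (2 * N / \<beta>) / (2 * N / \<beta>) powr (1 / p)"
          by (simp only:)
        moreover have "0 < (2 * N / \<beta>) powr (1 / p)"
          using Np \<beta> by simp
        ultimately have *: "8 * (D * (\<psi> / \<epsilon>)) * (2 * N / \<beta>) powr (1 / p) \<le> 2 * N / \<beta>"
          by (simp only: pos_le_divide_eq)
        have "8 * D * (L * (\<beta> / (2 * N))) = (8 * (D * (\<psi> / \<epsilon>)) * (2 * N / \<beta>) powr (1 / p)) * (\<epsilon> * (\<beta> / (2 * N)))"
          using \<epsilon> by (simp add: L_def)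
        also have "\<dots> \<le> (2 * N / \<beta>) * (\<epsilon> * (\<beta> / (2 * N)))"
          using * \<epsilon> \<beta> by (intro mult_right_mono) auto
        also have "\<dots> = \<epsilon>"
          using Np \<beta> by simp
        finally show "8 * D * (L * (\<beta> / (2 * N))) \<le> \<epsilon>" .
        \<comment> \<open>The first summand alone is at most \<open>N\<close> as well. Since 2^(2/p)
          \<le> 2, the squared level is at most 2 \<psi>^2 (N/\<beta>)^(2/p), and 2 * 25000 is the
          constant of part (a).\<close>
        have "?T1 powr (p / (p - 2)) * \<beta> powr (- 2 / (p - 2)) \<le> real N"
          using big \<beta> by (meson add_increasing2 order_trans order_refl mult_nonneg_nonneg powr_ge_zero less_imp_le)
        then have "?T1 * (N / \<beta>) powr (2 / p) \<le> N"
          using p \<beta> Np \<Lambda>0 R unfolding T1 by (intro powr_sample_size) auto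
        moreover have "L\<^sup>2 \<le> 2 * \<psi>\<^sup>2 * (N / \<beta>) powr (2 / p)"
        proof -
          have "((2 * N / \<beta>) powr (1 / p))\<^sup>2 = (2 * (N / \<beta>)) powr (2 / p)"
            using powr_powr[of "2 * N / \<beta>" "1 / p" 2] by simp
          also have "\<dots> = 2 powr (2 / p) * (N / \<beta>) powr (2 / p)"
            by (rule powr_mult)
          also have "\<dots> \<le> 2 powr 1 * (N / \<beta>) powr (2 / p)"
            using p by (intro mult_right_mono powr_mono) auto
          finally show ?thesis
            unfolding L_def power_mult_distrib using \<psi> by (simp add: mult_left_mono)
        qed
        then have "25000 * (R * L\<^sup>2 / \<epsilon>\<^sup>2 * \<Lambda>)
            \<le> 25000 * (R * (2 * \<psi>\<^sup>2 * (N / \<beta>) powr (2 / p)) / \<epsilon>\<^sup>2 * \<Lambda>)"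
          using R \<Lambda>0 by (intro mult_left_mono mult_right_mono divide_right_mono) auto
        ultimately show "25000 * (R * L\<^sup>2 / \<epsilon>\<^sup>2 * \<Lambda>) \<le> N"
          unfolding T1 by (simp add: mult_ac)
      qed
    qed
    show ?b
    proof (intro allI impI)
      fix \<phi> :: real
      assume \<phi>: "1 \<le> \<phi>"
        and tail: "\<forall>t\<ge>0. prob {\<omega> \<in> space \<Omega>. t \<le> M (\<xi> \<omega>)} \<le> 2 * exp (- t / \<phi>)"
        and big: "225000 * R * (\<phi>\<^sup>2 / \<epsilon>\<^sup>2) * (ln (real N) * ln (real N / \<beta>) ^ 3 / (q' - 1)) \<le> real N"
      \<comment> \<open>The level 3 \<phi> b gives tails 2 r^k at its multiples, and its square
        accounts for 9 * 25000.\<close>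
      show ?success
      proof (rule geometric)
        show "1 \<le> 3 * \<phi> * b"
          using mult_mono[of 1 "3 * \<phi>" 1 b] \<phi> b by simp
        show "prob {\<omega> \<in> space \<Omega>. k * (3 * \<phi> * b) \<le> Y \<omega>} \<le> 2 * r ^ k" for k :: nat
        proof -
          have "prob {\<omega> \<in> space \<Omega>. k * (3 * \<phi> * b) \<le> Y \<omega>} \<le> 2 * exp (- (k * (3 * \<phi> * b)) / \<phi>)"
            unfolding Y_def using \<phi> b by (intro tail[rule_format]) simp
          also have "- (k * (3 * \<phi> * b)) / \<phi> = k * (- (3 * b))"
            using \<phi> by simp
          finally show ?thesis
            by (simp only: exp_of_nat_mult r_def)
        qed
        show "25000 * (R * (3 * \<phi> * b)\<^sup>2 / \<epsilon>\<^sup>2 * \<Lambda>) \<le> N"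
          using big by (simp add: \<Lambda>_def b_def power2_eq_square power3_eq_cube mult_ac)
      qed
    qed
    show ?c
    proof (intro allI impI)
      fix \<phi> :: real
      assume \<phi>: "1 \<le> \<phi>"
        and tail: "\<forall>t\<ge>0. prob {\<omega> \<in> space \<Omega>. t \<le> M (\<xi> \<omega>)} \<le> 2 * exp (- t\<^sup>2 / \<phi>\<^sup>2)"
        and big: "75000 * R * (\<phi>\<^sup>2 / \<epsilon>\<^sup>2) * (ln (real N) * (ln (real N / \<beta>))\<^sup>2 / (q' - 1)) \<le> real N"
      \<comment> \<open>The square root of the logarithm is enough for a Gaussian tail, which saves
        one power of \<open>b\<close> against part (b); the constant is 3 * 25000.\<close>
      define L where "L = \<phi> * sqrt (3 * b)"
      have L2: "L\<^sup>2 = 3 * \<phi>\<^sup>2 * b"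
        using b by (simp add: L_def power_mult_distrib)
      show ?success
      proof (rule geometric)
        have "1 \<le> sqrt (3 * b)"
          using b by simp
        then show L: "1 \<le> L"
          unfolding L_def using \<phi> mult_mono[of 1 \<phi> 1 "sqrt (3 * b)"] by simp
        show "prob {\<omega> \<in> space \<Omega>. k * L \<le> Y \<omega>} \<le> 2 * r ^ k" if k: "1 \<le> k" for k :: nat
        proof -
          have "prob {\<omega> \<in> space \<Omega>. k * L \<le> Y \<omega>} \<le> 2 * exp (- (k * L)\<^sup>2 / \<phi>\<^sup>2)"
            unfolding Y_def using L by (intro tail[rule_format]) simp
          also have "- (k * L)\<^sup>2 / \<phi>\<^sup>2 = - ((real k)\<^sup>2 * (3 * b))"
            using \<phi> by (simp add: power_mult_distrib L2)
          \<comment> \<open>The Gaussian tail has k^2 in the exponent; k \<le> k^2 weakens it to the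
            geometric decay that is needed.\<close>
          also have "2 * exp \<dots> \<le> 2 * exp (k * (- (3 * b)))"
          proof -
            have "real k * (3 * b) \<le> (real k)\<^sup>2 * (3 * b)"
              using k b by (intro mult_right_mono) (auto simp: power2_eq_square)
            then show ?thesis
              by simp
          qed
          finally show ?thesis
            by (simp only: exp_of_nat_mult r_def)
        qed
        show "25000 * (R * L\<^sup>2 / \<epsilon>\<^sup>2 * \<Lambda>) \<le> N"
          using big unfolding L2 by (simp add: \<Lambda>_def b_def power2_eq_square mult_ac)
      qed
    qed
  qed
qed

text \<open>
  The joint law of \<open>\<xi>, \<xi>\<^sub>1, \<dots>, \<xi>\<^sub>N\<close>, completed, is again an instance of the setting, with the
  coordinate projections as random vectors.
\<close>

theorem sample_complexity_constants_transfer: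
  assumes H: "sample_complexity_constants TYPE(nat \<Rightarrow> nat \<Rightarrow> real) C3 C4 C5"
  shows "sample_complexity_constants TYPE('w) C3 C4 C5"
  unfolding sample_complexity_constants_def Let_def
proof (intro allI impI, goal_cases)
  case (1 \<Omega> m d \<Xi> \<xi> B X f xstar x0 N \<xi>s q \<epsilon> \<beta> q' D R lam0 \<delta> xt M)
  interpret stochastic_program \<Omega> m d \<Xi> \<xi> B X f xstar
    by (rule 1(1))
  note iid = 1(3)
  note sol = 1(17)
  let ?F = "expected_value \<Omega> \<xi> f"
  define S where "S = Borel_on m \<Xi>"
  define W where "W = (\<Pi>\<^sub>M j\<in>{0..N}. S)"
  \<comment> \<open>Index 0 carries \<xi>. It may depend on the sample in any way, so the whole
    joint law is transported instead of a product measure.\<close>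
  define J where "J \<omega> = (\<lambda>j\<in>{0..N}. if j = 0 then \<xi> \<omega> else \<xi>s j \<omega>)" for \<omega>
  \<comment> \<open>The setting demands a complete space. All random quantities involved are already
    measurable for \<open>W\<close>, so completing changes none of their laws, integrals or
    probabilities.\<close>
  define \<Omega>' where "\<Omega>' = completion (distr \<Omega> W J)"
  define \<xi>' where "\<xi>' w = w 0" for w :: "nat \<Rightarrow> nat \<Rightarrow> real"
  define \<xi>s' where "\<xi>s' j w = w j" for j and w :: "nat \<Rightarrow> nat \<Rightarrow> real"
  have xi: "\<xi> \<in> \<Omega> \<rightarrow>\<^sub>M S"
    unfolding S_def by (rule xi_measurable)
  have xis: "\<xi>s j \<in> \<Omega> \<rightarrow>\<^sub>M S" if "j \<in> {1..N}" for j
    using iid that unfolding iid_sample_def indep_vars_def S_def by auto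
  have J: "J \<in> \<Omega> \<rightarrow>\<^sub>M W"
    unfolding W_def J_def
  proof (rule measurable_restrict)
    fix j assume "j \<in> {0..N}"
    then show "(\<lambda>\<omega>. if j = 0 then \<xi> \<omega> else \<xi>s j \<omega>) \<in> \<Omega> \<rightarrow>\<^sub>M S"
      using xi xis by (cases "j = 0") auto
  qed
  have J0: "\<xi>' (J \<omega>) = \<xi> \<omega>" for \<omega>
    by (simp add: \<xi>'_def J_def)
  have Jj: "\<xi>s' j (J \<omega>) = \<xi>s j \<omega>" if "j \<in> {1..N}" for j \<omega>
    using that by (simp add: \<xi>s'_def J_def)
  have Jsample: "sample N \<xi>s' (J \<omega>) = sample N \<xi>s \<omega>" for \<omega>
    unfolding sample_def by (intro restrict_ext Jj)
  have space': "space \<Omega>' = space W"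
    by (simp add: \<Omega>'_def)
  have proj: "(\<lambda>w. w j) \<in> W \<rightarrow>\<^sub>M S" if "j \<in> {0..N}" for j
    unfolding W_def using that by (rule measurable_component_singleton)
  have xi': "\<xi>' \<in> W \<rightarrow>\<^sub>M S"
    unfolding \<xi>'_def[abs_def] by (rule proj) simp
  have xis': "\<xi>s' j \<in> W \<rightarrow>\<^sub>M S" if "j \<in> {1..N}" for j
    unfolding \<xi>s'_def[abs_def] using that by (intro proj) simp
  have completed: "g \<in> \<Omega>' \<rightarrow>\<^sub>M K" if "g \<in> W \<rightarrow>\<^sub>M K" for g :: "_ \<Rightarrow> 'k" and K
    unfolding \<Omega>'_def using that by (intro measurable_completion) simp
  have distr': "distr \<Omega>' K g = distr \<Omega> K (\<lambda>\<omega>. g (J \<omega>))" if "g \<in> W \<rightarrow>\<^sub>M K" for g :: "_ \<Rightarrow> 'k" and K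
    unfolding \<Omega>'_def using that distr_distr[OF that J] by (simp add: distr_completion comp_def)
  have integral': "(\<integral>w. g w \<partial>\<Omega>') = (\<integral>\<omega>. g (J \<omega>) \<partial>\<Omega>)" if "g \<in> borel_measurable W" for g :: "_ \<Rightarrow> real"
    unfolding \<Omega>'_def using that by (simp add: integral_completion integral_distr[OF J])
  have integrable': "integrable \<Omega>' g \<longleftrightarrow> integrable \<Omega> (\<lambda>\<omega>. g (J \<omega>))" if "g \<in> borel_measurable W" for g :: "_ \<Rightarrow> real"
    unfolding \<Omega>'_def using that by (simp add: integrable_completion integrable_distr_eq[OF J])
  have measure': "measure \<Omega>' {w \<in> space \<Omega>'. A w} = measure \<Omega> {\<omega> \<in> space \<Omega>. A (J \<omega>)}"
    if "{w \<in> space W. A w} \<in> sets W" for A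
  proof -
    have "J -` {w \<in> space W. A w} \<inter> space \<Omega> = {\<omega> \<in> space \<Omega>. A (J \<omega>)}"
      using measurable_space[OF J] by auto
    then show ?thesis
      using that measure_distr[OF J that] unfolding space' by (simp add: \<Omega>'_def)
  qed
  have f_section: "(\<lambda>w. f x (\<xi>' w)) \<in> borel_measurable W" if "x \<in> X" for x
    using measurable_compose[OF xi'[unfolded S_def] f_section_measurable[OF that]] .
  \<comment> \<open>Measurability of the section of \<open>f\<close> is available for points of
    \<open>X\<close>; the comparison of the success events gets by with this because the output lies
    in \<open>X\<close>.\<close>
  have F': "expected_value \<Omega>' \<xi>' f x = ?F x" if "x \<in> X" for x
    unfolding expected_value_def integral'[OF f_section[OF that]] by (simp add: J0)
  have "prob_space (distr \<Omega> W J)"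
    using J by (rule prob_space_distr)
  then have prob': "prob_space \<Omega>'"
    unfolding \<Omega>'_def by (rule prob_space.prob_space_completion)
  interpret \<Omega>': prob_space \<Omega>'
    by (rule prob')
  interpret SP: stochastic_program \<Omega>' m d \<Xi> \<xi>' B X f xstar
  proof (intro stochastic_program.intro stochastic_program_axioms.intro prob')
    show "complete_measure \<Omega>'"
      unfolding \<Omega>'_def by (rule completion.complete_measure_axioms)
    show "\<xi>' \<in> \<Omega>' \<rightarrow>\<^sub>M Borel_on m \<Xi>"
      using completed[OF xi'] by (simp add: S_def)
    show "integrable \<Omega>' (\<lambda>w. f x (\<xi>' w))" if "x \<in> X" for x
      using F_finite[OF that] by (simp add: integrable'[OF f_section[OF that]] J0)
    show "expected_value \<Omega>' \<xi>' f xstar \<le> expected_value \<Omega>' \<xi>' f x" if "x \<in> X" for x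
      using xstar_minimizer[OF that] by (simp add: F' that xstar_in_X)
  qed (fact Xi_borel B_open B_convex X_subset X_nonempty X_closed X_convex f_measurable xstar_in_X)+
  have sample': "sample N \<xi>s' \<in> W \<rightarrow>\<^sub>M (\<Pi>\<^sub>M j\<in>{1..N}. S)"
    unfolding sample_def[abs_def] by (intro measurable_restrict xis')
  have iid': "iid_sample \<Omega>' (Borel_on m \<Xi>) \<xi>' N \<xi>s'"
    unfolding iid_sample_def S_def[symmetric]
  proof (intro conjI ballI)
    have eq: "distr \<Omega>' S \<xi>' = distr \<Omega> S \<xi>"
      unfolding distr'[OF xi'] J0 ..
    have eqj: "distr \<Omega>' S (\<xi>s' j) = distr \<Omega> S (\<xi>s j)" if "j \<in> {1..N}" for j
      unfolding distr'[OF xis'[OF that]] Jj[OF that] ..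
    show "distr \<Omega>' S (\<xi>s' j) = distr \<Omega>' S \<xi>'" if "j \<in> {1..N}" for j
      using iid that unfolding eq eqj[OF that] by (simp add: iid_sample_def S_def)
    have ne: "{1..N} \<noteq> {}"
      using 1(18) by simp
    \<comment> \<open>Independence passes through its characterization by a product joint law, since
      the sample has the same law on both spaces.\<close>
    have "distr \<Omega>' (\<Pi>\<^sub>M j\<in>{1..N}. S) (sample N \<xi>s') = distr \<Omega> (\<Pi>\<^sub>M j\<in>{1..N}. S) (sample N \<xi>s)"
      unfolding distr'[OF sample'] Jsample ..
    also have "\<dots> = (\<Pi>\<^sub>M j\<in>{1..N}. distr \<Omega> S (\<xi>s j))"
      using iid indep_vars_iff_distr_eq_PiM'[where I="{1..N}" and M'="\<lambda>_. S" and X=\<xi>s] xis ne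
      by (simp add: iid_sample_def S_def sample_def[abs_def])
    also have "\<dots> = (\<Pi>\<^sub>M j\<in>{1..N}. distr \<Omega>' S (\<xi>s' j))"
      by (intro PiM_cong) (simp_all add: eqj)
    finally show "\<Omega>'.indep_vars (\<lambda>_. S) \<xi>s' {1..N}"
      using \<Omega>'.indep_vars_iff_distr_eq_PiM'[where I="{1..N}" and M'="\<lambda>_. S" and X=\<xi>s'] completed[OF xis'] ne
      by (simp add: sample_def[abs_def])
  qed
  have M': "(\<lambda>w. M (\<xi>' w)) \<in> borel_measurable W"
    using xi' 1(21) unfolding S_def by (rule measurable_compose)
  have Lp: "Lp_norm_le \<Omega> p (\<lambda>\<omega>. M (\<xi> \<omega>)) \<psi> \<longleftrightarrow> Lp_norm_le \<Omega>' p (\<lambda>w. M (\<xi>' w)) \<psi>" for p \<psi>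
  proof -
    have "(\<lambda>w. \<bar>M (\<xi>' w)\<bar> powr p) \<in> borel_measurable W"
      using M' by measurable
    then show ?thesis
      by (simp add: Lp_norm_le_def integral' integrable' J0)
  qed
  have tails: "measure \<Omega> {\<omega> \<in> space \<Omega>. t \<le> M (\<xi> \<omega>)} = measure \<Omega>' {w \<in> space \<Omega>'. t \<le> M (\<xi>' w)}" for t
  proof -
    have "{w \<in> space W. t \<le> M (\<xi>' w)} \<in> sets W"
      using M' by measurable
    from measure'[OF this] show ?thesis
      by (simp add: J0)
  qed
  have success: "measure \<Omega> {\<omega> \<in> space \<Omega>. ?F (xt (sample N \<xi>s \<omega>)) - ?F xstar \<le> \<epsilon>}
      = measure \<Omega>' {w \<in> space \<Omega>'. expected_value \<Omega>' \<xi>' f (xt (sample N \<xi>s' w)) - expected_value \<Omega>' \<xi>' f xstar \<le> \<epsilon>}"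
  proof -
    have "xt \<in> (\<Pi>\<^sub>M j\<in>{1..N}. S) \<rightarrow>\<^sub>M Borel_on d X"
      using sol unfolding approximate_solution_def S_def by blast
    then have xtB: "xt \<in> (\<Pi>\<^sub>M j\<in>{1..N}. S) \<rightarrow>\<^sub>M Borel_on d B"
      using X_subset by (rule measurable_Borel_on_mono)
    have "(\<lambda>w. expected_value \<Omega>' \<xi>' f (xt (sample N \<xi>s' w))) \<in> borel_measurable W"
      using measurable_compose[OF measurable_compose[OF sample' xtB] SP.expected_value_measurable] .
    then have "{w \<in> space W. expected_value \<Omega>' \<xi>' f (xt (sample N \<xi>s' w)) - expected_value \<Omega>' \<xi>' f xstar \<le> \<epsilon>} \<in> sets W"
      by measurable
    note measure'[OF this]
    moreover have "expected_value \<Omega>' \<xi>' f (xt (sample N \<xi>s \<omega>)) = ?F (xt (sample N \<xi>s \<omega>))" if "\<omega> \<in> space \<Omega>" for \<omega>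
    proof -
      have "sample N \<xi>s \<omega> \<in> (\<Pi>\<^sub>E j\<in>{1..N}. \<Xi>)"
        using measurable_space[OF sample_measurable[OF iid] that] by (simp add: space_PiM space_Xi)
      from F'[OF approximate_solution_in[OF sol this]] show ?thesis .
    qed
    ultimately show ?thesis
      by (simp add: Jsample F' xstar_in_X cong: conj_cong)
  qed
  note H' = H[unfolded sample_complexity_constants_def Let_def, rule_format]
  show ?case
    unfolding Lp tails success
    by (rule H'[OF SP.stochastic_program_axioms 1(2) iid']) (use 1(4-) in blast)+
qed

theorem proposition1:
  shows "(\<exists>C3>0. \<exists>C4>0. \<exists>C5>0.
            sample_complexity_constants TYPE(nat \<Rightarrow> nat \<Rightarrow> real) C3 C4 C5) \<and>
         (\<forall>C3>0. \<forall>C4>0. \<forall>C5>0.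
            sample_complexity_constants TYPE(nat \<Rightarrow> nat \<Rightarrow> real) C3 C4 C5 \<longrightarrow>
            sample_complexity_constants TYPE('w) C3 C4 C5)"
proof (intro conjI allI impI)
  show "\<exists>C3>0. \<exists>C4>0. \<exists>C5>0. sample_complexity_constants TYPE(nat \<Rightarrow> nat \<Rightarrow> real) C3 C4 C5"
    by (rule exI[of _ 50000], rule conjI, simp, rule exI[of _ 225000], rule conjI, simp,
        rule exI[of _ 75000], rule conjI, simp, rule sample_complexity_constants_explicit)
qed (rule sample_complexity_constants_transfer)

end
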